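(* Let $\Pi_n=\operatorname{conv}\{(\sigma(1),\dots,\sigma(n)) : \sigma\in \operatorname{Sym}(n)\}\subset\mathbb{R}^n$ be the regular permutahedron, whose vertices are identified with the permutations in $\operatorname{Sym}(n)$. A height function $w:\operatorname{Sym}(n)\to\mathbb{R}$ induces a permutahedral subdivision of $\Pi_n$ if and only if it induces a permutahedral subdivision of the $2$-skeleton of $\Pi_n$ (i.e. of every $2$-face of $\Pi_n$). That is, $w$ induces a permutahedral subdivision of $\Pi_n$ if and only if both of the following conditions hold: (HEX) for every hexagonal $2$-face of $\Pi_n$ with vertices $a,b,c,d,e,f$ (labeled cyclically), we have - (HXE) $w(a)+w(c)+w(e)=w(b)+w(d)+w(f)$, and - (HXM) the maximum in $\max\bigl(w(a)+w(d),\,w(b)+w(e),\,w(c)+w(f)\bigr)$ is attained at least twice; (SQR) for every square $2$-face of $\Pi_n$ with vertices $a,b,c,d$ (labeled cyclically), $w(a)+w(c)=w(b)+w(d)$.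
   Context: A generalized permutahedron in $\mathbb{R}^n$ is a convex polytope all of whose edges are parallel to $e_i-e_j$ for some $i\neq j$. A height function $w$ on the vertices of a polytope $P$ induces a regular subdivision of $P$ (with respect to its vertex set) by projecting the lower faces of the convex hull of the lifted points $(v,w(v))$. A subdivision of $P$ is called permutahedral if all its cells are generalized permutahedra. The height function $w$ restricts to the vertices of each face of $P$ and thus induces a subdivision of each face. Every $2$-face of $\Pi_n$ is either a hexagon or a square (quadrilateral). *)

theory Defs
  imports "HOL-Analysis.Analysis"
begin

text \<open>
  For an index type of class linorder, the coordinates of \<open>real ^ 'n\<close> are numbered
  \<open>1, \<dots>, CARD('n)\<close> in increasing order.
\<close>

definition coord_number :: "'n::{finite,linorder} \<Rightarrow> nat" where
  "coord_number i = card {j. j \<le> i}"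

definition Sym :: "nat \<Rightarrow> (nat \<Rightarrow> nat) set" where
  "Sym n = {\<sigma>. \<sigma> permutes {1..n}}"

definition perm_point :: "(nat \<Rightarrow> nat) \<Rightarrow> real ^ ('n::{finite,linorder})" where
  "perm_point \<sigma> = (\<chi> i. real (\<sigma> (coord_number i)))"

definition permutahedron :: "(real ^ ('n::{finite,linorder})) set" where
  "permutahedron = convex hull (perm_point ` Sym CARD('n))"

definition generalized_permutahedron :: "(real ^ 'n) set \<Rightarrow> bool" where
  "generalized_permutahedron P \<longleftrightarrow>
     polytope P \<and>
     (\<forall>E. E edge_of P \<longrightarrow>
        (\<exists>i j. i \<noteq> j \<and> (\<forall>x\<in>E. \<forall>y\<in>E. \<exists>c. x - y = c *\<^sub>R (axis i 1 - axis j 1))))"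

definition lifted_polytope :: "'a::euclidean_space set \<Rightarrow> ('a \<Rightarrow> real) \<Rightarrow> ('a \<times> real) set" where
  "lifted_polytope P h = convex hull {(v, h v) | v. v extreme_point_of P}"

text \<open>A face is lower if it has an inner normal vector with positive last coordinate.\<close>

definition lower_face :: "('a::euclidean_space \<times> real) set \<Rightarrow> ('a \<times> real) set \<Rightarrow> bool" where
  "lower_face F Q \<longleftrightarrow>
     F face_of Q \<and> F \<noteq> {} \<and>
     (\<exists>u s b. s > 0 \<and> (\<forall>z\<in>Q. (u, s) \<bullet> z \<ge> b) \<and> F = {z \<in> Q. (u, s) \<bullet> z = b})"

definition regular_subdivision :: "'a::euclidean_space set \<Rightarrow> ('a \<Rightarrow> real) \<Rightarrow> 'a set set" where
  "regular_subdivision P h = {fst ` F | F. lower_face F (lifted_polytope P h)}"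

definition permutahedral :: "(real ^ 'n) set set \<Rightarrow> bool" where
  "permutahedral S \<longleftrightarrow> (\<forall>C\<in>S. generalized_permutahedron C)"

lemma bij_betw_coord_number:
  "bij_betw (coord_number :: 'n::{finite,linorder} \<Rightarrow> nat) UNIV {1..CARD('n)}"
proof -
  have less: "coord_number i < coord_number j" if "i < j" for i j :: 'n
    unfolding coord_number_def using that by (intro psubset_card_mono) force+
  have inj: "inj (coord_number :: 'n \<Rightarrow> nat)"
    by (metis injI less less_irrefl linorder_neqE)
  have "coord_number i \<in> {1..CARD('n)}" for i :: 'n
  proof -
    have "0 < card {j. j \<le> i}" by (subst card_gt_0_iff) auto
    moreover have "card {j. j \<le> i} \<le> CARD('n)" by (intro card_mono) auto
    ultimately show ?thesis unfolding coord_number_def by simp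
  qed
  then have sub: "range (coord_number :: 'n \<Rightarrow> nat) \<subseteq> {1..CARD('n)}" by blast
  have "card (range (coord_number :: 'n \<Rightarrow> nat)) = card {1..CARD('n)}"
    using inj by (simp add: card_image)
  with sub inj show ?thesis
    unfolding bij_betw_def by (metis card_subset_eq finite_atLeastAtMost)
qed

lemma inj_on_perm_point:
  "inj_on (perm_point :: _ \<Rightarrow> real ^ ('n::{finite,linorder})) (Sym CARD('n))"
proof (rule inj_onI)
  fix \<sigma> \<tau>
  assume perm: "\<sigma> \<in> Sym CARD('n)" "\<tau> \<in> Sym CARD('n)"
    and eq: "(perm_point \<sigma> :: real ^ 'n::{finite,linorder}) = perm_point \<tau>"
  show "\<sigma> = \<tau>"
  proof
    fix k
    show "\<sigma> k = \<tau> k"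
    proof (cases "k \<in> {1..CARD('n)}")
      case True
      then obtain i :: 'n where "k = coord_number i"
        using bij_betw_coord_number unfolding bij_betw_def by (metis imageE)
      with eq show ?thesis by (simp add: perm_point_def vec_eq_iff)
    next
      case False
      with perm show ?thesis unfolding Sym_def by (simp add: permutes_not_in)
    qed
  qed
qed

text \<open>
  The identification of the vertices with permutations: \<open>w\<close> as a function on points. By
  injectivity of \<open>perm_point\<close>, it sends \<open>perm_point \<sigma>\<close> to \<open>w \<sigma>\<close>.
\<close>

definition vertex_height ::
  "((nat \<Rightarrow> nat) \<Rightarrow> real) \<Rightarrow> real ^ ('n::{finite,linorder}) \<Rightarrow> real" where
  "vertex_height w v = w (inv_into (Sym CARD('n)) perm_point v)"

lemma vertex_height_perm_point:
  "\<sigma> \<in> Sym CARD('n) \<Longrightarrow>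
     vertex_height w (perm_point \<sigma> :: real ^ ('n::{finite,linorder})) = w \<sigma>"
  by (simp add: vertex_height_def inv_into_f_f inj_on_perm_point)

definition induces_permutahedral_subdivision ::
  "((nat \<Rightarrow> nat) \<Rightarrow> real) \<Rightarrow> (real ^ ('n::{finite,linorder})) set \<Rightarrow> bool" where
  "induces_permutahedral_subdivision w P \<longleftrightarrow>
     permutahedral (regular_subdivision P (vertex_height w))"

definition two_face :: "(real ^ 'n) set \<Rightarrow> (real ^ 'n) set \<Rightarrow> bool" where
  "two_face F P \<longleftrightarrow> F face_of P \<and> aff_dim F = 2"

text \<open>
  The list \<open>xs\<close> enumerates the vertices of the polygon \<open>F\<close>, without repetition, in cyclic order.
\<close>

definition cyclic_labelling ::
  "(real ^ ('n::{finite,linorder})) set \<Rightarrow> (nat \<Rightarrow> nat) list \<Rightarrow> bool" where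
  "cyclic_labelling F xs \<longleftrightarrow>
     distinct xs \<and> set xs \<subseteq> Sym CARD('n) \<and>
     perm_point ` set xs = {v. v extreme_point_of F} \<and>
     (\<forall>i < length xs.
        closed_segment (perm_point (xs ! i)) (perm_point (xs ! (Suc i mod length xs))) edge_of F)"

definition max_attained_twice :: "real \<Rightarrow> real \<Rightarrow> real \<Rightarrow> bool" where
  "max_attained_twice x y z \<longleftrightarrow>
     (let m = max x (max y z) in (x = m \<and> y = m) \<or> (x = m \<and> z = m) \<or> (y = m \<and> z = m))"

end

theory Submission
  imports Defs "HOL-Combinatorics.Multiset_Permutations"
begin

text \<open>
  The vertices of \<open>\<Pi>\<^sub>n\<close> are the complete flags of subsets of the coordinate set. The square condition
  and (HXE) say that the height of a flag is the sum of a set function \<open>\<mu>\<close> over its members, and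
  (HXM) turns into the three-term incidence relations for \<open>\<mu>\<close>. These imply the three-term Pluecker
  relations, hence (by Murota's local-to-global argument) the exchange property of valuated matroids
  on every level. It follows that a flag which is minimal among its transposes is a global minimum,
  also after adding a linear functional. Consequently an edge of a cell is parallel to a root:
  otherwise one of its ends is strictly smaller than all its transposes, so a small tilt towards the
  other end keeps it locally, but not globally, minimal.

  Conversely, cells of a face are cells of \<open>\<Pi>\<^sub>n\<close> (tilt by a large multiple of a normal of the face), and in
  a hexagon or a square the conditions say exactly that no cell is a short diagonal, respectively a
  diagonal.
\<close>

subsection \<open>Exchange and local minimality of flags\<close>

definition flag_sum :: "('a set \<Rightarrow> real) \<Rightarrow> 'a list \<Rightarrow> real" where
  "flag_sum \<mu> xs = (\<Sum>k\<le>length xs. \<mu> (set (take k xs)))"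

text \<open>Taken for all orders of \<open>i\<close>, \<open>j\<close>, \<open>k\<close>, the
  inequality says that the minimum of the three sums of a singleton extension and the complementary
  pair extension of \<open>S\<close> is attained at least twice. These are the tropical incidence
  relations between consecutive levels of a flag of valuated matroids, in the convention for
  minima.\<close>

definition three_term :: "'a set \<Rightarrow> ('a set \<Rightarrow> real) \<Rightarrow> bool" where
  "three_term A \<mu> \<longleftrightarrow>
     (\<forall>S i j k. S \<subseteq> A \<and> {i, j, k} \<subseteq> A - S \<and> distinct [i, j, k] \<longrightarrow>
        min (\<mu> (insert j S) + \<mu> (insert i (insert k S))) (\<mu> (insert k S) + \<mu> (insert i (insert j S)))
          \<le> \<mu> (insert i S) + \<mu> (insert j (insert k S)))"

lemma three_termD:
  assumes "three_term A \<mu>" "S \<subseteq> A" "i \<in> A - S" "j \<in> A - S" "k \<in> A - S" "i \<noteq> j" "i \<noteq> k" "j \<noteq> k"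
  shows "min (\<mu> (insert j S) + \<mu> (insert i (insert k S))) (\<mu> (insert k S) + \<mu> (insert i (insert j S)))
          \<le> \<mu> (insert i S) + \<mu> (insert j (insert k S))"
  using assms unfolding three_term_def by auto

text \<open>
  After subtracting the singleton values, the three-term relations turn the pair values into an
  ultrametric on four points, and the four-term relation is its four-point condition.
\<close>

lemma four_term:
  assumes T: "three_term A \<mu>" and S: "S \<subseteq> A" "i \<in> A - S" "j \<in> A - S" "k \<in> A - S" "l \<in> A - S"
    and d: "distinct [i, j, k, l]"
  shows "min (\<mu> (insert i (insert k S)) + \<mu> (insert j (insert l S)))
             (\<mu> (insert i (insert l S)) + \<mu> (insert j (insert k S)))
         \<le> \<mu> (insert i (insert j S)) + \<mu> (insert k (insert l S))"
proof -
  define x where "x a b = \<mu> (insert a (insert b S)) - \<mu> (insert a S) - \<mu> (insert b S)" for a b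
  have sym: "x a b = x b a" for a b
    unfolding x_def by (simp add: insert_commute)
  have ultra: "min (x a c) (x a b) \<le> x b c"
    if "a \<in> A - S" "b \<in> A - S" "c \<in> A - S" "distinct [a, b, c]" for a b c
    using three_termD[OF T S(1), of a b c] that unfolding x_def by (auto simp: min_le_iff_disj)
  have "min (x i k) (x j k) \<le> x i j"
    using ultra[of k j i] S d by (auto simp: sym[of i k] sym[of j k] sym[of i j])
  moreover have "min (x i l) (x j l) \<le> x i j"
    using ultra[of l j i] S d by (auto simp: sym[of i l] sym[of j l] sym[of i j])
  moreover have "min (x i k) (x i l) \<le> x k l" "min (x j k) (x j l) \<le> x k l"
    using ultra[of i l k] ultra[of j l k] S d by (auto simp: sym[of k l])
  ultimately have "min (x i k + x j l) (x i l + x j k) \<le> x i j + x k l"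
    by (auto simp: min_le_iff_disj)
  then show ?thesis
    unfolding x_def by (auto simp: min_le_iff_disj)
qed

lemma card_exchange:
  assumes "finite Y" "v \<in> Y" "u \<notin> Y"
  shows "card (insert u (Y - {v})) = card Y"
  using assms card_Suc_Diff1[of Y v] by simp

text \<open>The exchange axiom of valuated matroids, for minima. The induction is on the distance of
  \<open>Y\<close> from \<open>X\<close>: \<open>Y\<close> is moved towards \<open>X\<close> by
  inserting some \<open>u0\<close> other than \<open>u\<close>, the induction hypothesis gives an
  exchange there, and the four-term relation carries it back to \<open>Y\<close>.\<close>

lemma valuated_exchange:
  assumes T: "three_term A \<mu>" and fin: "finite A" and X: "X \<subseteq> A"
    and u: "u \<in> X" and Y: "Y \<subseteq> A" "card Y = card X" "u \<notin> Y"
  shows "\<exists>v\<in>Y - X. \<mu> (insert v (X - {u})) + \<mu> (insert u (Y - {v})) \<le> \<mu> X + \<mu> Y"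
  using Y
proof (induction "card (Y - X)" arbitrary: Y rule: less_induct)
  case less
  have finX: "finite X" and finY: "finite Y"
    using X less.prems fin finite_subset by blast+
  have cards: "card (X - Y) = card (Y - X)"
    using finX finY less.prems(2) by (intro card_le_sym_Diff[THEN antisym] card_le_sym_Diff) auto
  \<comment> \<open>\<open>q v\<close> is the price of replacing \<open>u\<close> by
    \<open>v\<close> in \<open>X\<close>. The negated claim says that the reverse replacement in
    \<open>Y\<close> never gains that much.\<close>
  define q where "q v = \<mu> (insert v (X - {u})) - \<mu> X" for v
  show ?case
  proof (rule ccontr)
    assume "\<not> ?thesis"
    then have fail: "\<mu> Y < q v + \<mu> (insert u (Y - {v}))" if "v \<in> Y - X" for v
      using that unfolding q_def by force
    have "Y - X \<noteq> {}"
      using cards u less.prems(3) finX by (metis DiffI card_0_eq card.empty empty_iff finite_Diff)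
    show False
    proof (cases "X - Y = {u}")
      case True
      then obtain v where v: "Y - X = {v}"
        using cards by (metis card_1_singletonE is_singletonI is_singleton_altdef)
      \<comment> \<open>The only possible exchange interchanges \<open>X\<close> and
        \<open>Y\<close>, so it leaves the total unchanged.\<close>
      have "insert v (X - {u}) = Y" "insert u (Y - {v}) = X"
        using True v by blast+
      with fail[of v] v show False
        unfolding q_def by simp
    next
      case False
      then obtain u0 where u0: "u0 \<in> X - Y" "u0 \<noteq> u"
        using u less.prems(3) by blast
      \<comment> \<open>The element to be given up for \<open>u0\<close> is chosen with its price
        included; this is what allows \<open>v0\<close> to be compared with the \<open>v\<close> of
        the induction hypothesis.\<close>
      define e where "e v = \<mu> (insert u0 (Y - {v})) + q v" for v
      define v0 where "v0 = arg_min_on e (Y - X)"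
      have v0: "v0 \<in> Y - X"
        using \<open>Y - X \<noteq> {}\<close> finY arg_min_if_finite(1)[of "Y - X" e] unfolding v0_def by auto
      have v0_min: "e v0 \<le> e v" if "v \<in> Y - X" for v
        using that \<open>Y - X \<noteq> {}\<close> finY arg_min_least[of "Y - X" v e]
        unfolding v0_def by auto
      define Z where "Z = insert u0 (Y - {v0})"
      have ZX: "Z - X = Y - X - {v0}"
        using u0 v0 unfolding Z_def by blast
      have "card (Z - X) < card (Y - X)"
        unfolding ZX using v0 finY by (metis card_Diff1_less finite_Diff)
      moreover have "Z \<subseteq> A" "u \<notin> Z"
        using u0 X less.prems unfolding Z_def by auto
      moreover have "card Z = card X"
        using u0 v0 less.prems(2) card_exchange[OF finY] unfolding Z_def by (metis DiffD1 DiffD2)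
      ultimately obtain v where v: "v \<in> Z - X"
        and le: "\<mu> (insert v (X - {u})) + \<mu> (insert u (Z - {v})) \<le> \<mu> X + \<mu> Z"
        using less.hyps[of Z] by blast
      define S where "S = Y - {v, v0}"
      have vY: "v \<in> Y - X" "v \<noteq> v0"
        using v ZX by auto
      have sets: "Y = insert v (insert v0 S)" "insert u (Z - {v}) = insert u (insert u0 S)"
        "Z = insert v (insert u0 S)" "insert u (Y - {v}) = insert v0 (insert u S)"
        "insert u (Y - {v0}) = insert v (insert u S)" "insert u0 (Y - {v}) = insert v0 (insert u0 S)"
        using vY v0 u0 u unfolding S_def Z_def by auto
      \<comment> \<open>If the first sum is the smaller one, failure at \<open>v0\<close> and the
        minimality of \<open>e v0\<close> are violated; if the second is, failure at
        \<open>v\<close>. Both cases use the inequality of the induction hypothesis for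
        \<open>Z\<close>.\<close>
      have "min (\<mu> (insert v (insert u S)) + \<mu> (insert v0 (insert u0 S)))
             (\<mu> (insert v (insert u0 S)) + \<mu> (insert v0 (insert u S)))
         \<le> \<mu> (insert v (insert v0 S)) + \<mu> (insert u (insert u0 S))"
        using vY v0 u0 u less.prems X unfolding S_def
        by (intro four_term[OF T]) auto
      then have "min (\<mu> (insert u (Y - {v0})) + \<mu> (insert u0 (Y - {v})))
             (\<mu> Z + \<mu> (insert u (Y - {v}))) \<le> \<mu> Y + \<mu> (insert u (Z - {v}))"
        using sets by simp
      moreover have "e v0 = \<mu> Z + q v0" "e v = \<mu> (insert u0 (Y - {v})) + q v"
        unfolding e_def Z_def by auto
      ultimately show False
        using fail[OF vY(1)] fail[OF v0] v0_min[OF vY(1)] le unfolding q_def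
        by (auto simp: min_le_iff_disj)
    qed
  qed
qed

text \<open>An exchange moves \<open>Y\<close> towards \<open>X\<close>. By \<open>loc\<close> it
  does not lower the value on the side of \<open>X\<close>, so it does not raise the value on the
  side of \<open>Y\<close>, and the induction continues from the new \<open>Y\<close>.\<close>

lemma valuated_local_min:
  assumes T: "three_term A \<mu>" and fin: "finite A" and X: "X \<subseteq> A"
    and loc: "\<And>u v. u \<in> X \<Longrightarrow> v \<in> A - X \<Longrightarrow> \<mu> X \<le> \<mu> (insert v (X - {u}))"
    and Y: "Y \<subseteq> A" "card Y = card X"
  shows "\<mu> X \<le> \<mu> Y"
  using Y
proof (induction "card (Y - X)" arbitrary: Y rule: less_induct)
  case less
  have finX: "finite X" and finY: "finite Y"
    using X less.prems fin finite_subset by blast+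
  show ?case
  proof (cases "X \<subseteq> Y")
    case True
    then show ?thesis
      using finY less.prems by (metis card_subset_eq order_refl)
  next
    case False
    then obtain u where u: "u \<in> X" "u \<notin> Y"
      by blast
    obtain v where v: "v \<in> Y - X"
      and le: "\<mu> (insert v (X - {u})) + \<mu> (insert u (Y - {v})) \<le> \<mu> X + \<mu> Y"
      using valuated_exchange[OF T fin X u(1) less.prems u(2)] by blast
    define Z where "Z = insert u (Y - {v})"
    have "Z - X = Y - X - {v}"
      using u unfolding Z_def by blast
    then have "card (Z - X) < card (Y - X)"
      using v finY by (metis card_Diff1_less finite_Diff)
    moreover have "Z \<subseteq> A"
      using u X less.prems unfolding Z_def by auto
    moreover have "card Z = card X"
      using u v less.prems(2) card_exchange[OF finY] unfolding Z_def by (metis DiffD1 DiffD2)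
    ultimately have "\<mu> X \<le> \<mu> Z"
      using less.hyps[of Z] by blast
    moreover have "\<mu> X \<le> \<mu> (insert v (X - {u}))"
      using loc[of u v] u v less.prems by blast
    ultimately show ?thesis
      using le unfolding Z_def by linarith
  qed
qed

section \<open>Transpositions of flags and their effect on the levels\<close>

definition swap_nth :: "nat \<Rightarrow> nat \<Rightarrow> 'a list \<Rightarrow> 'a list" where
  "swap_nth i j xs = xs[i := xs ! j, j := xs ! i]"

lemma swap_nth_permutations:
  assumes "xs \<in> permutations_of_set A" "i < length xs" "j < length xs"
  shows "swap_nth i j xs \<in> permutations_of_set A"
proof -
  have "mset (swap_nth i j xs) = mset xs"
    unfolding swap_nth_def using assms by (simp add: mset_swap)
  then show ?thesis
    using assms mset_eq_setD mset_eq_imp_distinct_iff unfolding permutations_of_set_def by blast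
qed

text \<open>A prefix changes as a set only if it contains exactly one of the two positions.\<close>

lemma take_swap_nth:
  assumes "distinct xs" "i < j" "j < length xs"
  shows "set (take k (swap_nth i j xs)) =
    (if i < k \<and> k \<le> j then insert (xs ! j) (set (take k xs) - {xs ! i}) else set (take k xs))"
proof -
  consider "k \<le> i" | "i < k" "k \<le> j" | "j < k"
    by linarith
  then show ?thesis
  proof cases
    case 1
    then show ?thesis unfolding swap_nth_def using assms by simp
  next
    case 2
    then have "take k (swap_nth i j xs) = (take k xs)[i := xs ! j]"
      unfolding swap_nth_def using assms by (simp add: take_update_swap list_update_beyond)
    moreover have "set ((take k xs)[i := xs ! j]) = insert (xs ! j) (set (take k xs) - {take k xs ! i})"
      using 2 assms by (intro set_update_distinct) auto
    ultimately show ?thesis using 2 by simp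
  next
    case 3
    then have "take k (swap_nth i j xs) = swap_nth i j (take k xs)"
      unfolding swap_nth_def using assms by (simp add: take_update_swap)
    moreover have "mset (swap_nth i j (take k xs)) = mset (take k xs)"
      unfolding swap_nth_def using assms 3 mset_swap[of j "take k xs" i] by (simp add: list_update_swap)
    ultimately have "set (take k (swap_nth i j xs)) = set (take k xs)"
      using mset_eq_setD by metis
    then show ?thesis using 3 by simp
  qed
qed

text \<open>Minimality among transposes is split into local minimality on each level
  (\<open>d_nonneg\<close>); \<open>valuated_local_min\<close> then applies level by level, so the
  flag minimizes every summand.\<close>

lemma flag_sum_local_min:
  assumes T: "three_term A \<mu>" and xs: "xs \<in> permutations_of_set A"
    and loc: "\<And>i j. i < j \<Longrightarrow> j < length xs \<Longrightarrow> flag_sum \<mu> xs \<le> flag_sum \<mu> (swap_nth i j xs)"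
    and ys: "ys \<in> permutations_of_set A"
  shows "flag_sum \<mu> xs \<le> flag_sum \<mu> ys"
proof -
  define B where "B k = set (take k xs)" for k
  define d where "d k i j = \<mu> (insert (xs ! j) (B k - {xs ! i})) - \<mu> (B k)" for k i j
  have dist: "distinct xs" "set xs = A"
    using xs unfolding permutations_of_set_def by auto
  have fin: "finite A"
    using dist by auto
  have BA: "B k \<subseteq> A" for k
    unfolding B_def using dist set_take_subset by fast
  have in_B: "xs ! i \<in> B k \<longleftrightarrow> i < k" if "i < length xs" for i k
    unfolding B_def using that dist by (auto simp: in_set_conv_nth nth_eq_iff_index_eq)
  have B_Suc: "B (Suc k) = insert (xs ! k) (B k)" if "k < length xs" for k
    unfolding B_def using that by (simp add: take_Suc_conv_app_nth)
  \<comment> \<open>\<open>d k i j\<close> is the change on level \<open>k\<close> under the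
    transposition of \<open>i\<close> and \<open>j\<close>. The hypothesis controls only the sum of
    these changes over \<open>k\<close>; the induction on \<open>j - i\<close> isolates the single
    terms.\<close>
  have d_nonneg: "0 \<le> d k i j" if "i < k" "k \<le> j" "j < length xs" for i j k
    using that
  proof (induction "j - i" arbitrary: i j k rule: less_induct)
    case less
    define I J where "I = xs ! i" and "J = xs ! j"
    \<comment> \<open>The shorter ranges give \<mu>(S+I) + \<mu>(S+I+K) \<le> \<mu>(S+K) +
      \<mu>(S+I+J). If one of the two changes is negative, the right-hand side is therefore not the
      minimum of the three-term relation. The other two sums must then agree, which says that the
      two changes are equal.\<close>
    have neg_step: "d (Suc k) i j < 0 \<longleftrightarrow> d k i j < 0" if k: "i < k" "k < j" for k
    proof -
      define K where "K = xs ! k"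
      define S where "S = B k - {I}"
      have kl: "i < length xs" "k < length xs" "j < length xs"
        using k less.prems by auto
      have neq: "I \<noteq> J" "I \<noteq> K" "J \<noteq> K"
        unfolding I_def J_def K_def using k kl dist by (auto simp: nth_eq_iff_index_eq)
      have mem: "I \<in> A - S" "J \<in> A - S" "K \<in> A - S"
        unfolding I_def J_def K_def S_def using kl k dist in_B by auto
      have B: "B k = insert I S" "B (Suc k) = insert I (insert K S)"
        unfolding S_def using in_B[of i k] B_Suc[of k] kl k unfolding I_def K_def by auto
      have z: "0 \<le> d k i k" "0 \<le> d (Suc k) k j"
        using less.hyps[of k i k] less.hyps[of j k "Suc k"] k kl by auto
      have "S \<subseteq> A"
        unfolding S_def using BA by blast
      note T' = three_termD[OF T this]
      have sets: "insert (xs ! j) (B (Suc k) - {xs ! i}) = insert J (insert K S)"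
        "insert (xs ! j) (B k - {xs ! i}) = insert J S"
        "insert (xs ! k) (B k - {xs ! i}) = insert K S"
        "insert (xs ! j) (B (Suc k) - {xs ! k}) = insert J (insert I S)"
        unfolding B I_def[symmetric] J_def[symmetric] K_def[symmetric] using neq mem by auto
      show ?thesis
        using z T'[of I J K] T'[of J I K] mem neq unfolding d_def sets unfolding B
        by (auto simp: insert_commute min_le_iff_disj)
    qed
    have all: "d k' i j < 0" if "d k i j < 0" "i < k'" "k' \<le> j" for k'
    proof -
      have base: "d k' i j < 0 \<longleftrightarrow> d (Suc i) i j < 0" if "Suc i \<le> k'" "k' \<le> j" for k'
        using that
      proof (induction k' rule: dec_induct)
        case base
        then show ?case by simp
      next
        case (step m)
        then show ?case using neg_step[of m] by simp
      qed
      show ?thesis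
        using that base[of k] base[of k'] less.prems by simp
    qed
    have len_swap: "length (swap_nth i j xs) = length xs"
      unfolding swap_nth_def by simp
    have "flag_sum \<mu> (swap_nth i j xs) - flag_sum \<mu> xs =
        (\<Sum>k\<le>length xs. \<mu> (set (take k (swap_nth i j xs))) - \<mu> (set (take k xs)))"
      unfolding flag_sum_def len_swap by (rule sum_subtractf[symmetric])
    also have "\<dots> = (\<Sum>k\<le>length xs. if k \<in> {i<..j} then d k i j else 0)"
      using less.prems dist unfolding d_def B_def by (intro sum.cong) (simp_all add: take_swap_nth)
    also have "\<dots> = (\<Sum>k\<in>{i<..j}. d k i j)"
      using less.prems by (subst sum.inter_restrict[symmetric]) (auto intro!: sum.cong)
    finally have "0 \<le> (\<Sum>k\<in>{i<..j}. d k i j)"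
      using loc[of i j] less.prems by simp
    \<comment> \<open>One negative change spreads to all levels of the range and would make the sum
      negative.\<close>
    moreover have "(\<Sum>k\<in>{i<..j}. d k i j) < 0" if "d k i j < 0"
      using sum_strict_mono[of "{i<..j}" "\<lambda>k. d k i j" "\<lambda>_. 0"] all[OF that] less.prems by simp
    ultimately show ?case
      by force
  qed
  have len: "length ys = length xs"
    using xs ys length_finite_permutations_of_set by metis
  have "\<mu> (set (take k xs)) \<le> \<mu> (set (take k ys))" if k: "k \<le> length xs" for k
  proof (rule valuated_local_min[OF T fin])
    show "set (take k xs) \<subseteq> A" "set (take k ys) \<subseteq> A"
      using xs ys set_take_subset unfolding permutations_of_set_def by fast+
    show "card (set (take k ys)) = card (set (take k xs))"
      using xs ys len k unfolding permutations_of_set_def by (simp add: distinct_card)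
    fix u v assume u: "u \<in> set (take k xs)" and v: "v \<in> A - set (take k xs)"
    obtain i where i: "u = xs ! i" "i < length xs" "i < k"
      using u by (auto simp: in_set_conv_nth)
    obtain j where j: "v = xs ! j" "j < length xs"
      using v dist by (auto simp: in_set_conv_nth)
    have "k \<le> j"
      using v j in_B[of j k] unfolding B_def by auto
    then show "\<mu> (set (take k xs)) \<le> \<mu> (insert v (set (take k xs) - {u}))"
      using d_nonneg[of i k j] i j unfolding d_def B_def by simp
  qed
  then show ?thesis
    unfolding flag_sum_def len by (intro sum_mono) simp
qed

subsection \<open>Heights of flags as sums of a set function\<close>

definition square_additive :: "'a set \<Rightarrow> ('a list \<Rightarrow> real) \<Rightarrow> bool" where
  "square_additive A g \<longleftrightarrow>
     (\<forall>p a b q c d r. p @ a # b # q @ c # d # r \<in> permutations_of_set A \<longrightarrow>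
        g (p @ a # b # q @ c # d # r) + g (p @ b # a # q @ d # c # r)
          = g (p @ b # a # q @ c # d # r) + g (p @ a # b # q @ d # c # r))"

definition hexagon_additive :: "'a set \<Rightarrow> ('a list \<Rightarrow> real) \<Rightarrow> bool" where
  "hexagon_additive A g \<longleftrightarrow>
     (\<forall>p i j k q. p @ i # j # k # q \<in> permutations_of_set A \<longrightarrow>
        g (p @ i # j # k # q) + g (p @ j # k # i # q) + g (p @ k # i # j # q)
          = g (p @ j # i # k # q) + g (p @ k # j # i # q) + g (p @ i # k # j # q))"

definition hexagon_max :: "'a set \<Rightarrow> ('a list \<Rightarrow> real) \<Rightarrow> bool" where
  "hexagon_max A g \<longleftrightarrow>
     (\<forall>p i j k q. p @ i # j # k # q \<in> permutations_of_set A \<longrightarrow>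
        max_attained_twice (g (p @ i # j # k # q) + g (p @ k # j # i # q))
          (g (p @ j # i # k # q) + g (p @ k # i # j # q))
          (g (p @ j # k # i # q) + g (p @ i # k # j # q)))"

lemma square_additiveD:
  assumes "square_additive A g" "distinct (p @ a # b # q @ c # d # r)"
    "set (p @ a # b # q @ c # d # r) = A"
  shows "g (p @ a # b # q @ c # d # r) + g (p @ b # a # q @ d # c # r)
          = g (p @ b # a # q @ c # d # r) + g (p @ a # b # q @ d # c # r)"
  using assms unfolding square_additive_def permutations_of_set_def by blast

lemma hexagon_additiveD:
  assumes "hexagon_additive A g" "distinct (p @ i # j # k # q)" "set (p @ i # j # k # q) = A"
  shows "g (p @ i # j # k # q) + g (p @ j # k # i # q) + g (p @ k # i # j # q)
          = g (p @ j # i # k # q) + g (p @ k # j # i # q) + g (p @ i # k # j # q)"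
  using assms unfolding hexagon_additive_def permutations_of_set_def by blast

text \<open>Adjacent transpositions connect all arrangements of \<open>S\<close>: the head of
  \<open>xs\<close> is carried to the front of \<open>ys\<close>, and the induction rearranges what
  stands behind it.\<close>

lemma adjacent_swap_invariant:
  assumes "\<And>p a b q. distinct (p @ a # b # q) \<Longrightarrow> set (p @ a # b # q) = S \<Longrightarrow>
      f (p @ a # b # q) = f (p @ b # a # q)"
    and "distinct xs" "set xs = S" "distinct ys" "set ys = S"
  shows "f xs = f ys"
  using assms
proof (induction xs arbitrary: S f ys)
  case Nil
  then show ?case by simp
next
  case (Cons x xs)
  obtain p q where ys: "ys = p @ x # q"
    using Cons.prems by (metis list.set_intros(1) split_list)
  have front: "f (p @ x # q) = f (x # p @ q)"
    if "distinct (p @ x # q)" "set (p @ x # q) = S" for p q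
    using that
  proof (induction p arbitrary: q rule: rev_induct)
    case Nil
    then show ?case by simp
  next
    case (snoc a p)
    have "f (p @ a # x # q) = f (p @ x # a # q)"
      using snoc.prems by (intro Cons.prems(1)) auto
    also have "\<dots> = f (x # p @ a # q)"
      using snoc.prems by (intro snoc.IH) auto
    finally show ?case by simp
  qed
  have "set (p @ q) = set ys - {x}" "set xs = S - {x}" "distinct (p @ q)"
    using Cons.prems ys by auto
  then have pq: "distinct (p @ q)" "set (p @ q) = set xs"
    using Cons.prems by auto
  have "f (x # xs) = f (x # p @ q)"
  proof (rule Cons.IH[where f = "\<lambda>zs. f (x # zs)" and S = "set xs"])
    fix p' a b q' assume "distinct (p' @ a # b # q')" "set (p' @ a # b # q') = set xs"
    then show "f (x # p' @ a # b # q') = f (x # p' @ b # a # q')"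
      using Cons.prems(1)[of "x # p'" a b q'] Cons.prems(2,3) by auto
  qed (use Cons.prems pq in auto)
  with front[of p q] Cons.prems ys show ?case
    by simp
qed

text \<open>The square relation says that an adjacent swap elsewhere does not affect the difference
  caused by swapping \<open>a\<close> and \<open>b\<close>. Hence the elements before the pair, and
  those after it, may be rearranged among themselves.\<close>

lemma adjacent_difference_invariant:
  assumes sq: "square_additive A g"
    and d: "distinct (ys @ a # b # zs)" "set (ys @ a # b # zs) = A"
    and d': "distinct (ys' @ a # b # zs')" "set (ys' @ a # b # zs') = A"
    and S: "set ys = set ys'"
  shows "g (ys @ a # b # zs) - g (ys @ b # a # zs) = g (ys' @ a # b # zs') - g (ys' @ b # a # zs')"
proof -
  have R: "set zs = set zs'"
    using d d' S by auto
  have "g (ys @ a # b # zs) - g (ys @ b # a # zs) = g (ys' @ a # b # zs) - g (ys' @ b # a # zs)"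
  proof (rule adjacent_swap_invariant[where f = "\<lambda>ys. g (ys @ a # b # zs) - g (ys @ b # a # zs)"
        and S = "set ys"])
    have ext: "distinct (L @ a # b # zs) \<and> set (L @ a # b # zs) = A"
      if "distinct L" "set L = set ys" for L
      using that d by simp
    fix p c e q assume "distinct (p @ c # e # q)" "set (p @ c # e # q) = set ys"
    note ext[OF this]
    then show "g ((p @ c # e # q) @ a # b # zs) - g ((p @ c # e # q) @ b # a # zs) =
        g ((p @ e # c # q) @ a # b # zs) - g ((p @ e # c # q) @ b # a # zs)"
      using square_additiveD[OF sq, of p c e q a b zs] by simp
  qed (use d d' S in auto)
  also have "\<dots> = g (ys' @ a # b # zs') - g (ys' @ b # a # zs')"
  proof (rule adjacent_swap_invariant[where f = "\<lambda>zs. g (ys' @ a # b # zs) - g (ys' @ b # a # zs)"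
        and S = "set zs"])
    have ext: "distinct (ys' @ a # b # L) \<and> set (ys' @ a # b # L) = A"
      if "distinct L" "set L = set zs" for L
      using that d' R by simp
    fix p c e q assume "distinct (p @ c # e # q)" "set (p @ c # e # q) = set zs"
    note ext[OF this]
    then show "g (ys' @ a # b # p @ c # e # q) - g (ys' @ b # a # p @ c # e # q) =
        g (ys' @ a # b # p @ e # c # q) - g (ys' @ b # a # p @ e # c # q)"
      using square_additiveD[OF sq, of ys' a b p c e q] by simp
  qed (use d d' R in auto)
  finally show ?thesis .
qed

text \<open>Two neighbouring flags share all members but one.\<close>

lemma flag_sum_adjacent_swap:
  "flag_sum \<mu> (p @ a # b # q) - flag_sum \<mu> (p @ b # a # q)
     = \<mu> (insert a (set p)) - \<mu> (insert b (set p))"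
proof -
  have "flag_sum \<mu> (p @ a # b # q) - flag_sum \<mu> (p @ b # a # q) =
    (\<Sum>k\<le>length (p @ a # b # q). \<mu> (set (take k (p @ a # b # q))) - \<mu> (set (take k (p @ b # a # q))))"
    unfolding flag_sum_def by (simp add: sum_subtractf)
  also have "\<dots> = (\<Sum>k\<in>{Suc (length p)}. \<mu> (set (take k (p @ a # b # q))) - \<mu> (set (take k (p @ b # a # q))))"
  proof (rule sum.mono_neutral_right)
    show "\<forall>k\<in>{..length (p @ a # b # q)} - {Suc (length p)}.
        \<mu> (set (take k (p @ a # b # q))) - \<mu> (set (take k (p @ b # a # q))) = 0"
    proof
      fix k assume "k \<in> {..length (p @ a # b # q)} - {Suc (length p)}"
      then consider "k \<le> length p" | "k \<ge> Suc (Suc (length p))"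
        by fastforce
      then show "\<mu> (set (take k (p @ a # b # q))) - \<mu> (set (take k (p @ b # a # q))) = 0"
      proof cases
        case 2
        then obtain m where "k = length p + Suc (Suc m)"
          by (metis add_Suc_right le_Suc_ex add_Suc)
        then show ?thesis by (simp add: insert_commute)
      qed simp
    qed
  qed auto
  finally show ?thesis by simp
qed

lemma flag_sum_snoc: "flag_sum \<mu> (xs @ [x]) = flag_sum \<mu> xs + \<mu> (insert x (set xs))"
  unfolding flag_sum_def by simp

lemma flag_sum_cong:
  assumes "\<And>S. S \<subseteq> set xs \<Longrightarrow> \<mu> S = \<nu> S"
  shows "flag_sum \<mu> xs = flag_sum \<nu> xs"
  unfolding flag_sum_def using assms by (intro sum.cong) (auto simp: set_take_subset)

text \<open>
  Induction on the ground set. If a new element \<open>x\<close> is last in the list, the value is known by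
  induction. Moving \<open>x\<close> past \<open>b\<close> forces \<open>\<mu> (insert x S) - \<mu> (insert b S)\<close>, and the hexagon
  relation says that the value of \<open>\<mu> (insert x S)\<close> obtained in this way does not depend on \<open>b\<close>.
\<close>

lemma flag_sum_decomposition:
  assumes "finite A" "square_additive A g" "hexagon_additive A g"
  shows "\<exists>\<mu>. \<forall>xs. distinct xs \<longrightarrow> set xs = A \<longrightarrow> g xs = flag_sum \<mu> xs"
  using assms
proof (induction A arbitrary: g rule: finite_induct)
  case empty
  show ?case
    by (rule exI[of _ "\<lambda>_. g []"]) (simp add: flag_sum_def)
next
  case (insert x A)
  note sq = insert.prems(1) and hex = insert.prems(2)
  have "square_additive A (\<lambda>xs. g (xs @ [x]))"
    unfolding square_additive_def
  proof (intro allI impI)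
    fix p a b q c d r
    assume "p @ a # b # q @ c # d # r \<in> permutations_of_set A"
    then show "g ((p @ a # b # q @ c # d # r) @ [x]) + g ((p @ b # a # q @ d # c # r) @ [x])
       = g ((p @ b # a # q @ c # d # r) @ [x]) + g ((p @ a # b # q @ d # c # r) @ [x])"
      using square_additiveD[OF sq, of p a b q c d "r @ [x]"] insert.hyps
      by (auto simp: permutations_of_set_def)
  qed
  moreover have "hexagon_additive A (\<lambda>xs. g (xs @ [x]))"
    unfolding hexagon_additive_def
  proof (intro allI impI)
    fix p i j k q
    assume "p @ i # j # k # q \<in> permutations_of_set A"
    then show "g ((p @ i # j # k # q) @ [x]) + g ((p @ j # k # i # q) @ [x])
        + g ((p @ k # i # j # q) @ [x])
      = g ((p @ j # i # k # q) @ [x]) + g ((p @ k # j # i # q) @ [x]) + g ((p @ i # k # j # q) @ [x])"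
      using hexagon_additiveD[OF hex, of p i j k "q @ [x]"] insert.hyps
      by (auto simp: permutations_of_set_def)
  qed
  ultimately obtain \<nu> where \<nu>: "\<And>xs. distinct xs \<Longrightarrow> set xs = A \<Longrightarrow> g (xs @ [x]) = flag_sum \<nu> xs"
    using insert.IH by blast
  \<comment> \<open>As \<open>x\<close> lies behind the pair, it can be moved to the end without
    changing the difference, and there the induction hypothesis applies.\<close>
  have diff: "g (ys @ a # b # zs) - g (ys @ b # a # zs)
      = \<nu> (insert a (set ys)) - \<nu> (insert b (set ys))"
    if d: "distinct (ys @ a # b # zs)" "set (ys @ a # b # zs) = insert x A"
      and x: "x \<in> set zs" for ys a b zs
  proof -
    obtain r where r: "distinct r" "set r = set zs - {x}"
      using finite_distinct_list[of "set zs - {x}"] by auto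
    have "set (ys @ a # b # r) = set (ys @ a # b # zs) - {x}"
      using d r x by auto
    then have A: "set (ys @ a # b # r) = A"
      using d insert.hyps by simp
    have D: "distinct (ys @ a # b # r)"
      using d r by auto
    have "g (ys @ a # b # zs) - g (ys @ b # a # zs)
        = g (ys @ a # b # r @ [x]) - g (ys @ b # a # r @ [x])"
      using d x r insert.hyps by (intro adjacent_difference_invariant[OF sq]) auto
    also have "\<dots> = flag_sum \<nu> (ys @ a # b # r) - flag_sum \<nu> (ys @ b # a # r)"
      using \<nu>[of "ys @ a # b # r"] \<nu>[of "ys @ b # a # r"] A D by (auto simp: insert_commute)
    finally show ?thesis
      by (simp add: flag_sum_adjacent_swap)
  qed
  define val where "val ys b zs = \<nu> (insert b (set ys)) + (g (ys @ x # b # zs) - g (ys @ b # x # zs))"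
    for ys b zs
  define ok where "ok S ys b zs \<longleftrightarrow> distinct (ys @ x # b # zs) \<and> set (ys @ x # b # zs) = insert x A \<and> set ys = S"
    for S ys b zs
  have val_eq: "val ys b zs = val ys' b' zs'" if ok1: "ok S ys b zs" and ok2: "ok S ys' b' zs'"
    for S ys b zs ys' b' zs'
  proof (cases "b = b'")
    case True
    have "g (ys @ x # b # zs) - g (ys @ b # x # zs) = g (ys' @ x # b # zs') - g (ys' @ b # x # zs')"
      by (rule adjacent_difference_invariant[OF sq])
        (use that True in \<open>simp_all only: ok_def\<close>)
    with that True show ?thesis
      unfolding ok_def val_def by simp
  next
    case False
    \<comment> \<open>With a common rest \<open>r\<close> behind them, the orders of
      \<open>x\<close>, \<open>b\<close>, \<open>b'\<close> form a single hexagon, in which both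
      values can be compared.\<close>
    obtain r where r: "distinct r" "set r = set zs - {b'}"
      using finite_distinct_list[of "set zs - {b'}"] by auto
    have d1: "distinct (ys @ x # b # zs)" and E1: "set (ys @ x # b # zs) = insert x A"
      and d2: "distinct (ys' @ x # b' # zs')" and E2: "set (ys' @ x # b' # zs') = insert x A"
      and S: "set ys = S" "set ys' = S"
      using ok1 ok2 unfolding ok_def by blast+
    have "b' \<in> set (ys @ x # b # zs)" "b \<in> set (ys' @ x # b' # zs')"
      unfolding E1 unfolding E2[symmetric] using E1 E2 by auto
    then have b': "b' \<in> set zs" "b' \<noteq> x" and b: "b \<in> set zs'" "b \<noteq> x"
      using d1 d2 S False by auto
    have "set zs = set (ys @ x # b # zs) - S - {x, b}"
      "set zs' = set (ys' @ x # b' # zs') - S - {x, b'}"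
      using d1 d2 S by auto
    then have "set zs = insert x A - S - {x, b}" "set zs' = insert x A - S - {x, b'}"
      unfolding E1 E2 by simp_all
    then have zs': "set zs' = insert b (set r)"
      using False r b b' by auto
    have d: "distinct (ys @ x # b # b' # r)" "set (ys @ x # b # b' # r) = insert x A"
      using d1 r b' unfolding E1[symmetric] by auto
    have "g (ys @ x # b # zs) - g (ys @ b # x # zs)
        = g (ys @ x # b # b' # r) - g (ys @ b # x # b' # r)"
      using d1 E1 d by (intro adjacent_difference_invariant[OF sq]) simp_all
    moreover have "g (ys' @ x # b' # zs') - g (ys' @ b' # x # zs')
        = g (ys @ x # b' # b # r) - g (ys @ b' # x # b # r)"
      using d2 E2 d S False[symmetric]
      by (intro adjacent_difference_invariant[OF sq]) (simp_all add: insert_commute)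
    moreover have "g (ys @ b # b' # x # r) - g (ys @ b' # b # x # r)
        = \<nu> (insert b (set ys)) - \<nu> (insert b' (set ys))"
      using d b'(2) b(2) by (intro diff) (simp_all add: insert_commute)
    moreover have "g (ys @ x # b # b' # r) + g (ys @ b # b' # x # r) + g (ys @ b' # x # b # r)
        = g (ys @ b # x # b' # r) + g (ys @ b' # b # x # r) + g (ys @ x # b' # b # r)"
      using d by (intro hexagon_additiveD[OF hex])
    ultimately show ?thesis
      unfolding val_def S by linarith
  qed
  define m where "m S = (SOME m. \<forall>ys b zs. ok S ys b zs \<longrightarrow> m = val ys b zs)" for S
  have "\<exists>m. \<forall>ys b zs. ok S ys b zs \<longrightarrow> m = val ys b zs" for S
  proof (cases "\<exists>ys b zs. ok S ys b zs")
    case True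
    then obtain ys b zs where "ok S ys b zs"
      by blast
    then show ?thesis
      by (intro exI[of _ "val ys b zs"] allI impI) (rule val_eq)
  qed simp
  then have "\<forall>ys b zs. ok S ys b zs \<longrightarrow> m S = val ys b zs" for S
    unfolding m_def by (rule someI_ex)
  then have m: "m S = val ys b zs" if "ok S ys b zs" for S ys b zs
    using that by blast
  \<comment> \<open>The full set gets 0 because \<open>flag_sum \<nu>\<close> already accounts for
    the whole height when \<open>x\<close> comes last.\<close>
  define \<mu> where "\<mu> T = (if x \<notin> T then \<nu> T else if T = insert x A then 0 else m (T - {x}))" for T
  \<comment> \<open>Induction on what stands behind \<open>x\<close>: each step moves
    \<open>x\<close> one place to the right, until it is last.\<close>
  have "g (ys @ x # zs) = flag_sum \<mu> (ys @ x # zs)"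
    if "distinct (ys @ x # zs)" "set (ys @ x # zs) = insert x A" for ys zs
    using that
  proof (induction zs arbitrary: ys)
    case Nil
    then have "set ys = A" "distinct ys"
      using insert.hyps by (simp_all add: insert_ident)
    then have "g (ys @ [x]) = flag_sum \<nu> ys"
      by (intro \<nu>)
    also have "\<dots> = flag_sum \<mu> ys"
      using Nil by (intro flag_sum_cong) (auto simp: \<mu>_def)
    also have "\<dots> = flag_sum \<mu> (ys @ [x])"
      using Nil by (simp add: flag_sum_snoc \<mu>_def)
    finally show ?case .
  next
    case (Cons b zs)
    have "ok (set ys) ys b zs"
      using Cons.prems unfolding ok_def by blast
    then have "m (set ys) = val ys b zs"
      by (rule m)
    moreover have b: "b \<notin> set ys" "x \<notin> set ys" "b \<noteq> x"
      using Cons.prems(1) by auto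
    have "b \<in> set (ys @ x # b # zs)"
      by simp
    then have "b \<in> A"
      unfolding Cons.prems(2) using b by simp
    then have "insert x (set ys) \<noteq> insert x A" "x \<notin> insert b (set ys)"
      using b by blast+
    then have "\<mu> (insert x (set ys)) = m (set ys)" "\<mu> (insert b (set ys)) = \<nu> (insert b (set ys))"
      unfolding \<mu>_def using b by simp_all
    moreover have "g ((ys @ [b]) @ x # zs) = flag_sum \<mu> ((ys @ [b]) @ x # zs)"
      using Cons.prems b by (intro Cons.IH) (simp_all add: insert_commute)
    moreover note flag_sum_adjacent_swap[of \<mu> ys x b zs]
    ultimately show ?case
      unfolding val_def by simp
  qed
  then have "g xs = flag_sum \<mu> xs" if "distinct xs" "set xs = insert x A" for xs
    using that split_list[of x xs] by auto
  then show ?case by blast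
qed

text \<open>Around the hexagon a height is a constant plus one singleton value and one pair value.
  The heights of two opposite vertices together use all six such values except those of one
  singleton and its complementary pair. So the sum of opposite heights is a constant minus a sum
  from \<open>three_term\<close>, and a maximum attained twice becomes a minimum attained
  twice.\<close>

lemma three_term_of_hexagons:
  assumes fin: "finite A" and hex: "hexagon_max A g"
    and g: "\<And>xs. distinct xs \<Longrightarrow> set xs = A \<Longrightarrow> g xs = flag_sum \<mu> xs"
  shows "three_term A \<mu>"
  unfolding three_term_def
proof (intro allI impI, elim conjE)
  fix S i j k assume S: "S \<subseteq> A" and ijk: "{i, j, k} \<subseteq> A - S" "distinct [i, j, k]"
  obtain p where p: "distinct p" "set p = S"
    using finite_distinct_list[of S] finite_subset[OF S fin] by auto
  obtain q where q: "distinct q" "set q = A - S - {i, j, k}"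
    using finite_distinct_list[of "A - S - {i, j, k}"] fin by auto
  define G where "G xs = g (p @ xs @ q)" for xs
  have G: "G xs = flag_sum \<mu> (p @ xs @ q)" if "mset xs = mset [i, j, k]" for xs
  proof -
    have "set xs = {i, j, k}" "distinct xs"
      using mset_eq_setD[OF that] mset_eq_imp_distinct_iff[OF that] ijk by auto
    then show ?thesis
      unfolding G_def using p q ijk S by (intro g) auto
  qed
  have swap1: "G [a, b, c] - G [b, a, c] = \<mu> (insert a S) - \<mu> (insert b S)"
    if "mset [a, b, c] = mset [i, j, k]" for a b c
    using G[of "[a, b, c]"] G[of "[b, a, c]"] that flag_sum_adjacent_swap[of \<mu> p a b "c # q"] p
    by (simp add: add_mset_commute)
  have swap2: "G [c, a, b] - G [c, b, a] = \<mu> (insert c (insert a S)) - \<mu> (insert c (insert b S))"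
    if "mset [a, b, c] = mset [i, j, k]" for a b c
    using G[of "[c, a, b]"] G[of "[c, b, a]"] that flag_sum_adjacent_swap[of \<mu> "p @ [c]" a b q] p
    by (simp add: add_mset_commute insert_commute)
  have "p @ i # j # k # q \<in> permutations_of_set A"
    using p q ijk S by (auto simp: permutations_of_set_def)
  then have "max_attained_twice (G [i, j, k] + G [k, j, i]) (G [j, i, k] + G [k, i, j])
      (G [j, k, i] + G [i, k, j])"
    using hex unfolding hexagon_max_def G_def by simp
  moreover note swap1[of i j k] swap2[of i k j] swap1[of j k i] swap2[of i j k] swap1[of i k j] swap2[of j k i]
  ultimately show "min (\<mu> (insert j S) + \<mu> (insert i (insert k S)))
      (\<mu> (insert k S) + \<mu> (insert i (insert j S))) \<le> \<mu> (insert i S) + \<mu> (insert j (insert k S))"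
    unfolding max_attained_twice_def Let_def
    by (simp add: insert_commute add_mset_commute min_le_iff_disj max_def split: if_splits)
qed

lemma local_minimum_is_global:
  assumes fin: "finite A" and sq: "square_additive A g" and ha: "hexagon_additive A g"
    and hm: "hexagon_max A g" and xs: "xs \<in> permutations_of_set A"
    and loc: "\<And>i j. i < j \<Longrightarrow> j < length xs \<Longrightarrow> g xs \<le> g (swap_nth i j xs)"
    and ys: "ys \<in> permutations_of_set A"
  shows "g xs \<le> g ys"
proof -
  obtain \<mu> where \<mu>: "\<And>xs. distinct xs \<Longrightarrow> set xs = A \<Longrightarrow> g xs = flag_sum \<mu> xs"
    using flag_sum_decomposition[OF fin sq ha] by blast
  then have eq: "g zs = flag_sum \<mu> zs" if "zs \<in> permutations_of_set A" for zs
    using that by (simp add: permutations_of_set_def)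
  have "flag_sum \<mu> xs \<le> flag_sum \<mu> ys"
  proof (rule flag_sum_local_min[OF three_term_of_hexagons[OF fin hm \<mu>] xs _ ys])
    fix i j assume "i < j" "j < length xs"
    then show "flag_sum \<mu> xs \<le> flag_sum \<mu> (swap_nth i j xs)"
      using loc[of i j] eq[OF xs] eq[OF swap_nth_permutations[OF xs, of i j]] by simp
  qed auto
  then show ?thesis
    using eq xs ys by simp
qed

subsection \<open>Faces and cells as sets of minimizers\<close>

text \<open>Faces and cells are handled through the vertices at which some function is minimal.
  Faces of cells and cells of faces then become minimizers of minimizers.\<close>

definition minimizers :: "('a \<Rightarrow> real) \<Rightarrow> 'a set \<Rightarrow> 'a set" where
  "minimizers f X = {x \<in> X. \<forall>y\<in>X. f x \<le> f y}"

lemma minimizers_nonempty: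
  assumes "finite X" "X \<noteq> {}"
  shows "minimizers f X \<noteq> {}"
  using arg_min_if_finite(1)[OF assms, of f] arg_min_least[OF assms, of _ f]
  unfolding minimizers_def by blast

lemma minimizers_level:
  assumes "\<And>y. y \<in> X \<Longrightarrow> b \<le> f y" "z \<in> X" "f z = b"
  shows "{x \<in> X. f x = b} = minimizers f X"
  using assms unfolding minimizers_def by fastforce

lemma minimizers_cong:
  assumes "\<And>x y. x \<in> X \<Longrightarrow> y \<in> X \<Longrightarrow> f x \<le> f y \<longleftrightarrow> g x \<le> g y"
  shows "minimizers f X = minimizers g X"
  using assms unfolding minimizers_def by blast

text \<open>For small \<epsilon> the minimization is lexicographic, \<open>f\<close> before
  \<open>g\<close>. This serves three purposes: faces of a cell, cells of a face, and tilts that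
  preserve a strict minimum.\<close>

lemma minimizers_perturb:
  assumes "finite X"
  obtains \<epsilon> where "\<epsilon> > 0" "minimizers (\<lambda>x. f x + \<epsilon> * g x) X = minimizers g (minimizers f X)"
proof -
  \<comment> \<open>A strict inequality between two values of \<open>f\<close> survives for all
    small \<epsilon>, and there are only finitely many pairs to respect.\<close>
  have "\<forall>\<^sub>F \<epsilon> in at_right 0. f (fst p) < f (snd p) \<longrightarrow>
      f (fst p) + \<epsilon> * g (fst p) < f (snd p) + \<epsilon> * g (snd p)" for p
  proof (cases "f (fst p) < f (snd p)")
    case True
    have "((\<lambda>\<epsilon>. f (snd p) + \<epsilon> * g (snd p) - (f (fst p) + \<epsilon> * g (fst p)))
        \<longlongrightarrow> f (snd p) + 0 * g (snd p) - (f (fst p) + 0 * g (fst p))) (at_right 0)"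
      by (intro tendsto_intros)
    then have "\<forall>\<^sub>F \<epsilon> in at_right 0. 0 < f (snd p) + \<epsilon> * g (snd p) - (f (fst p) + \<epsilon> * g (fst p))"
      using True by (intro order_tendstoD(1)) auto
    then show ?thesis
      by eventually_elim simp
  qed simp
  then have "\<forall>\<^sub>F \<epsilon> in at_right 0. \<forall>p\<in>X \<times> X. f (fst p) < f (snd p) \<longrightarrow>
      f (fst p) + \<epsilon> * g (fst p) < f (snd p) + \<epsilon> * g (snd p)"
    using assms by (intro eventually_ball_finite) auto
  moreover have "\<forall>\<^sub>F \<epsilon> in at_right 0. (0::real) < \<epsilon>"
    by (rule eventually_at_right_less)
  ultimately have "\<forall>\<^sub>F \<epsilon> in at_right 0. 0 < \<epsilon> \<and> (\<forall>p\<in>X \<times> X. f (fst p) < f (snd p) \<longrightarrow>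
      f (fst p) + \<epsilon> * g (fst p) < f (snd p) + \<epsilon> * g (snd p))"
    by eventually_elim simp
  from eventually_happens'[OF trivial_limit_at_right_real this] obtain \<epsilon> where \<epsilon>0: "\<epsilon> > 0"
    and all: "\<forall>p\<in>X \<times> X. f (fst p) < f (snd p) \<longrightarrow>
      f (fst p) + \<epsilon> * g (fst p) < f (snd p) + \<epsilon> * g (snd p)"
    by blast
  have \<epsilon>: "\<epsilon> > 0"
    "\<And>x y. x \<in> X \<Longrightarrow> y \<in> X \<Longrightarrow> f x < f y \<Longrightarrow> f x + \<epsilon> * g x < f y + \<epsilon> * g y"
    using \<epsilon>0 all by auto
  have "minimizers (\<lambda>x. f x + \<epsilon> * g x) X = minimizers g (minimizers f X)" (is "?L = ?R")
  proof
    show "?L \<subseteq> ?R"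
    proof
      fix x assume x: "x \<in> ?L"
      then have "f x \<le> f y" if "y \<in> X" for y
        using \<epsilon>(2)[of y x] that unfolding minimizers_def by force
      then have "x \<in> minimizers f X"
        using x unfolding minimizers_def by blast
      moreover have "g x \<le> g y" if "y \<in> minimizers f X" for y
      proof -
        have "f x = f y" "f x + \<epsilon> * g x \<le> f y + \<epsilon> * g y"
          using that x \<open>x \<in> minimizers f X\<close> unfolding minimizers_def by (auto intro: antisym)
        then show ?thesis
          using \<epsilon>(1) by simp
      qed
      ultimately show "x \<in> ?R"
        unfolding minimizers_def[of g] by blast
    qed
    show "?R \<subseteq> ?L"
    proof
      fix x assume x: "x \<in> ?R"
      have "f x + \<epsilon> * g x \<le> f y + \<epsilon> * g y" if y: "y \<in> X" for y
      proof (cases "f x < f y")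
        case True
        then show ?thesis
          using \<epsilon>(2)[of x y] x y unfolding minimizers_def by simp
      next
        case False
        then have "f x = f y" "y \<in> minimizers f X"
          using x y unfolding minimizers_def by force+
        then show ?thesis
          using x \<epsilon>(1) unfolding minimizers_def[of g] by simp
      qed
      then show "x \<in> ?L"
        using x unfolding minimizers_def by blast
    qed
  qed
  with \<epsilon>(1) that show ?thesis by blast
qed

lemma convex_hull_Int_supporting_hyperplane:
  fixes V :: "'a::euclidean_space set"
  assumes fin: "finite V" and b: "\<And>v. v \<in> V \<Longrightarrow> b \<le> a \<bullet> v"
  shows "convex hull V \<inter> {x. a \<bullet> x = b} = convex hull {v \<in> V. a \<bullet> v = b}"
    and "convex hull {v \<in> V. a \<bullet> v = b} face_of convex hull V"
    and "x \<in> convex hull V \<Longrightarrow> b \<le> a \<bullet> x"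
proof -
  have "convex hull V \<subseteq> {x. a \<bullet> x \<ge> b}"
    using b by (intro hull_minimal) (auto simp: convex_halfspace_ge)
  then have face: "(convex hull V \<inter> {x. a \<bullet> x = b}) face_of convex hull V"
    by (intro face_of_Int_supporting_hyperplane_ge) auto
  then obtain S where S: "S \<subseteq> V" "convex hull V \<inter> {x. a \<bullet> x = b} = convex hull S"
    using face_of_convex_hull_subset[OF finite_imp_compact[OF fin]] by metis
  have "S \<subseteq> {v \<in> V. a \<bullet> v = b}"
    using S hull_subset[of S convex] by blast
  then have "convex hull V \<inter> {x. a \<bullet> x = b} \<subseteq> convex hull {v \<in> V. a \<bullet> v = b}"
    using S hull_mono by metis
  moreover have "convex hull {v \<in> V. a \<bullet> v = b} \<subseteq> convex hull V \<inter> {x. a \<bullet> x = b}"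
    by (intro hull_minimal) (auto simp: hull_inc convex_Int convex_hyperplane)
  ultimately show eq: "convex hull V \<inter> {x. a \<bullet> x = b} = convex hull {v \<in> V. a \<bullet> v = b}"
    by blast
  show "convex hull {v \<in> V. a \<bullet> v = b} face_of convex hull V"
    using face unfolding eq .
  show "x \<in> convex hull V \<Longrightarrow> b \<le> a \<bullet> x"
    using \<open>convex hull V \<subseteq> {x. a \<bullet> x \<ge> b}\<close> by blast
qed

lemma face_of_minimizers:
  fixes V :: "'a::euclidean_space set"
  assumes "finite V"
  shows "convex hull (minimizers ((\<bullet>) a) V) face_of convex hull V"
proof (cases "minimizers ((\<bullet>) a) V = {}")
  case False
  then obtain z where z: "z \<in> minimizers ((\<bullet>) a) V"
    by blast
  then have "minimizers ((\<bullet>) a) V = {v \<in> V. a \<bullet> v = a \<bullet> z}"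
    by (intro minimizers_level[symmetric, of _ _ _ z]) (auto simp: minimizers_def)
  then show ?thesis
    using convex_hull_Int_supporting_hyperplane(2)[OF assms, of "a \<bullet> z" a] z
    by (auto simp: minimizers_def)
qed (metis convex_hull_empty empty_face_of)

text \<open>Faces of a polyhedron are exposed. The sign changes because exposed faces are described
  by upper bounds.\<close>

lemma face_of_convex_hull_imp_minimizers:
  fixes V :: "'a::euclidean_space set"
  assumes fin: "finite V" and F: "F face_of convex hull V" "F \<noteq> {}"
  obtains a where "F = convex hull (minimizers ((\<bullet>) a) V)"
proof -
  have "F exposed_face_of convex hull V"
    using F fin by (simp add: exposed_face_of_polyhedron polyhedron_convex_hull)
  then obtain a b where ab: "convex hull V \<subseteq> {x. a \<bullet> x \<le> b}" "F = convex hull V \<inter> {x. a \<bullet> x = b}"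
    unfolding exposed_face_of_def by blast
  have "- b \<le> - a \<bullet> v" if "v \<in> V" for v
    using ab(1) hull_inc[OF that, of convex] by auto
  note hyp = convex_hull_Int_supporting_hyperplane[OF fin this]
  have "F = convex hull V \<inter> {x. - a \<bullet> x = - b}"
    using ab(2) by simp
  then have F_eq: "F = convex hull {v \<in> V. - a \<bullet> v = - b}"
    using hyp(1) by simp
  then have "{v \<in> V. - a \<bullet> v = - b} \<noteq> {}"
    using F(2) convex_hull_eq_empty by metis
  then obtain z where "z \<in> V" "- a \<bullet> z = - b"
    by blast
  then have "{v \<in> V. - a \<bullet> v = - b} = minimizers ((\<bullet>) (- a)) V"
    using \<open>\<And>v. v \<in> V \<Longrightarrow> - b \<le> - a \<bullet> v\<close> by (intro minimizers_level) auto
  with F_eq that show ?thesis by metis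
qed

text \<open>A lower normal can be rescaled to have last coordinate 1. The face it cuts out of the
  lifted polytope then projects to the hull of the minimizers of the height plus a linear
  functional. Cells of every dimension are covered, in particular single segments.\<close>

lemma regular_subdivision_iff:
  fixes P :: "'a::euclidean_space set"
  assumes V: "{v. v extreme_point_of P} = V" and fin: "finite V" and ne: "V \<noteq> {}"
  shows "C \<in> regular_subdivision P h \<longleftrightarrow>
    (\<exists>u. C = convex hull (minimizers (\<lambda>v. h v + u \<bullet> v) V))"
proof -
  define lift where "lift v = (v, h v)" for v
  have Q: "lifted_polytope P h = convex hull (lift ` V)"
    unfolding lifted_polytope_def lift_def V[symmetric] by (simp add: image_Collect)
  have finL: "finite (lift ` V)"
    using fin by simp
  have cell: "fst ` {z \<in> lifted_polytope P h. (u, s) \<bullet> z = b} = convex hull {v \<in> V. u \<bullet> v + s * h v = b}"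
    and face: "{z \<in> lifted_polytope P h. (u, s) \<bullet> z = b} face_of lifted_polytope P h"
    and ge_Q: "\<forall>z\<in>lifted_polytope P h. b \<le> (u, s) \<bullet> z"
    if "\<And>v. v \<in> V \<Longrightarrow> b \<le> u \<bullet> v + s * h v" for u s b
  proof -
    have "b \<le> (u, s) \<bullet> z" if "z \<in> lift ` V" for z
      using that \<open>\<And>v. v \<in> V \<Longrightarrow> b \<le> u \<bullet> v + s * h v\<close> by (auto simp: lift_def)
    note hyp = convex_hull_Int_supporting_hyperplane[OF finL this]
    have set_eq: "{z \<in> lifted_polytope P h. (u, s) \<bullet> z = b}
        = convex hull {z \<in> lift ` V. (u, s) \<bullet> z = b}"
      using hyp(1) unfolding Q by blast
    have "fst ` {z \<in> lift ` V. (u, s) \<bullet> z = b} = {v \<in> V. u \<bullet> v + s * h v = b}"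
      unfolding lift_def by force
    then show "fst ` {z \<in> lifted_polytope P h. (u, s) \<bullet> z = b} = convex hull {v \<in> V. u \<bullet> v + s * h v = b}"
      unfolding set_eq by (simp add: convex_hull_linear_image linear_fst)
    show "{z \<in> lifted_polytope P h. (u, s) \<bullet> z = b} face_of lifted_polytope P h"
      unfolding set_eq unfolding Q using hyp(2) .
    show "\<forall>z\<in>lifted_polytope P h. b \<le> (u, s) \<bullet> z"
      unfolding Q using hyp(3) by blast
  qed
  show ?thesis
  proof
    assume "C \<in> regular_subdivision P h"
    then obtain F u s b where F: "C = fst ` F" "F \<noteq> {}" "s > 0"
      "\<forall>z\<in>lifted_polytope P h. b \<le> (u, s) \<bullet> z" "F = {z \<in> lifted_polytope P h. (u, s) \<bullet> z = b}"
      unfolding regular_subdivision_def lower_face_def by blast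
    have ge: "b \<le> u \<bullet> v + s * h v" if "v \<in> V" for v
      using F(4) that hull_inc[of "lift v" "lift ` V" convex] unfolding Q by (auto simp: lift_def)
    have C: "C = convex hull {v \<in> V. u \<bullet> v + s * h v = b}"
      unfolding F(1,5) by (rule cell[OF ge])
    moreover have "C \<noteq> {}"
      using F(1,2) by simp
    ultimately have "{v \<in> V. u \<bullet> v + s * h v = b} \<noteq> {}"
      using convex_hull_eq_empty by metis
    then obtain z where "z \<in> V" "u \<bullet> z + s * h z = b"
      by blast
    then have "{v \<in> V. u \<bullet> v + s * h v = b} = minimizers (\<lambda>v. u \<bullet> v + s * h v) V"
      using ge by (intro minimizers_level) auto
    also have "\<dots> = minimizers (\<lambda>v. h v + (u /\<^sub>R s) \<bullet> v) V"
    proof (rule minimizers_cong)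
      have "u \<bullet> v + s * h v = s * (h v + (u /\<^sub>R s) \<bullet> v)" for v
        using F(3) by (simp add: field_simps)
      then show "u \<bullet> x + s * h x \<le> u \<bullet> y + s * h y \<longleftrightarrow> h x + (u /\<^sub>R s) \<bullet> x \<le> h y + (u /\<^sub>R s) \<bullet> y" for x y
        using F(3) by simp
    qed
    finally show "\<exists>u. C = convex hull (minimizers (\<lambda>v. h v + u \<bullet> v) V)"
      using C by metis
  next
    assume "\<exists>u. C = convex hull (minimizers (\<lambda>v. h v + u \<bullet> v) V)"
    then obtain u where C: "C = convex hull (minimizers (\<lambda>v. h v + u \<bullet> v) V)"
      by blast
    obtain z where z: "z \<in> minimizers (\<lambda>v. h v + u \<bullet> v) V"
      using minimizers_nonempty[OF fin ne, of "\<lambda>v. h v + u \<bullet> v"] by blast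
    define b where "b = h z + u \<bullet> z"
    have ge: "b \<le> u \<bullet> v + 1 * h v" if "v \<in> V" for v
      using z that unfolding minimizers_def b_def by (auto simp: add.commute)
    have "{v \<in> V. h v + u \<bullet> v = b} = minimizers (\<lambda>v. h v + u \<bullet> v) V"
      using ge z by (intro minimizers_level[where z = z]) (auto simp: b_def add.commute minimizers_def)
    then have C': "C = convex hull {v \<in> V. u \<bullet> v + 1 * h v = b}"
      unfolding C by (simp add: add.commute)
    define F where "F = {z \<in> lifted_polytope P h. (u, 1) \<bullet> z = b}"
    have "C = fst ` F"
      unfolding C' F_def by (rule cell[OF ge, symmetric])
    moreover have "C \<noteq> {}"
      unfolding C using z by auto
    ultimately have "F \<noteq> {}"
      by auto
    moreover have "F face_of lifted_polytope P h" "\<forall>z\<in>lifted_polytope P h. b \<le> (u, 1) \<bullet> z"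
      unfolding F_def by (intro face[OF ge] ge_Q[OF ge]; assumption)+
    ultimately have "lower_face F (lifted_polytope P h)"
      unfolding lower_face_def F_def using zero_less_one by blast
    with \<open>C = fst ` F\<close> show "C \<in> regular_subdivision P h"
      unfolding regular_subdivision_def by blast
  qed
qed

lemma aff_dim_1_collinear:
  fixes E :: "'a::euclidean_space set"
  assumes "aff_dim E = 1" "a \<in> E" "b \<in> E" "a \<noteq> b" "x \<in> E" "y \<in> E"
  obtains c where "x - y = c *\<^sub>R (a - b)"
proof -
  have "affine hull {a, b} = affine hull E"
    using assms by (subst aff_dim_eq_full_gen[symmetric]) auto
  then have "x \<in> affine hull {a, b}" "y \<in> affine hull {a, b}"
    using assms by (auto simp: hull_inc)
  then obtain s t where st: "x = a + s *\<^sub>R (b - a)" "y = a + t *\<^sub>R (b - a)"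
    unfolding affine_hull_2_alt by auto
  have "x - y = (t - s) *\<^sub>R (a - b)"
    unfolding st by (simp add: algebra_simps)
  then show ?thesis by (rule that)
qed

text \<open>A face that meets the interior of the segment from \<open>z\<close> to \<open>w\<close>
  contains \<open>z\<close>, but an extreme point of \<open>F\<close> lying on the segment from
  \<open>x\<close> to \<open>y\<close> must be one of its ends.\<close>

lemma not_face_of_crossing:
  fixes F :: "'a::euclidean_space set"
  assumes F: "closed_segment x y face_of F" and z: "z extreme_point_of F" "z \<noteq> x" "z \<noteq> y"
    and w: "w \<in> F" "w \<noteq> z" and t: "0 < t" "t < 1" and s: "0 \<le> s" "s \<le> 1"
    and eq: "(1 - t) *\<^sub>R z + t *\<^sub>R w = (1 - s) *\<^sub>R x + s *\<^sub>R y"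
  shows False
proof -
  define p where "p = (1 - t) *\<^sub>R z + t *\<^sub>R w"
  have "p \<in> open_segment z w"
    unfolding p_def in_segment using w t by auto
  moreover have "p \<in> closed_segment x y"
    unfolding p_def eq in_segment using s by auto
  moreover have "z \<in> F"
    using z(1) by (simp add: extreme_point_of_def)
  ultimately have "z \<in> closed_segment x y"
    using F w unfolding face_of_def by blast
  moreover have "z \<notin> open_segment x y"
    using z(1) F face_of_imp_subset[OF F] by (auto simp: extreme_point_of_def)
  ultimately show False
    using z by (simp add: open_segment_def)
qed

subsection \<open>Vertices and faces of the permutahedron\<close>

text \<open>
  A vertex of the permutahedron is written as the list of coordinates in increasing order of their
  entries; swapping two adjacent list elements then traverses an edge.
\<close>

abbreviation flags :: "'n::finite list set" where
  "flags \<equiv> permutations_of_set UNIV"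

definition pt :: "'n::finite list \<Rightarrow> real ^ 'n" where
  "pt xs = (\<Sum>k<length xs. real (Suc k) *\<^sub>R axis (xs ! k) 1)"

lemma inner_pt: "u \<bullet> pt xs = (\<Sum>k<length xs. real (Suc k) * u $ (xs ! k))"
  unfolding pt_def by (simp add: inner_sum_right inner_axis)

lemma pt_component:
  assumes "distinct xs" "k < length xs"
  shows "pt xs $ (xs ! k) = real (Suc k)"
proof -
  have "pt xs $ (xs ! k) = (\<Sum>l<length xs. if l = k then real (Suc l) else 0)"
    unfolding pt_def sum_component using assms
    by (intro sum.cong) (auto simp: axis_def nth_eq_iff_index_eq)
  then show ?thesis
    using assms by simp
qed

lemma pt_swap_nth:
  assumes "i < j" "j < length xs"
  shows "pt (swap_nth i j xs) = pt xs + real (j - i) *\<^sub>R (axis (xs ! i) 1 - axis (xs ! j) 1)"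
proof -
  have "pt (swap_nth i j xs) - pt xs =
      (\<Sum>k<length xs. real (Suc k) *\<^sub>R (axis (swap_nth i j xs ! k) 1 - axis (xs ! k) 1))"
    unfolding pt_def by (simp add: sum_subtractf scaleR_diff_right swap_nth_def)
  also have "\<dots> = (\<Sum>k\<in>{i, j}. real (Suc k) *\<^sub>R (axis (swap_nth i j xs ! k) 1 - axis (xs ! k) 1))"
    using assms by (intro sum.mono_neutral_right) (auto simp: swap_nth_def nth_list_update)
  also have "\<dots> = real (j - i) *\<^sub>R (axis (xs ! i) 1 - axis (xs ! j) 1)"
    using assms by (simp add: swap_nth_def nth_list_update of_nat_diff algebra_simps)
  finally show ?thesis
    by (simp add: algebra_simps)
qed

lemma pt_adjacent_swap: "pt (p @ b # a # q) = pt (p @ a # b # q) + (axis a 1 - axis b 1)"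
proof -
  have "swap_nth (length p) (Suc (length p)) (p @ a # b # q) = p @ b # a # q"
    unfolding swap_nth_def by (simp add: nth_append list_update_append)
  then show ?thesis
    using pt_swap_nth[of "length p" "Suc (length p)" "p @ a # b # q"]
    by (simp add: nth_append)
qed

lemma length_flag: "xs \<in> (flags :: 'n::finite list set) \<Longrightarrow> length xs = CARD('n)"
  using length_finite_permutations_of_set by blast

text \<open>Only the inclusion from right to left is constructed, by listing the coordinates in the
  order of their entries. Equality follows by counting: there are n! distinct permutation points,
  and the flags give at most n! points.\<close>

lemma pt_image: "pt ` flags = (perm_point ` Sym CARD('n) :: (real ^ 'n::{finite,linorder}) set)"
proof -
  have "perm_point \<sigma> \<in> pt ` (flags :: 'n list set)" if "\<sigma> \<in> Sym CARD('n)" for \<sigma>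
  proof -
    define f :: "'n \<Rightarrow> nat" where "f i = \<sigma> (coord_number i)" for i
    have "bij_betw (\<sigma> \<circ> coord_number) (UNIV :: 'n set) {1..CARD('n)}"
      using that unfolding Sym_def
      by (intro bij_betw_trans[OF bij_betw_coord_number]) (simp add: permutes_imp_bij)
    then have f: "bij_betw f UNIV {1..CARD('n)}"
      unfolding f_def comp_def .
    define xs where "xs = map (inv_into UNIV f) [1..<Suc CARD('n)]"
    have g: "bij_betw (inv_into UNIV f) {1..CARD('n)} UNIV"
      using f by (rule bij_betw_inv_into)
    have "set [1..<Suc CARD('n)] = {1..CARD('n)}"
      by auto
    then have "set xs = UNIV" "distinct xs"
      unfolding xs_def using g by (auto simp: distinct_map bij_betw_def simp del: upt_Suc)
    then have "xs \<in> flags"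
      by (simp add: permutations_of_set_def)
    moreover have "pt xs = perm_point \<sigma>"
      unfolding vec_eq_iff
    proof
      fix i :: 'n
      have fi: "f i \<in> {1..CARD('n)}"
        using f by (auto simp: bij_betw_def)
      define k where "k = f i - 1"
      have k: "k < length xs" "Suc k = f i"
        unfolding k_def xs_def using fi by auto
      have "xs ! k = i"
        unfolding xs_def using k f by (simp add: xs_def bij_betw_def del: upt_Suc)
      then show "pt xs $ i = perm_point \<sigma> $ i"
        using pt_component[OF \<open>distinct xs\<close> k(1)] k(2) by (simp add: perm_point_def f_def)
    qed
    ultimately show ?thesis by (metis imageI)
  qed
  then have sub: "(perm_point ` Sym CARD('n) :: (real ^ 'n::{finite,linorder}) set) \<subseteq> pt ` flags"
    by blast
  have "card (pt ` (flags :: 'n list set)) \<le> fact CARD('n)"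
    by (rule order_trans[OF card_image_le]) simp_all
  moreover have "card (perm_point ` Sym CARD('n) :: (real ^ 'n::{finite,linorder}) set) = card (Sym CARD('n))"
    by (rule card_image[OF inj_on_perm_point])
  moreover have "card (Sym CARD('n)) = fact CARD('n)"
    unfolding Sym_def by (rule card_permutations) simp_all
  ultimately show ?thesis
    using sub by (intro card_seteq[symmetric]) auto
qed

lemma permutahedron_eq: "permutahedron = convex hull (pt ` (flags :: 'n::{finite,linorder} list set))"
  unfolding permutahedron_def pt_image ..

lemma inj_on_pt: "inj_on pt (flags :: 'n::finite list set)"
proof (rule inj_onI)
  fix xs ys :: "'n list"
  assume fl: "xs \<in> flags" "ys \<in> flags" and eq: "pt xs = pt ys"
  show "xs = ys"
  proof (rule nth_equalityI)
    show len: "length xs = length ys"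
      using fl by (simp add: length_flag)
    fix k assume k: "k < length xs"
    obtain l where l: "l < length ys" "ys ! l = xs ! k"
      using fl by (metis UNIV_I in_set_conv_nth permutations_of_setD(1))
    have "real (Suc k) = pt ys $ (ys ! l)"
      using pt_component[of xs k] fl k eq l by (simp add: permutations_of_set_def)
    also have "\<dots> = real (Suc l)"
      using pt_component[of ys l] fl l by (simp add: permutations_of_set_def)
    finally show "xs ! k = ys ! k"
      using l by simp
  qed
qed

lemma finite_vertices: "finite (pt ` (flags :: 'n::finite list set))"
  by simp

lemma vertices_nonempty: "pt ` (flags :: 'n::finite list set) \<noteq> {}"
  by simp

lemma inner_pt_self:
  assumes "xs \<in> (flags :: 'n::finite list set)"
  shows "pt xs \<bullet> pt xs = (\<Sum>k<CARD('n). (real (Suc k))\<^sup>2)"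
proof -
  have "pt xs \<bullet> pt xs = (\<Sum>k<length xs. (real (Suc k))\<^sup>2)"
    unfolding inner_pt using assms
    by (intro sum.cong) (auto simp: pt_component permutations_of_set_def power2_eq_square)
  then show ?thesis
    using length_flag[OF assms] by simp
qed

text \<open>All candidates lie on one sphere around the origin, so each of them is the unique
  maximizer of the inner product with itself.\<close>

lemma extreme_points_permutahedron:
  "{v. v extreme_point_of permutahedron} = pt ` (flags :: 'n::{finite,linorder} list set)"
proof
  show "{v. v extreme_point_of permutahedron} \<subseteq> pt ` (flags :: 'n list set)"
    unfolding permutahedron_eq by (rule extreme_points_of_convex_hull)
  show "pt ` (flags :: 'n list set) \<subseteq> {v. v extreme_point_of permutahedron}"
  proof
    fix v assume v: "v \<in> pt ` (flags :: 'n list set)"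
    have less: "v \<bullet> y < v \<bullet> v" if "y \<in> pt ` (flags :: 'n list set)" "y \<noteq> v" for y
    proof -
      have "0 < (v - y) \<bullet> (v - y)"
        using that by simp
      moreover have "v \<bullet> v = y \<bullet> y"
        using v that by (auto simp: inner_pt_self)
      ultimately show ?thesis
        by (simp add: inner_diff_left inner_diff_right inner_commute)
    qed
    have "minimizers ((\<bullet>) (- v)) (pt ` (flags :: 'n list set)) = {v}"
      using v less unfolding minimizers_def by (force simp: less_imp_le)
    then have "{v} face_of permutahedron"
      using face_of_minimizers[OF finite_vertices, of "- v"] unfolding permutahedron_eq by simp
    then show "v \<in> {v. v extreme_point_of permutahedron}"
      by (simp add: face_of_singleton)
  qed
qed

lemma face_of_permutahedron:
  fixes F :: "(real ^ 'n::{finite,linorder}) set"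
  assumes F: "F face_of permutahedron" "F \<noteq> {}"
  obtains a where "F = convex hull (minimizers ((\<bullet>) a) (pt ` flags))"
    "{v. v extreme_point_of F} = minimizers ((\<bullet>) a) (pt ` flags)"
proof -
  define V where "V = pt ` (flags :: 'n list set)"
  obtain a where a: "F = convex hull (minimizers ((\<bullet>) a) V)"
    using face_of_convex_hull_imp_minimizers[OF finite_vertices] F unfolding permutahedron_eq V_def
    by metis
  have "{v. v extreme_point_of F} = minimizers ((\<bullet>) a) V"
  proof
    show "{v. v extreme_point_of F} \<subseteq> minimizers ((\<bullet>) a) V"
      unfolding a by (rule extreme_points_of_convex_hull)
    show "minimizers ((\<bullet>) a) V \<subseteq> {v. v extreme_point_of F}"
      using extreme_point_of_face[OF F(1)] extreme_points_permutahedron hull_subset[of "minimizers ((\<bullet>) a) V" convex]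
      unfolding a V_def minimizers_def by blast
  qed
  with a that show ?thesis
    unfolding V_def by blast
qed

text \<open>For a list sorted by \<kappa> these are the rearrangements inside blocks of equal key.
  The blocks form an ordered set partition, the usual combinatorial description of a face of the
  permutahedron.\<close>

definition tie_class :: "('a \<Rightarrow> real) \<Rightarrow> 'a list \<Rightarrow> 'a list set" where
  "tie_class \<kappa> xs = {ys. mset ys = mset xs \<and> map \<kappa> ys = map \<kappa> xs}"

lemma minimizers_image: "minimizers f (g ` X) = g ` minimizers (\<lambda>x. f (g x)) X"
  unfolding minimizers_def by blast

text \<open>The rearrangement inequality. Later positions carry larger weights, so with coefficients
  \<open>- \<kappa> x\<close> a minimizer has its keys in increasing order, since otherwise an
  adjacent swap would lower the value. The value depends on the sequence of keys only, hence the
  whole tie class is minimal.\<close>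

lemma minimizers_sorted:
  fixes xs :: "'n::finite list"
  assumes xs: "xs \<in> flags" and sorted: "sorted (map \<kappa> xs)"
  shows "minimizers ((\<bullet>) (\<chi> x. - \<kappa> x)) (pt ` flags) = pt ` tie_class \<kappa> xs"
proof -
  define L where "L ys = (\<chi> x. - \<kappa> x) \<bullet> pt ys" for ys
  have L: "L ys = (\<Sum>k<length (map \<kappa> ys). real (Suc k) * - (map \<kappa> ys ! k))" for ys
    unfolding L_def inner_pt by simp
  have tie: "ys \<in> tie_class \<kappa> xs \<longleftrightarrow> ys \<in> flags \<and> map \<kappa> ys = map \<kappa> xs" for ys
  proof -
    have "mset ys = mset xs \<longleftrightarrow> ys \<in> flags"
      using xs mset_eq_imp_distinct_iff[of ys xs] mset_eq_setD[of ys xs]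
        set_eq_iff_mset_eq_distinct[of ys xs] by (auto simp: permutations_of_set_def)
    then show ?thesis by (simp add: tie_class_def)
  qed
  have sub: "minimizers L flags \<subseteq> tie_class \<kappa> xs"
  proof
    fix zs assume zs: "zs \<in> minimizers L flags"
    then have fl: "zs \<in> flags"
      by (simp add: minimizers_def)
    have "sorted (map \<kappa> zs)"
      unfolding sorted_iff_nth_Suc
    proof (intro allI impI)
      fix k assume "Suc k < length (map \<kappa> zs)"
      then have k: "Suc k < length zs" by simp
      have "L zs \<le> L (swap_nth k (Suc k) zs)"
        using zs k swap_nth_permutations[OF fl, of k "Suc k"] by (simp add: minimizers_def)
      also have "\<dots> = L zs - \<kappa> (zs ! k) + \<kappa> (zs ! Suc k)"
        unfolding L_def using k
        by (simp add: pt_swap_nth inner_add_right inner_diff_right inner_axis)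
      finally show "map \<kappa> zs ! k \<le> map \<kappa> zs ! Suc k"
        using k by simp
    qed
    moreover have "mset zs = mset xs"
      using fl xs set_eq_iff_mset_eq_distinct[of zs xs] by (auto simp: permutations_of_set_def)
    ultimately have "map \<kappa> zs = map \<kappa> xs"
      using sorted properties_for_sort by (metis mset_map)
    with fl show "zs \<in> tie_class \<kappa> xs"
      by (simp add: tie)
  qed
  moreover have "tie_class \<kappa> xs \<subseteq> minimizers L flags"
  proof
    fix ys assume ys: "ys \<in> tie_class \<kappa> xs"
    obtain zs where zs: "zs \<in> minimizers L (flags :: 'n list set)"
      using minimizers_nonempty[of "flags :: 'n list set" L] by auto
    then have "map \<kappa> zs = map \<kappa> ys"
      using sub ys tie by fastforce
    then have "L ys = L zs"
      unfolding L by simp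
    then show "ys \<in> minimizers L flags"
      using zs ys tie by (simp add: minimizers_def)
  qed
  ultimately show ?thesis
    unfolding minimizers_image L_def by blast
qed

text \<open>The keys tell which part an element belongs to, so every member of the class is cut at
  the same place. Geometrically, the face is a product.\<close>

lemma tie_class_append:
  assumes less: "\<And>x y. x \<in> set p \<Longrightarrow> y \<in> set q \<Longrightarrow> \<kappa> x < \<kappa> y"
  shows "tie_class \<kappa> (p @ q) = (\<Union>p'\<in>tie_class \<kappa> p. (@) p' ` tie_class \<kappa> q)"
proof
  show "(\<Union>p'\<in>tie_class \<kappa> p. (@) p' ` tie_class \<kappa> q) \<subseteq> tie_class \<kappa> (p @ q)"
    by (auto simp: tie_class_def)
  show "tie_class \<kappa> (p @ q) \<subseteq> (\<Union>p'\<in>tie_class \<kappa> p. (@) p' ` tie_class \<kappa> q)"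
  proof
    fix ys assume ys: "ys \<in> tie_class \<kappa> (p @ q)"
    define p' q' where "p' = take (length p) ys" and "q' = drop (length p) ys"
    have ys_eq: "ys = p' @ q'"
      unfolding p'_def q'_def by simp
    have map: "map \<kappa> p' = map \<kappa> p" "map \<kappa> q' = map \<kappa> q"
      using ys unfolding p'_def q'_def tie_class_def by (simp_all flip: take_map drop_map)
    define P where "P x \<longleftrightarrow> \<kappa> x \<in> \<kappa> ` set p" for x
    have "\<kappa> ` set p' = \<kappa> ` set p" "\<kappa> ` set q' = \<kappa> ` set q"
      using map by (metis list.set_map)+
    moreover have "\<kappa> ` set p \<inter> \<kappa> ` set q = {}"
      using less by force
    ultimately have "\<forall>x\<in>set p'. P x" "\<forall>x\<in>set q'. \<not> P x" "\<forall>x\<in>set p. P x" "\<forall>x\<in>set q. \<not> P x"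
      unfolding P_def by blast+
    then have "filter P (p' @ q') = p'" "filter P (p @ q) = p"
      by (simp_all add: filter_id_conv filter_empty_conv)
    moreover have m: "mset (p' @ q') = mset (p @ q)"
      using ys unfolding ys_eq tie_class_def by simp
    ultimately have "mset p' = mset p"
      by (metis mset_filter)
    moreover from this m have "mset q' = mset q"
      by simp
    ultimately show "ys \<in> (\<Union>p'\<in>tie_class \<kappa> p. (@) p' ` tie_class \<kappa> q)"
      using map ys_eq unfolding tie_class_def by blast
  qed
qed

lemma tie_class_Nil [simp]: "tie_class \<kappa> [] = {[]}"
  by (auto simp: tie_class_def)

lemma tie_class_strict:
  assumes "sorted_wrt (<) (map \<kappa> xs)"
  shows "tie_class \<kappa> xs = {xs}"
  using assms
proof (induction xs)
  case (Cons x xs)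
  have "tie_class \<kappa> [x] = {[x]}"
    by (auto simp: tie_class_def)
  then show ?case
    using Cons tie_class_append[of "[x]" xs \<kappa>] by auto
qed simp

lemma tie_class_const:
  assumes "\<And>x y. x \<in> set xs \<Longrightarrow> y \<in> set xs \<Longrightarrow> \<kappa> x = \<kappa> y"
  shows "tie_class \<kappa> xs = {ys. mset ys = mset xs}"
proof -
  have "map \<kappa> ys = map \<kappa> xs" if "mset ys = mset xs" for ys
  proof (rule nth_equalityI)
    show "length (map \<kappa> ys) = length (map \<kappa> xs)"
      using mset_eq_length[OF that] by simp
    fix k assume "k < length (map \<kappa> ys)"
    then show "map \<kappa> ys ! k = map \<kappa> xs ! k"
      using mset_eq_length[OF that] mset_eq_setD[OF that] assms by (metis length_map nth_map nth_mem)
  qed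
  then show ?thesis
    unfolding tie_class_def by blast
qed

lemma tie_class_pair:
  assumes "\<kappa> a = \<kappa> b"
  shows "tie_class \<kappa> [a, b] = {[a, b], [b, a]}"
proof -
  have "tie_class \<kappa> [a, b] = permutations_of_multiset {#a, b#}"
    using assms by (subst tie_class_const) (auto simp: permutations_of_multiset_def)
  then show ?thesis
    by (simp add: permutations_of_multiset_doubleton insert_commute)
qed

lemma tie_class_triple:
  assumes "\<kappa> i = \<kappa> j" "\<kappa> j = \<kappa> k" and d: "distinct [i, j, k]"
  shows "tie_class \<kappa> [i, j, k] = {[i, j, k], [j, i, k], [j, k, i], [k, j, i], [k, i, j], [i, k, j]}"
proof -
  have "tie_class \<kappa> [i, j, k] = {ys. mset ys = mset [i, j, k]}"
    using assms by (intro tie_class_const) auto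
  also have "\<dots> = permutations_of_set {i, j, k}"
  proof -
    have "mset ys = mset [i, j, k] \<longleftrightarrow> set ys = {i, j, k} \<and> distinct ys" for ys
      using d mset_eq_imp_distinct_iff[of ys "[i, j, k]"] mset_eq_setD[of ys "[i, j, k]"]
        set_eq_iff_mset_eq_distinct[of ys "[i, j, k]"] by fastforce
    then show ?thesis
      unfolding permutations_of_set_def by blast
  qed
  also have "\<dots> = {[i, j, k], [j, i, k], [j, k, i], [k, j, i], [k, i, j], [i, k, j]}"
  proof -
    have "{i, j, k} - {i} = {j, k}" "{i, j, k} - {j} = {i, k}" "{i, j, k} - {k} = {i, j}"
      using d by auto
    then show ?thesis
      using d by (subst permutations_of_set_nonempty) (auto simp: permutations_of_set_doubleton)
  qed
  finally show ?thesis .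
qed

text \<open>Applied repeatedly to the remaining list, this finds the ties of a key one after
  another; the dimension of a face is bounded through them.\<close>

lemma first_tie:
  assumes "sorted (map \<kappa> xs)"
  obtains "sorted_wrt (<) (map \<kappa> xs)"
  | p a b q where "xs = p @ a # b # q" "\<kappa> a = (\<kappa> b :: real)" "sorted_wrt (<) (map \<kappa> (p @ [a]))"
  using assms
proof (induction xs arbitrary: thesis rule: induct_list012)
  case (3 x y zs)
  show ?case
  proof (cases "\<kappa> x = \<kappa> y")
    case True
    then show ?thesis
      using "3.prems"(2)[of "[]" x y zs] by simp
  next
    case False
    then have less: "\<kappa> x < \<kappa> z" if "z \<in> set (y # zs)" for z
      using "3.prems"(3) that by force
    have sorted: "sorted (map \<kappa> (y # zs))"
      using "3.prems"(3) by simp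
    show ?thesis
    proof (rule "3.IH"(2)[OF _ _ sorted])
      assume "sorted_wrt (<) (map \<kappa> (y # zs))"
      then show thesis
        using less by (intro "3.prems"(1)) auto
    next
      fix p a b q
      assume *: "y # zs = p @ a # b # q" "\<kappa> a = \<kappa> b" "sorted_wrt (<) (map \<kappa> (p @ [a]))"
      then have "set (p @ [a]) \<subseteq> set (y # zs)"
        by (metis Un_subset_iff append.assoc append_Cons append_Nil set_append sup_ge1)
      then have "sorted_wrt (<) (map \<kappa> ((x # p) @ [a]))"
        using *(3) less by auto
      then show thesis
        using * by (intro "3.prems"(2)[of "x # p" a b q]) auto
    qed
  qed
qed auto

lemma aff_dim_insert_off_hyperplane:
  fixes S :: "'a::euclidean_space set"
  assumes "\<And>x. x \<in> S \<Longrightarrow> u \<bullet> x = t" "u \<bullet> y \<noteq> t"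
  shows "aff_dim (insert y S) = aff_dim S + 1"
proof -
  have "affine hull S \<subseteq> {x. u \<bullet> x = t}"
    using assms(1) by (intro hull_minimal) (auto simp: affine_hyperplane)
  then show ?thesis
    using assms(2) by (auto simp: aff_dim_insert)
qed

subsection \<open>Two-dimensional faces\<close>

lemma distinct_sorted_key:
  assumes "distinct xs"
  obtains \<kappa> :: "'a \<Rightarrow> real" where "sorted_wrt (<) (map \<kappa> xs)"
proof -
  have "\<exists>\<kappa> :: 'a \<Rightarrow> real. sorted_wrt (<) (map \<kappa> xs)"
    using assms
  proof (induction xs rule: rev_induct)
    case (snoc x xs)
    then obtain \<kappa> :: "'a \<Rightarrow> real" where \<kappa>: "sorted_wrt (<) (map \<kappa> xs)"
      by auto
    define m where "m = Max (insert 0 (\<kappa> ` set xs)) + 1"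
    have m: "\<kappa> y < m" if "y \<in> set xs" for y
    proof -
      have "\<kappa> y \<le> Max (insert 0 (\<kappa> ` set xs))"
        using that by (intro Max_ge) auto
      then show ?thesis by (simp add: m_def)
    qed
    have "map (\<kappa>(x := m)) (xs @ [x]) = map \<kappa> xs @ [m]"
      using snoc.prems by auto
    moreover have "sorted_wrt (<) (map \<kappa> xs @ [m])"
      using \<kappa> m by (auto simp: sorted_wrt_append)
    ultimately have "sorted_wrt (<) (map (\<kappa>(x := m)) (xs @ [x]))"
      by metis
    then show ?case by blast
  qed simp
  with that show ?thesis by blast
qed

lemma tie_class_edge:
  assumes "sorted_wrt (<) (map \<kappa> (p @ [a]))" "\<kappa> a = (\<kappa> b :: real)" "sorted_wrt (<) (map \<kappa> (b # q))"
  shows "tie_class \<kappa> (p @ a # b # q) = {p @ a # b # q, p @ b # a # q}"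
proof -
  have less: "\<kappa> x < \<kappa> a" if "x \<in> set p" for x
    using assms(1) that by (auto simp: sorted_wrt_append)
  have greater: "\<kappa> a < \<kappa> y" if "y \<in> set q" for y
    using assms(2,3) that by auto
  have "tie_class \<kappa> ([a, b] @ q) = (\<Union>p'\<in>{[a, b], [b, a]}. (@) p' ` {q})"
    using assms greater by (subst tie_class_append) (auto simp: tie_class_pair tie_class_strict)
  moreover have "tie_class \<kappa> (p @ [a, b] @ q)
      = (\<Union>p'\<in>{p}. (@) p' ` tie_class \<kappa> ([a, b] @ q))"
    using assms less greater
    by (subst tie_class_append) (auto simp: tie_class_strict sorted_wrt_append intro: less_trans)
  ultimately show ?thesis by auto
qed

lemma tie_class_square:
  assumes "sorted_wrt (<) (map \<kappa> (p @ [a]))" "\<kappa> a = (\<kappa> b :: real)"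
    "sorted_wrt (<) (map \<kappa> (b # q @ [c]))" "\<kappa> c = \<kappa> d" "sorted_wrt (<) (map \<kappa> (d # r))"
  shows "tie_class \<kappa> (p @ a # b # q @ c # d # r) =
    {p @ a # b # q @ c # d # r, p @ b # a # q @ c # d # r,
     p @ b # a # q @ d # c # r, p @ a # b # q @ d # c # r}"
proof -
  have ab: "\<kappa> a < \<kappa> c" "\<And>x. x \<in> set q \<Longrightarrow> \<kappa> a < \<kappa> x" "\<And>x. x \<in> set q \<Longrightarrow> \<kappa> x < \<kappa> c"
    "\<And>x. x \<in> set r \<Longrightarrow> \<kappa> c < \<kappa> x" "\<And>x. x \<in> set p \<Longrightarrow> \<kappa> x < \<kappa> a"
    using assms by (auto simp: sorted_wrt_append)
  have pr: "\<kappa> x < \<kappa> y" if "x \<in> set p" "y \<in> set r" for x y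
    using ab(1) ab(4)[OF that(2)] ab(5)[OF that(1)] by linarith
  have inner: "tie_class \<kappa> (q @ c # d # r) = {q @ c # d # r, q @ d # c # r}"
    using assms by (intro tie_class_edge) auto
  have "tie_class \<kappa> ([a, b] @ q @ c # d # r)
      = (\<Union>p'\<in>{[a, b], [b, a]}. (@) p' ` {q @ c # d # r, q @ d # c # r})"
    using assms ab
    by (subst tie_class_append) (auto simp: tie_class_pair inner intro: less_trans)
  moreover have "tie_class \<kappa> (p @ [a, b] @ q @ c # d # r)
      = (\<Union>p'\<in>{p}. (@) p' ` tie_class \<kappa> ([a, b] @ q @ c # d # r))"
    using assms ab pr
    by (subst tie_class_append) (auto simp: tie_class_strict sorted_wrt_append intro: less_trans)
  ultimately show ?thesis by auto
qed

lemma tie_class_hexagon: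
  assumes "sorted_wrt (<) (map \<kappa> (p @ [i]))" "\<kappa> i = (\<kappa> j :: real)" "\<kappa> j = \<kappa> k"
    "sorted_wrt (<) (map \<kappa> (k # q))" "distinct [i, j, k]"
  shows "tie_class \<kappa> (p @ i # j # k # q) =
    {p @ i # j # k # q, p @ j # i # k # q, p @ j # k # i # q,
     p @ k # j # i # q, p @ k # i # j # q, p @ i # k # j # q}"
proof -
  have less: "\<kappa> x < \<kappa> i" if "x \<in> set p" for x
    using assms(1) that by (auto simp: sorted_wrt_append)
  have greater: "\<kappa> i < \<kappa> y" if "y \<in> set q" for y
    using assms(2,3,4) that by auto
  have "tie_class \<kappa> ([i, j, k] @ q) = (\<Union>p'\<in>tie_class \<kappa> [i, j, k]. (@) p' ` {q})"
    using assms greater by (subst tie_class_append) (auto simp: tie_class_strict)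
  moreover have "tie_class \<kappa> (p @ [i, j, k] @ q)
      = (\<Union>p'\<in>{p}. (@) p' ` tie_class \<kappa> ([i, j, k] @ q))"
    using assms less greater
    by (subst tie_class_append) (auto simp: tie_class_strict sorted_wrt_append intro: less_trans)
  moreover note tie_class_triple[OF assms(2,3,5)]
  ultimately show ?thesis by auto
qed

abbreviation hexagon_flags :: "'a list \<Rightarrow> 'a \<Rightarrow> 'a \<Rightarrow> 'a \<Rightarrow> 'a list \<Rightarrow> 'a list set" where
  "hexagon_flags p i j k q \<equiv>
    {p @ i # j # k # q, p @ j # i # k # q, p @ j # k # i # q,
     p @ k # j # i # q, p @ k # i # j # q, p @ i # k # j # q}"

abbreviation square_flags :: "'a list \<Rightarrow> 'a \<Rightarrow> 'a \<Rightarrow> 'a list \<Rightarrow> 'a \<Rightarrow> 'a \<Rightarrow> 'a list \<Rightarrow> 'a list set" where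
  "square_flags p a b q c d r \<equiv>
    {p @ a # b # q @ c # d # r, p @ b # a # q @ c # d # r,
     p @ b # a # q @ d # c # r, p @ a # b # q @ d # c # r}"

abbreviation axis_diff :: "'n::finite \<Rightarrow> 'n \<Rightarrow> real ^ 'n" where
  "axis_diff a b \<equiv> axis a 1 - axis b 1"

text \<open>In the basis \<open>axis_diff i j\<close>, \<open>axis_diff j k\<close> every hexagon is
  the same lattice polygon, with vertices (0,0), (1,0), (2,1), (2,2), (1,2), (0,1) in cyclic order.
  Its long diagonals are twice a root.\<close>

lemma pt_hexagon:
  "pt (p @ j # i # k # q) = pt (p @ i # j # k # q) + axis_diff i j"
  "pt (p @ j # k # i # q) = pt (p @ i # j # k # q) + 2 *\<^sub>R axis_diff i j + axis_diff j k"
  "pt (p @ k # j # i # q) = pt (p @ i # j # k # q) + 2 *\<^sub>R axis_diff i j + 2 *\<^sub>R axis_diff j k"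
  "pt (p @ k # i # j # q) = pt (p @ i # j # k # q) + axis_diff i j + 2 *\<^sub>R axis_diff j k"
  "pt (p @ i # k # j # q) = pt (p @ i # j # k # q) + axis_diff j k"
proof -
  have e: "pt (p @ j # i # k # q) = pt (p @ i # j # k # q) + axis_diff i j"
    "pt (p @ j # k # i # q) = pt (p @ j # i # k # q) + axis_diff i k"
    "pt (p @ k # j # i # q) = pt (p @ j # k # i # q) + axis_diff j k"
    "pt (p @ i # k # j # q) = pt (p @ i # j # k # q) + axis_diff j k"
    "pt (p @ k # i # j # q) = pt (p @ i # k # j # q) + axis_diff i k"
    using pt_adjacent_swap[of p j i "k # q"] pt_adjacent_swap[of "p @ [j]" k i q]
      pt_adjacent_swap[of p k j "i # q"] pt_adjacent_swap[of "p @ [i]" k j q]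
      pt_adjacent_swap[of p k i "j # q"] by simp_all
  then show "pt (p @ j # i # k # q) = pt (p @ i # j # k # q) + axis_diff i j"
    "pt (p @ i # k # j # q) = pt (p @ i # j # k # q) + axis_diff j k"
    by simp_all
  show "pt (p @ j # k # i # q) = pt (p @ i # j # k # q) + 2 *\<^sub>R axis_diff i j + axis_diff j k"
    "pt (p @ k # j # i # q) = pt (p @ i # j # k # q) + 2 *\<^sub>R axis_diff i j + 2 *\<^sub>R axis_diff j k"
    "pt (p @ k # i # j # q) = pt (p @ i # j # k # q) + axis_diff i j + 2 *\<^sub>R axis_diff j k"
    unfolding e(2,3,5) unfolding e(2) unfolding e(1,4) by (simp_all add: scaleR_2)
qed

lemma pt_square:
  "pt (p @ b # a # q @ c # d # r) = pt (p @ a # b # q @ c # d # r) + axis_diff a b"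
  "pt (p @ b # a # q @ d # c # r) = pt (p @ a # b # q @ c # d # r) + axis_diff a b + axis_diff c d"
  "pt (p @ a # b # q @ d # c # r) = pt (p @ a # b # q @ c # d # r) + axis_diff c d"
  using pt_adjacent_swap[of p b a "q @ c # d # r"] pt_adjacent_swap[of "p @ b # a # q" d c r]
    pt_adjacent_swap[of "p @ a # b # q" d c r] by simp_all

text \<open>The coordinate \<open>d\<close> is constant on the first segment and changes along the
  second root. The index \<open>c\<close> may coincide with \<open>b\<close>, as it does for a
  hexagon.\<close>

lemma aff_dim_two_roots:
  fixes v :: "real ^ 'n"
  assumes "a \<noteq> b" "c \<noteq> d" "d \<noteq> a" "d \<noteq> b"
  shows "aff_dim {v + axis_diff c d, v + axis_diff a b, v} = 2"
proof -
  have "axis_diff a b $ b \<noteq> 0"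
    using assms by (simp add: axis_def)
  then have "axis_diff a b \<noteq> 0"
    by (metis zero_index)
  then have "aff_dim {v + axis_diff a b, v} = 1"
    by simp
  then show ?thesis
    using assms
    by (subst aff_dim_insert_off_hyperplane[where u = "axis d 1" and t = "axis d 1 \<bullet> v"])
      (auto simp: inner_add_right inner_diff_right inner_axis_axis)
qed

lemma aff_dim_three_roots:
  fixes v :: "real ^ 'n"
  assumes "a \<noteq> b" "c \<noteq> d" "d \<noteq> a" "d \<noteq> b" "e \<noteq> f" "f \<noteq> a" "f \<noteq> b" "f \<noteq> c" "f \<noteq> d"
  shows "aff_dim {v + axis_diff e f, v + axis_diff c d, v + axis_diff a b, v} = 3"
  using assms aff_dim_two_roots[of a b c d v]
  by (subst aff_dim_insert_off_hyperplane[where u = "axis f 1" and t = "axis f 1 \<bullet> v"])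
    (auto simp: inner_add_right inner_diff_right inner_axis_axis)

lemma aff_dim_planar:
  fixes v :: "'a::euclidean_space"
  assumes "\<And>x. x \<in> X \<Longrightarrow> \<exists>\<alpha> \<beta>. x = v + \<alpha> *\<^sub>R r + \<beta> *\<^sub>R s"
  shows "aff_dim X \<le> 2"
proof -
  have "X \<subseteq> affine hull {v, v + r, v + s}"
  proof
    fix x assume "x \<in> X"
    then obtain \<alpha> \<beta> where "x = v + \<alpha> *\<^sub>R r + \<beta> *\<^sub>R s"
      using assms by blast
    then have "x = (1 - \<alpha> - \<beta>) *\<^sub>R v + \<alpha> *\<^sub>R (v + r) + \<beta> *\<^sub>R (v + s)"
      by (simp add: algebra_simps)
    moreover have "(1 - \<alpha> - \<beta>) + \<alpha> + \<beta> = 1"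
      by simp
    ultimately show "x \<in> affine hull {v, v + r, v + s}"
      unfolding affine_hull_3 by blast
  qed
  then have "aff_dim X \<le> aff_dim {v, v + r, v + s}"
    using aff_dim_subset aff_dim_affine_hull by metis
  also have "\<dots> \<le> int (card {v, v + r, v + s}) - 1"
    by (rule aff_dim_le_card) simp
  also have "\<dots> \<le> 2"
    using card_insert_le_m1[of 3 "{v + r, v + s}" v] card_insert_le_m1[of 2 "{v + s}" "v + r"] by simp
  finally show ?thesis .
qed

text \<open>A face is given by a sorted key, and its dimension is read off from the ties: no tie is
  a vertex, one tie an edge, and three ties force dimension at least 3. Two ties remain.\<close>

lemma two_face_cases:
  fixes F :: "(real ^ 'n::{finite,linorder}) set"
  assumes "two_face F permutahedron"
  obtains p i j k q where "p @ i # j # k # q \<in> flags"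
      "{v. v extreme_point_of F} = pt ` hexagon_flags p i j k q"
  | p a b q c d r where "p @ a # b # q @ c # d # r \<in> flags"
      "{v. v extreme_point_of F} = pt ` square_flags p a b q c d r"
proof -
  have F: "F face_of permutahedron" "aff_dim F = 2"
    using assms by (auto simp: two_face_def)
  then have "F \<noteq> {}"
    by auto
  then obtain A where A: "F = convex hull (minimizers ((\<bullet>) A) (pt ` flags))"
    "{v. v extreme_point_of F} = minimizers ((\<bullet>) A) (pt ` flags)"
    using face_of_permutahedron F(1) by metis
  define \<kappa> where "\<kappa> x = - (A $ x)" for x
  obtain l where l: "distinct l" "set l = (UNIV :: 'n set)"
    using finite_distinct_list[of "UNIV :: 'n set"] by auto
  define xs where "xs = sort_key \<kappa> l"
  have xs: "xs \<in> flags" and sorted: "sorted (map \<kappa> xs)"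
    using l unfolding xs_def by (simp_all add: permutations_of_set_def)
  have "A = (\<chi> x. - \<kappa> x)"
    unfolding \<kappa>_def by (simp add: vec_eq_iff)
  then have min: "minimizers ((\<bullet>) A) (pt ` flags) = pt ` tie_class \<kappa> xs"
    using minimizers_sorted[OF xs sorted] by simp
  have dim: "aff_dim (pt ` tie_class \<kappa> xs) = 2"
    using F(2) unfolding A(1) min by (simp add: aff_dim_convex_hull)
  have dist: "distinct xs"
    using xs by (simp add: permutations_of_set_def)
  have not_strict: False if "sorted_wrt (<) (map \<kappa> xs)"
    using dim tie_class_strict[OF that] by simp
  then obtain p a b q where t1: "xs = p @ a # b # q" "\<kappa> a = \<kappa> b" "sorted_wrt (<) (map \<kappa> (p @ [a]))"
    using first_tie[OF sorted] by metis
  have "sorted (map \<kappa> (b # q))"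
    using sorted unfolding t1(1) by (simp add: sorted_append)
  then consider "sorted_wrt (<) (map \<kappa> (b # q))"
    | p' c d q' where "b # q = p' @ c # d # q'" "\<kappa> c = \<kappa> d" "sorted_wrt (<) (map \<kappa> (p' @ [c]))"
    using first_tie by metis
  then show ?thesis
  proof cases
    case 1
    have "tie_class \<kappa> xs = {p @ a # b # q, p @ b # a # q}"
      unfolding t1(1) by (rule tie_class_edge[OF t1(3,2) 1])
    then have "aff_dim (pt ` tie_class \<kappa> xs) \<le> 1"
      by simp
    with dim show ?thesis by simp
  next
    case 2
    have xs2: "xs = (p @ a # p') @ c # d # q'"
      unfolding t1(1) 2(1) by simp
    have "sorted (map \<kappa> (d # q'))"
      using sorted unfolding xs2 by (simp add: sorted_append)
    then consider "sorted_wrt (<) (map \<kappa> (d # q'))"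
      | p'' e f q'' where "d # q' = p'' @ e # f # q''" "\<kappa> e = \<kappa> f"
      using first_tie by metis
    then show ?thesis
    proof cases
      case strict: 1
      show ?thesis
      \<comment> \<open>Two ties that share the element \<open>b\<close> form a block of three,
        hence a hexagon; otherwise there are two separate blocks of two, hence a square.\<close>
      proof (cases p')
        case Nil
        then have "c = b" "xs = p @ a # b # d # q'"
          using 2(1) xs2 by auto
        moreover from this have "tie_class \<kappa> xs = hexagon_flags p a b d q'"
          using t1 2 strict dist by (simp add: tie_class_hexagon)
        ultimately show ?thesis
          using that(1) xs A(2) min by metis
      next
        case (Cons b' p2)
        then have "b' = b" "xs = p @ a # b # p2 @ c # d # q'"
          using 2(1) xs2 by auto
        moreover from this have "tie_class \<kappa> xs = square_flags p a b p2 c d q'"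
          using t1 2 strict Cons by (simp add: tie_class_square)
        ultimately show ?thesis
          using that(2) xs A(2) min by metis
      qed
    next
      case third: 2
      have xs3: "xs = (p @ a # p' @ c # p'') @ e # f # q''"
        unfolding xs2 third(1) by simp
      \<comment> \<open>The ties end in the different elements \<open>b\<close>, \<open>d\<close>,
        \<open>f\<close>, so each of the three swaps contributes a root with a coordinate not seen
        before.\<close>
      have "a \<noteq> b"
        using dist unfolding t1(1) by simp
      moreover have "c \<noteq> d" "d \<noteq> a"
        using dist unfolding xs2 by auto
      moreover have "d \<noteq> b"
        using dist 2(1) unfolding t1(1) by (cases p') auto
      moreover have "e \<noteq> f" "f \<noteq> a" "f \<noteq> c"
        using dist unfolding xs3 by auto
      moreover have "f \<noteq> d"
        using dist third(1) unfolding xs2 by (cases p'') auto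
      moreover have "f \<noteq> b"
        using dist 2(1) third(1) \<open>f \<noteq> c\<close> unfolding t1(1) by (cases p'; cases p'') auto
      ultimately have "aff_dim {pt xs + axis_diff e f, pt xs + axis_diff c d, pt xs + axis_diff a b, pt xs} = 3"
        by (intro aff_dim_three_roots)
      moreover have "pt (p @ b # a # q) = pt xs + axis_diff a b"
        unfolding t1(1) by (rule pt_adjacent_swap)
      moreover have "pt ((p @ a # p') @ d # c # q') = pt xs + axis_diff c d"
        unfolding xs2 by (rule pt_adjacent_swap)
      moreover have "pt ((p @ a # p' @ c # p'') @ f # e # q'') = pt xs + axis_diff e f"
        unfolding xs3 by (rule pt_adjacent_swap)
      moreover have "p @ b # a # q \<in> tie_class \<kappa> xs"
        unfolding t1(1) using t1(2) by (simp add: tie_class_def)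
      moreover have "(p @ a # p') @ d # c # q' \<in> tie_class \<kappa> xs"
        unfolding xs2 using 2(2) by (simp add: tie_class_def)
      moreover have "(p @ a # p' @ c # p'') @ f # e # q'' \<in> tie_class \<kappa> xs"
        unfolding xs3 using third(2) by (simp add: tie_class_def)
      moreover have "xs \<in> tie_class \<kappa> xs"
        by (simp add: tie_class_def)
      ultimately have "3 \<le> aff_dim (pt ` tie_class \<kappa> xs)"
        using aff_dim_subset[of "{pt xs + axis_diff e f, pt xs + axis_diff c d, pt xs + axis_diff a b, pt xs}"
            "pt ` tie_class \<kappa> xs"] by (metis (no_types, lifting) empty_subsetI imageI insert_subset)
      with dim show ?thesis by simp
    qed
  qed
qed

lemma face_of_sorted_key:
  fixes xs :: "'n::{finite,linorder} list"
  assumes "xs \<in> flags" "sorted (map \<kappa> xs)"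
  shows "convex hull (pt ` tie_class \<kappa> xs) face_of permutahedron"
    and "{v. v extreme_point_of convex hull (pt ` tie_class \<kappa> xs)} = pt ` tie_class \<kappa> xs"
proof -
  have min: "minimizers ((\<bullet>) (\<chi> x. - \<kappa> x)) (pt ` flags) = pt ` tie_class \<kappa> xs"
    by (rule minimizers_sorted[OF assms])
  then show face: "convex hull (pt ` tie_class \<kappa> xs) face_of permutahedron"
    using face_of_minimizers[OF finite_vertices, of "\<chi> x. - \<kappa> x :: real ^ 'n::{finite,linorder}"] permutahedron_eq by metis
  show "{v. v extreme_point_of convex hull (pt ` tie_class \<kappa> xs)} = pt ` tie_class \<kappa> xs"
  proof
    show "{v. v extreme_point_of convex hull (pt ` tie_class \<kappa> xs)} \<subseteq> pt ` tie_class \<kappa> xs"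
      by (rule extreme_points_of_convex_hull)
    have "pt ` tie_class \<kappa> xs \<subseteq> {v. v extreme_point_of permutahedron}"
      unfolding extreme_points_permutahedron min[symmetric] by (auto simp: minimizers_def)
    then show "pt ` tie_class \<kappa> xs \<subseteq> {v. v extreme_point_of convex hull (pt ` tie_class \<kappa> xs)}"
      using extreme_point_of_face[OF face] hull_subset[of "pt ` tie_class \<kappa> xs" convex] by blast
  qed
qed

lemma hexagon_face:
  fixes p q :: "'n::{finite,linorder} list"
  assumes fl: "p @ i # j # k # q \<in> flags"
  shows "two_face (convex hull (pt ` hexagon_flags p i j k q)) permutahedron"
    and "{v. v extreme_point_of convex hull (pt ` hexagon_flags p i j k q)} = pt ` hexagon_flags p i j k q"
proof -
  have dist: "distinct (p @ i # j # k # q)"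
    using fl by (simp add: permutations_of_set_def)
  obtain \<kappa>0 :: "'n \<Rightarrow> real" where \<kappa>0: "sorted_wrt (<) (map \<kappa>0 (p @ i # j # k # q))"
    using distinct_sorted_key[OF dist] .
  \<comment> \<open>Merging the keys of three neighbours in a strictly increasing key produces
    exactly the block of the hexagon.\<close>
  define \<kappa> where "\<kappa> = \<kappa>0(i := \<kappa>0 j, k := \<kappa>0 j)"
  have map: "map \<kappa> p = map \<kappa>0 p" "map \<kappa> q = map \<kappa>0 q"
    using dist unfolding \<kappa>_def by auto
  have \<kappa>: "\<kappa> i = \<kappa>0 j" "\<kappa> j = \<kappa>0 j" "\<kappa> k = \<kappa>0 j"
    using dist unfolding \<kappa>_def by auto
  have kp: "\<And>x. x \<in> set p \<Longrightarrow> \<kappa> x = \<kappa>0 x" "\<And>x. x \<in> set q \<Longrightarrow> \<kappa> x = \<kappa>0 x"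
    using map by auto
  have strict: "sorted_wrt (<) (map \<kappa> (p @ [i]))" "sorted_wrt (<) (map \<kappa> (k # q))"
    using \<kappa>0 by (auto simp: sorted_wrt_append map \<kappa> kp)
  have "sorted (map \<kappa> (p @ i # j # k # q))"
    using \<kappa>0 by (auto simp: sorted_wrt_append sorted_append map \<kappa> kp strict_sorted_imp_sorted
        intro: less_imp_le less_trans)
  note face = face_of_sorted_key[OF fl this]
  have tie: "tie_class \<kappa> (p @ i # j # k # q) = hexagon_flags p i j k q"
    using strict \<kappa> dist by (intro tie_class_hexagon) auto
  let ?v = "pt (p @ i # j # k # q)"
  have "aff_dim (pt ` hexagon_flags p i j k q) \<le> 2"
  proof (rule aff_dim_planar)
    fix x assume "x \<in> pt ` hexagon_flags p i j k q"
    then consider "x = ?v + 0 *\<^sub>R axis_diff i j + 0 *\<^sub>R axis_diff j k" | "x = ?v + 1 *\<^sub>R axis_diff i j + 0 *\<^sub>R axis_diff j k"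
      | "x = ?v + 2 *\<^sub>R axis_diff i j + 1 *\<^sub>R axis_diff j k" | "x = ?v + 2 *\<^sub>R axis_diff i j + 2 *\<^sub>R axis_diff j k"
      | "x = ?v + 1 *\<^sub>R axis_diff i j + 2 *\<^sub>R axis_diff j k" | "x = ?v + 0 *\<^sub>R axis_diff i j + 1 *\<^sub>R axis_diff j k"
      by (auto simp: pt_hexagon[where p = p and i = i and j = j and k = k and q = q])
    then show "\<exists>\<alpha> \<beta>. x = ?v + \<alpha> *\<^sub>R axis_diff i j + \<beta> *\<^sub>R axis_diff j k"
      by cases blast+
  qed
  moreover have "{?v + axis_diff j k, ?v + axis_diff i j, ?v} \<subseteq> pt ` hexagon_flags p i j k q"
    by (simp add: pt_hexagon[where p = p and i = i and j = j and k = k and q = q])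
  then have "aff_dim {?v + axis_diff j k, ?v + axis_diff i j, ?v} \<le> aff_dim (pt ` hexagon_flags p i j k q)"
    by (rule aff_dim_subset)
  then have "2 \<le> aff_dim (pt ` hexagon_flags p i j k q)"
    using dist aff_dim_two_roots[of i j j k ?v] by auto
  ultimately show "two_face (convex hull (pt ` hexagon_flags p i j k q)) permutahedron"
    using face(1) unfolding tie two_face_def by (simp add: aff_dim_convex_hull)
  show "{v. v extreme_point_of convex hull (pt ` hexagon_flags p i j k q)} = pt ` hexagon_flags p i j k q"
    using face(2) unfolding tie .
qed

lemma square_face:
  fixes p q :: "'n::{finite,linorder} list"
  assumes fl: "p @ a # b # q @ c # d # r \<in> flags"
  shows "two_face (convex hull (pt ` square_flags p a b q c d r)) permutahedron"
    and "{v. v extreme_point_of convex hull (pt ` square_flags p a b q c d r)} = pt ` square_flags p a b q c d r"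
proof -
  have dist: "distinct (p @ a # b # q @ c # d # r)"
    using fl by (simp add: permutations_of_set_def)
  obtain \<kappa>0 :: "'n \<Rightarrow> real" where \<kappa>0: "sorted_wrt (<) (map \<kappa>0 (p @ a # b # q @ c # d # r))"
    using distinct_sorted_key[OF dist] .
  \<comment> \<open>Each pair takes its key from the member next to \<open>q\<close>, so the strict
    increase from the first pair through \<open>q\<close> to the second is inherited
    directly.\<close>
  define \<kappa> where "\<kappa> = \<kappa>0(a := \<kappa>0 b, d := \<kappa>0 c)"
  have map: "map \<kappa> p = map \<kappa>0 p" "map \<kappa> q = map \<kappa>0 q" "map \<kappa> r = map \<kappa>0 r"
    using dist unfolding \<kappa>_def by auto
  have \<kappa>: "\<kappa> a = \<kappa>0 b" "\<kappa> b = \<kappa>0 b" "\<kappa> c = \<kappa>0 c" "\<kappa> d = \<kappa>0 c"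
    using dist unfolding \<kappa>_def by auto
  have kp: "\<And>x. x \<in> set p \<Longrightarrow> \<kappa> x = \<kappa>0 x" "\<And>x. x \<in> set q \<Longrightarrow> \<kappa> x = \<kappa>0 x"
    "\<And>x. x \<in> set r \<Longrightarrow> \<kappa> x = \<kappa>0 x"
    using map by auto
  have strict: "sorted_wrt (<) (map \<kappa> (p @ [a]))" "sorted_wrt (<) (map \<kappa> (b # q @ [c]))"
    "sorted_wrt (<) (map \<kappa> (d # r))"
    using \<kappa>0 by (auto simp: sorted_wrt_append map \<kappa> kp)
  have "sorted (map \<kappa> (p @ a # b # q @ c # d # r))"
    using \<kappa>0 by (auto simp: sorted_wrt_append sorted_append map \<kappa> kp strict_sorted_imp_sorted
        intro: less_imp_le less_trans)
  note face = face_of_sorted_key[OF fl this]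
  have tie: "tie_class \<kappa> (p @ a # b # q @ c # d # r) = square_flags p a b q c d r"
    using strict \<kappa> by (intro tie_class_square) auto
  let ?v = "pt (p @ a # b # q @ c # d # r)"
  have "aff_dim (pt ` square_flags p a b q c d r) \<le> 2"
  proof (rule aff_dim_planar)
    fix x assume "x \<in> pt ` square_flags p a b q c d r"
    then consider "x = ?v + 0 *\<^sub>R axis_diff a b + 0 *\<^sub>R axis_diff c d" | "x = ?v + 1 *\<^sub>R axis_diff a b + 0 *\<^sub>R axis_diff c d"
      | "x = ?v + 1 *\<^sub>R axis_diff a b + 1 *\<^sub>R axis_diff c d" | "x = ?v + 0 *\<^sub>R axis_diff a b + 1 *\<^sub>R axis_diff c d"
      by (auto simp: pt_square[where p = p and a = a and b = b and q = q and c = c and d = d and r = r])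
    then show "\<exists>\<alpha> \<beta>. x = ?v + \<alpha> *\<^sub>R axis_diff a b + \<beta> *\<^sub>R axis_diff c d"
      by cases blast+
  qed
  moreover have "{?v + axis_diff c d, ?v + axis_diff a b, ?v} \<subseteq> pt ` square_flags p a b q c d r"
    by (simp add: pt_square[where p = p and a = a and b = b and q = q and c = c and d = d and r = r])
  then have "aff_dim {?v + axis_diff c d, ?v + axis_diff a b, ?v} \<le> aff_dim (pt ` square_flags p a b q c d r)"
    by (rule aff_dim_subset)
  then have "2 \<le> aff_dim (pt ` square_flags p a b q c d r)"
    using dist aff_dim_two_roots[of a b c d ?v] by auto
  ultimately show "two_face (convex hull (pt ` square_flags p a b q c d r)) permutahedron"
    using face(1) unfolding tie two_face_def by (simp add: aff_dim_convex_hull)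
  show "{v. v extreme_point_of convex hull (pt ` square_flags p a b q c d r)} = pt ` square_flags p a b q c d r"
    using face(2) unfolding tie .
qed

subsection \<open>Subdivisions of the two-dimensional faces\<close>

text \<open>Permuting \<open>i\<close>, \<open>j\<close>, \<open>k\<close> changes only the starting
  vertex and the orientation of the hexagon, so a statement at one vertex transfers to all
  six.\<close>

lemma hexagon_flags_rename:
  "hexagon_flags p j k i q = hexagon_flags p i j k q"
  "hexagon_flags p k i j q = hexagon_flags p i j k q"
  "hexagon_flags p j i k q = hexagon_flags p i j k q"
  "hexagon_flags p i k j q = hexagon_flags p i j k q"
  "hexagon_flags p k j i q = hexagon_flags p i j k q"
  by blast+

lemma square_flags_rename: "square_flags p b a q c d r = square_flags p a b q c d r"
  by blast

lemma flags_rename: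
  assumes "p @ i # j # k # q \<in> flags"
  shows "p @ j # k # i # q \<in> flags" "p @ k # i # j # q \<in> flags" "p @ j # i # k # q \<in> flags"
    "p @ i # k # j # q \<in> flags" "p @ k # j # i # q \<in> flags"
  using assms by (auto simp: permutations_of_set_def insert_commute)

text \<open>If exactly two vertices are minimal, the segment between them is a cell and its own
  edge, hence parallel to a root. A root has only two nonzero coordinates, so it vanishes at one of
  any three.\<close>

lemma permutahedral_diagonal_cell:
  fixes F :: "(real ^ 'n::{finite,linorder}) set"
  assumes perm: "permutahedral (regular_subdivision F h)"
    and V: "{v. v extreme_point_of F} = V" and fin: "finite V"
    and min: "minimizers (\<lambda>v. h v + u \<bullet> v) V = {x, y}"
    and ijk: "distinct [i, j, k]"
  shows "(y - x) $ i = 0 \<or> (y - x) $ j = 0 \<or> (y - x) $ k = 0"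
proof (cases "x = y")
  case False
  have "V \<noteq> {}"
    using min by (auto simp: minimizers_def)
  then have "convex hull {x, y} \<in> regular_subdivision F h"
    using regular_subdivision_iff[OF V fin] min by metis
  then have "generalized_permutahedron (convex hull {x, y})"
    using perm by (simp add: permutahedral_def)
  moreover have "(convex hull {x, y}) edge_of (convex hull {x, y})"
    unfolding edge_of_def using False by (simp add: aff_dim_convex_hull face_of_refl)
  moreover have "x \<in> convex hull {x, y}" "y \<in> convex hull {x, y}"
    by (simp_all add: hull_inc)
  ultimately obtain a b c where "y - x = c *\<^sub>R axis_diff a b"
    unfolding generalized_permutahedron_def by meson
  then show ?thesis
    using ijk by (auto simp: axis_def)
qed simp

text \<open>
  The minimizing functional makes the two ends of a short diagonal \<open>x\<^sub>0 x\<^sub>2\<close> of the hexagon equal;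
  one degree of freedom remains, and the three inequalities say that the lower bound on it coming
  from \<open>x\<^sub>1\<close> lies below the upper bounds coming from \<open>x\<^sub>3\<close>, \<open>x\<^sub>4\<close> and \<open>x\<^sub>5\<close>.
\<close>

lemma hexagon_short_diagonal:
  fixes F :: "(real ^ 'n::{finite,linorder}) set"
  assumes perm: "permutahedral (regular_subdivision F h)" and fl: "p @ i # j # k # q \<in> flags"
    and V: "{v. v extreme_point_of F} = pt ` hexagon_flags p i j k q"
    and w: "w0 = h (pt (p @ i # j # k # q))" "w1 = h (pt (p @ j # i # k # q))"
      "w2 = h (pt (p @ j # k # i # q))" "w3 = h (pt (p @ k # j # i # q))"
      "w4 = h (pt (p @ k # i # j # q))" "w5 = h (pt (p @ i # k # j # q))"
  shows "\<not> (w0 + 2 * w2 < 2 * w1 + w3 \<and> 2 * w0 + 2 * w2 < 3 * w1 + w4 \<and> 2 * w0 + w2 < 2 * w1 + w5)"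
proof
  assume less: "w0 + 2 * w2 < 2 * w1 + w3 \<and> 2 * w0 + 2 * w2 < 3 * w1 + w4 \<and> 2 * w0 + w2 < 2 * w1 + w5"
  have ijk: "distinct [i, j, k]"
    using fl by (auto simp: permutations_of_set_def)
  have "w0 - w1 < min ((w3 + w0 - 2 * w2) / 2) (min ((w4 + w0 - 2 * w2) / 3) ((w5 - w2) / 2))"
    using less by auto
  then obtain \<alpha> where \<alpha>: "w0 - w1 < \<alpha>"
    "\<alpha> < min ((w3 + w0 - 2 * w2) / 2) (min ((w4 + w0 - 2 * w2) / 3) ((w5 - w2) / 2))"
    using dense by blast
  define \<beta> where "\<beta> = w0 - w2 - 2 * \<alpha>"
  define u :: "real ^ 'n::{finite,linorder}" where "u = \<alpha> *\<^sub>R axis i 1 - \<beta> *\<^sub>R axis k 1"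
  have u: "u \<bullet> axis_diff i j = \<alpha>" "u \<bullet> axis_diff j k = \<beta>"
    using ijk unfolding u_def by (auto simp: inner_diff_left inner_diff_right inner_axis_axis)
  define c where "c = u \<bullet> pt (p @ i # j # k # q)"
  define f where "f v = h v + u \<bullet> v" for v
  have val: "f (pt (p @ i # j # k # q)) = w0 + c" "f (pt (p @ j # i # k # q)) = w1 + c + \<alpha>"
    "f (pt (p @ j # k # i # q)) = w2 + c + 2 * \<alpha> + \<beta>"
    "f (pt (p @ k # j # i # q)) = w3 + c + 2 * \<alpha> + 2 * \<beta>"
    "f (pt (p @ k # i # j # q)) = w4 + c + \<alpha> + 2 * \<beta>" "f (pt (p @ i # k # j # q)) = w5 + c + \<beta>"
    unfolding f_def w pt_hexagon[where i = i and j = j and k = k] inner_add_right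
      inner_scaleR_right u c_def[symmetric]
    by simp_all
  have bounds: "w0 < w1 + \<alpha>" "w0 = w2 + 2 * \<alpha> + \<beta>" "w0 < w3 + 2 * \<alpha> + 2 * \<beta>"
    "w0 < w4 + \<alpha> + 2 * \<beta>" "w0 < w5 + \<beta>"
    using \<alpha> unfolding \<beta>_def by auto
  have "minimizers f (pt ` hexagon_flags p i j k q)
      = {pt (p @ i # j # k # q), pt (p @ j # k # i # q)}"
    using bounds unfolding minimizers_def by (auto simp: val)
  then have "(pt (p @ j # k # i # q) - pt (p @ i # j # k # q)) $ i = 0
      \<or> (pt (p @ j # k # i # q) - pt (p @ i # j # k # q)) $ j = 0
      \<or> (pt (p @ j # k # i # q) - pt (p @ i # j # k # q)) $ k = 0"
    unfolding f_def by (intro permutahedral_diagonal_cell[OF perm V _ _ ijk]) auto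
  then show False
    using ijk unfolding pt_hexagon[where i = i and j = j and k = k] by (auto simp: axis_def)
qed

text \<open>The hypotheses exclude the six short diagonals as cells. As the vertices are in convex
  position, the hexagon is then undivided or cut along one long diagonal, say from vertex 0 to
  vertex 3. Flatness of the two trapezoids gives w3 - w0 = 2 (w2 - w1) = 2 (w4 - w5), hence the
  equation and w1 + w4 = w2 + w5; since the diagonal lies below, this common value is the
  maximum.\<close>

lemma hexagon_arithmetic:
  fixes w0 w1 w2 w3 w4 w5 :: real
  assumes "\<not> (w0 + 2 * w2 < 2 * w1 + w3 \<and> 2 * w0 + 2 * w2 < 3 * w1 + w4 \<and> 2 * w0 + w2 < 2 * w1 + w5)"
    "\<not> (w2 + 2 * w4 < 2 * w3 + w5 \<and> 2 * w2 + 2 * w4 < 3 * w3 + w0 \<and> 2 * w2 + w4 < 2 * w3 + w1)"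
    "\<not> (w4 + 2 * w0 < 2 * w5 + w1 \<and> 2 * w4 + 2 * w0 < 3 * w5 + w2 \<and> 2 * w4 + w0 < 2 * w5 + w3)"
    "\<not> (w1 + 2 * w5 < 2 * w0 + w4 \<and> 2 * w1 + 2 * w5 < 3 * w0 + w3 \<and> 2 * w1 + w5 < 2 * w0 + w2)"
    "\<not> (w5 + 2 * w3 < 2 * w4 + w2 \<and> 2 * w5 + 2 * w3 < 3 * w4 + w1 \<and> 2 * w5 + w3 < 2 * w4 + w0)"
    "\<not> (w3 + 2 * w1 < 2 * w2 + w0 \<and> 2 * w3 + 2 * w1 < 3 * w2 + w5 \<and> 2 * w3 + w1 < 2 * w2 + w4)"
  shows "w0 + w2 + w4 = w1 + w3 + w5 \<and> max_attained_twice (w0 + w3) (w1 + w4) (w2 + w5)"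
proof
  show eq: "w0 + w2 + w4 = w1 + w3 + w5"
    using assms by smt
  show "max_attained_twice (w0 + w3) (w1 + w4) (w2 + w5)"
    unfolding max_attained_twice_def Let_def max_def using assms eq by smt
qed

lemma hexagon_conditions:
  fixes F :: "(real ^ 'n::{finite,linorder}) set"
  assumes perm: "permutahedral (regular_subdivision F h)" and fl: "p @ i # j # k # q \<in> flags"
    and V: "{v. v extreme_point_of F} = pt ` hexagon_flags p i j k q"
  defines "w xs \<equiv> h (pt (p @ xs @ q))"
  shows "w [i, j, k] + w [j, k, i] + w [k, i, j] = w [j, i, k] + w [k, j, i] + w [i, k, j] \<and>
    max_attained_twice (w [i, j, k] + w [k, j, i]) (w [j, i, k] + w [k, i, j]) (w [j, k, i] + w [i, k, j])"
proof (rule hexagon_arithmetic)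
  note diag = hexagon_short_diagonal[OF perm, OF _ _ refl refl refl refl refl refl]
  note ren = hexagon_flags_rename[where p = p and i = i and j = j and k = k and q = q]
  note fls = flags_rename[OF fl]
  show "\<not> (w [i, j, k] + 2 * w [j, k, i] < 2 * w [j, i, k] + w [k, j, i] \<and>
      2 * w [i, j, k] + 2 * w [j, k, i] < 3 * w [j, i, k] + w [k, i, j] \<and>
      2 * w [i, j, k] + w [j, k, i] < 2 * w [j, i, k] + w [i, k, j])"
    using diag[OF fl] V unfolding w_def by simp
  show "\<not> (w [j, k, i] + 2 * w [k, i, j] < 2 * w [k, j, i] + w [i, k, j] \<and>
      2 * w [j, k, i] + 2 * w [k, i, j] < 3 * w [k, j, i] + w [i, j, k] \<and>
      2 * w [j, k, i] + w [k, i, j] < 2 * w [k, j, i] + w [j, i, k])"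
    using diag[OF fls(1), unfolded ren, OF V] unfolding w_def by simp
  show "\<not> (w [k, i, j] + 2 * w [i, j, k] < 2 * w [i, k, j] + w [j, i, k] \<and>
      2 * w [k, i, j] + 2 * w [i, j, k] < 3 * w [i, k, j] + w [j, k, i] \<and>
      2 * w [k, i, j] + w [i, j, k] < 2 * w [i, k, j] + w [k, j, i])"
    using diag[OF fls(2), unfolded ren, OF V] unfolding w_def by simp
  show "\<not> (w [j, i, k] + 2 * w [i, k, j] < 2 * w [i, j, k] + w [k, i, j] \<and>
      2 * w [j, i, k] + 2 * w [i, k, j] < 3 * w [i, j, k] + w [k, j, i] \<and>
      2 * w [j, i, k] + w [i, k, j] < 2 * w [i, j, k] + w [j, k, i])"
    using diag[OF fls(3), unfolded ren, OF V] unfolding w_def by simp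
  show "\<not> (w [i, k, j] + 2 * w [k, j, i] < 2 * w [k, i, j] + w [j, k, i] \<and>
      2 * w [i, k, j] + 2 * w [k, j, i] < 3 * w [k, i, j] + w [j, i, k] \<and>
      2 * w [i, k, j] + w [k, j, i] < 2 * w [k, i, j] + w [i, j, k])"
    using diag[OF fls(4), unfolded ren, OF V] unfolding w_def by simp
  show "\<not> (w [k, j, i] + 2 * w [j, i, k] < 2 * w [j, k, i] + w [i, j, k] \<and>
      2 * w [k, j, i] + 2 * w [j, i, k] < 3 * w [j, k, i] + w [i, k, j] \<and>
      2 * w [k, j, i] + w [j, i, k] < 2 * w [j, k, i] + w [k, i, j])"
    using diag[OF fls(5), unfolded ren, OF V] unfolding w_def by simp
qed

text \<open>Otherwise a functional that balances the ends of the diagonal through the first vertex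
  would make this diagonal a cell, although its direction has four nonzero coordinates. The diagonal
  through the second vertex gives the reverse inequality.\<close>

lemma square_diagonal:
  fixes F :: "(real ^ 'n::{finite,linorder}) set"
  assumes perm: "permutahedral (regular_subdivision F h)" and fl: "p @ a # b # q @ c # d # r \<in> flags"
    and V: "{v. v extreme_point_of F} = pt ` square_flags p a b q c d r"
    and w: "w0 = h (pt (p @ a # b # q @ c # d # r))" "w1 = h (pt (p @ b # a # q @ c # d # r))"
      "w2 = h (pt (p @ b # a # q @ d # c # r))" "w3 = h (pt (p @ a # b # q @ d # c # r))"
  shows "w1 + w3 \<le> w0 + w2"
proof (rule ccontr)
  assume "\<not> w1 + w3 \<le> w0 + w2"
  then have "w0 - w1 < w3 - w2"
    by simp
  then obtain \<alpha> where \<alpha>: "w0 - w1 < \<alpha>" "\<alpha> < w3 - w2"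
    using dense by blast
  define \<beta> where "\<beta> = w0 - w2 - \<alpha>"
  have dist: "distinct [a, b, c, d]"
    using fl by (auto simp: permutations_of_set_def)
  define u :: "real ^ 'n::{finite,linorder}" where "u = \<alpha> *\<^sub>R axis a 1 + \<beta> *\<^sub>R axis c 1"
  have u: "u \<bullet> axis_diff a b = \<alpha>" "u \<bullet> axis_diff c d = \<beta>"
    using dist unfolding u_def by (auto simp: inner_add_left inner_diff_right inner_axis_axis)
  define t where "t = u \<bullet> pt (p @ a # b # q @ c # d # r)"
  define f where "f v = h v + u \<bullet> v" for v
  have val: "f (pt (p @ a # b # q @ c # d # r)) = w0 + t" "f (pt (p @ b # a # q @ c # d # r)) = w1 + t + \<alpha>"
    "f (pt (p @ b # a # q @ d # c # r)) = w2 + t + \<alpha> + \<beta>" "f (pt (p @ a # b # q @ d # c # r)) = w3 + t + \<beta>"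
    unfolding f_def w pt_square[where a = a and b = b and c = c and d = d] inner_add_right
      u t_def[symmetric]
    by simp_all
  have bounds: "w0 < w1 + \<alpha>" "w0 = w2 + \<alpha> + \<beta>" "w0 < w3 + \<beta>"
    using \<alpha> unfolding \<beta>_def by auto
  have "minimizers f (pt ` square_flags p a b q c d r)
      = {pt (p @ a # b # q @ c # d # r), pt (p @ b # a # q @ d # c # r)}"
    using bounds unfolding minimizers_def by (auto simp: val)
  then have "(pt (p @ b # a # q @ d # c # r) - pt (p @ a # b # q @ c # d # r)) $ a = 0
      \<or> (pt (p @ b # a # q @ d # c # r) - pt (p @ a # b # q @ c # d # r)) $ b = 0
      \<or> (pt (p @ b # a # q @ d # c # r) - pt (p @ a # b # q @ c # d # r)) $ c = 0"
    unfolding f_def using dist by (intro permutahedral_diagonal_cell[OF perm V]) auto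
  then show False
    using dist unfolding pt_square[where a = a and b = b and c = c and d = d] by (auto simp: axis_def)
qed

lemma square_condition:
  fixes F :: "(real ^ 'n::{finite,linorder}) set"
  assumes perm: "permutahedral (regular_subdivision F h)" and fl: "p @ a # b # q @ c # d # r \<in> flags"
    and V: "{v. v extreme_point_of F} = pt ` square_flags p a b q c d r"
  shows "h (pt (p @ a # b # q @ c # d # r)) + h (pt (p @ b # a # q @ d # c # r))
    = h (pt (p @ b # a # q @ c # d # r)) + h (pt (p @ a # b # q @ d # c # r))"
proof -
  have "p @ b # a # q @ c # d # r \<in> flags"
    using fl by (auto simp: permutations_of_set_def insert_commute)
  then show ?thesis
    using square_diagonal[OF perm fl V refl refl refl refl]
      square_diagonal[OF perm, of p b a q c d r, unfolded square_flags_rename[of p b a q c d r], OF _ V refl refl refl refl]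
    by linarith
qed

section \<open>Local conditions and the subdivision of the whole permutahedron\<close>

definition local_conditions :: "(real ^ 'n::finite \<Rightarrow> real) \<Rightarrow> bool" where
  "local_conditions h \<longleftrightarrow> square_additive UNIV (\<lambda>xs. h (pt xs)) \<and>
     hexagon_additive UNIV (\<lambda>xs. h (pt xs)) \<and> hexagon_max UNIV (\<lambda>xs. h (pt xs))"

lemma local_conditions_of_two_faces:
  fixes h :: "real ^ 'n::{finite,linorder} \<Rightarrow> real"
  assumes "\<And>F. two_face F permutahedron \<Longrightarrow> permutahedral (regular_subdivision F h)"
  shows "local_conditions h"
  unfolding local_conditions_def square_additive_def hexagon_additive_def hexagon_max_def
proof (intro conjI allI impI)
  fix p q r :: "'n list" and a b c d
  assume "p @ a # b # q @ c # d # r \<in> flags"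
  then show "h (pt (p @ a # b # q @ c # d # r)) + h (pt (p @ b # a # q @ d # c # r))
    = h (pt (p @ b # a # q @ c # d # r)) + h (pt (p @ a # b # q @ d # c # r))"
    using square_condition assms square_face by metis
next
  fix p q :: "'n list" and i j k
  assume fl: "p @ i # j # k # q \<in> flags"
  note hex = hexagon_conditions[OF assms[OF hexagon_face(1)[OF fl]] fl hexagon_face(2)[OF fl]]
  show "h (pt (p @ i # j # k # q)) + h (pt (p @ j # k # i # q)) + h (pt (p @ k # i # j # q))
      = h (pt (p @ j # i # k # q)) + h (pt (p @ k # j # i # q)) + h (pt (p @ i # k # j # q))"
    "max_attained_twice (h (pt (p @ i # j # k # q)) + h (pt (p @ k # j # i # q)))
      (h (pt (p @ j # i # k # q)) + h (pt (p @ k # i # j # q)))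
      (h (pt (p @ j # k # i # q)) + h (pt (p @ i # k # j # q)))"
    using hex by simp_all
qed

lemma max_attained_twice_add:
  "max_attained_twice (x + t) (y + t) (z + t) \<longleftrightarrow> max_attained_twice x y z"
  unfolding max_attained_twice_def Let_def max_def by auto

text \<open>Opposite pairs of a square have equal sums, and so do the two triangles of a hexagon;
  the three long diagonals of a hexagon share their midpoint. A linear functional therefore cancels
  in the equations and adds the same \<open>t\<close> to all three terms of the maximum.\<close>

lemma local_conditions_add_linear:
  assumes "local_conditions h"
  shows "local_conditions (\<lambda>v. h v + u \<bullet> v)"
  unfolding local_conditions_def square_additive_def hexagon_additive_def hexagon_max_def
proof (intro conjI allI impI)
  fix p q r :: "'a list" and a b c d
  assume "p @ a # b # q @ c # d # r \<in> flags"
  then have "h (pt (p @ a # b # q @ c # d # r)) + h (pt (p @ b # a # q @ d # c # r))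
    = h (pt (p @ b # a # q @ c # d # r)) + h (pt (p @ a # b # q @ d # c # r))"
    using assms unfolding local_conditions_def square_additive_def by blast
  moreover have "u \<bullet> pt (p @ a # b # q @ c # d # r) + u \<bullet> pt (p @ b # a # q @ d # c # r)
    = u \<bullet> pt (p @ b # a # q @ c # d # r) + u \<bullet> pt (p @ a # b # q @ d # c # r)"
    unfolding pt_square[where a = a and b = b and c = c and d = d] inner_add_right by simp
  ultimately show "h (pt (p @ a # b # q @ c # d # r)) + u \<bullet> pt (p @ a # b # q @ c # d # r) +
      (h (pt (p @ b # a # q @ d # c # r)) + u \<bullet> pt (p @ b # a # q @ d # c # r))
    = h (pt (p @ b # a # q @ c # d # r)) + u \<bullet> pt (p @ b # a # q @ c # d # r) +
      (h (pt (p @ a # b # q @ d # c # r)) + u \<bullet> pt (p @ a # b # q @ d # c # r))"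
    by linarith
next
  fix p q :: "'a list" and i j k
  assume fl: "p @ i # j # k # q \<in> flags"
  let ?v = "pt (p @ i # j # k # q)"
  define t where "t = 2 * (u \<bullet> ?v) + 2 * (u \<bullet> axis_diff i j) + 2 * (u \<bullet> axis_diff j k)"
  have lin: "u \<bullet> ?v + u \<bullet> pt (p @ k # j # i # q) = t"
    "u \<bullet> pt (p @ j # i # k # q) + u \<bullet> pt (p @ k # i # j # q) = t"
    "u \<bullet> pt (p @ j # k # i # q) + u \<bullet> pt (p @ i # k # j # q) = t"
    unfolding pt_hexagon[where i = i and j = j and k = k] inner_add_right inner_scaleR_right t_def
    by simp_all
  have "u \<bullet> ?v + u \<bullet> pt (p @ j # k # i # q) + u \<bullet> pt (p @ k # i # j # q)
      = u \<bullet> pt (p @ j # i # k # q) + u \<bullet> pt (p @ k # j # i # q) + u \<bullet> pt (p @ i # k # j # q)"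
    unfolding pt_hexagon[where i = i and j = j and k = k] inner_add_right inner_scaleR_right by simp
  moreover have "h ?v + h (pt (p @ j # k # i # q)) + h (pt (p @ k # i # j # q))
      = h (pt (p @ j # i # k # q)) + h (pt (p @ k # j # i # q)) + h (pt (p @ i # k # j # q))"
    using assms fl unfolding local_conditions_def hexagon_additive_def by blast
  ultimately show "h ?v + u \<bullet> ?v + (h (pt (p @ j # k # i # q)) + u \<bullet> pt (p @ j # k # i # q))
      + (h (pt (p @ k # i # j # q)) + u \<bullet> pt (p @ k # i # j # q))
      = h (pt (p @ j # i # k # q)) + u \<bullet> pt (p @ j # i # k # q)
      + (h (pt (p @ k # j # i # q)) + u \<bullet> pt (p @ k # j # i # q))
      + (h (pt (p @ i # k # j # q)) + u \<bullet> pt (p @ i # k # j # q))"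
    by linarith
  have "max_attained_twice (h ?v + h (pt (p @ k # j # i # q)) + t)
      (h (pt (p @ j # i # k # q)) + h (pt (p @ k # i # j # q)) + t)
      (h (pt (p @ j # k # i # q)) + h (pt (p @ i # k # j # q)) + t)"
    using assms fl unfolding local_conditions_def hexagon_max_def max_attained_twice_add by blast
  moreover have "h ?v + u \<bullet> ?v + (h (pt (p @ k # j # i # q)) + u \<bullet> pt (p @ k # j # i # q))
      = h ?v + h (pt (p @ k # j # i # q)) + t"
    "h (pt (p @ j # i # k # q)) + u \<bullet> pt (p @ j # i # k # q)
      + (h (pt (p @ k # i # j # q)) + u \<bullet> pt (p @ k # i # j # q))
      = h (pt (p @ j # i # k # q)) + h (pt (p @ k # i # j # q)) + t"
    "h (pt (p @ j # k # i # q)) + u \<bullet> pt (p @ j # k # i # q)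
      + (h (pt (p @ i # k # j # q)) + u \<bullet> pt (p @ i # k # j # q))
      = h (pt (p @ j # k # i # q)) + h (pt (p @ i # k # j # q)) + t"
    using lin by linarith+
  ultimately show "max_attained_twice (h ?v + u \<bullet> ?v + (h (pt (p @ k # j # i # q)) + u \<bullet> pt (p @ k # j # i # q)))
      (h (pt (p @ j # i # k # q)) + u \<bullet> pt (p @ j # i # k # q)
      + (h (pt (p @ k # i # j # q)) + u \<bullet> pt (p @ k # i # j # q)))
      (h (pt (p @ j # k # i # q)) + u \<bullet> pt (p @ j # k # i # q)
      + (h (pt (p @ i # k # j # q)) + u \<bullet> pt (p @ i # k # j # q)))"
    by (simp only:)
qed

lemma permutahedral_imp_two_face:
  fixes h :: "real ^ 'n::{finite,linorder} \<Rightarrow> real"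
  assumes perm: "permutahedral (regular_subdivision permutahedron h)" and F: "two_face F permutahedron"
  shows "permutahedral (regular_subdivision F h)"
  unfolding permutahedral_def
proof
  fix C assume C: "C \<in> regular_subdivision F h"
  define V where "V = pt ` (flags :: 'n list set)"
  have "F face_of permutahedron" "F \<noteq> {}"
    using F by (auto simp: two_face_def)
  then obtain a where "{v. v extreme_point_of F} = minimizers ((\<bullet>) a) V"
    using face_of_permutahedron unfolding V_def by metis
  moreover have "finite (minimizers ((\<bullet>) a) V)" "minimizers ((\<bullet>) a) V \<noteq> {}"
    unfolding V_def using minimizers_nonempty[OF finite_vertices vertices_nonempty]
    by (auto simp: minimizers_def)
  ultimately obtain u where u: "C = convex hull (minimizers (\<lambda>v. h v + u \<bullet> v) (minimizers ((\<bullet>) a) V))"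
    using C regular_subdivision_iff by metis
  \<comment> \<open>The normal \<open>a\<close> of the face is minimized first, the tilted height
    second. Division by \<epsilon> turns this into the height plus a linear functional on all
    vertices.\<close>
  obtain \<epsilon> where \<epsilon>: "\<epsilon> > 0" "minimizers (\<lambda>v. a \<bullet> v + \<epsilon> * (h v + u \<bullet> v)) V
      = minimizers (\<lambda>v. h v + u \<bullet> v) (minimizers ((\<bullet>) a) V)"
    using minimizers_perturb[of V "(\<bullet>) a" "\<lambda>v. h v + u \<bullet> v"] unfolding V_def by auto
  have "minimizers (\<lambda>v. a \<bullet> v + \<epsilon> * (h v + u \<bullet> v)) V
      = minimizers (\<lambda>v. h v + (u + a /\<^sub>R \<epsilon>) \<bullet> v) V"
  proof (rule minimizers_cong)
    have "a \<bullet> v + \<epsilon> * (h v + u \<bullet> v) = \<epsilon> * (h v + (u + a /\<^sub>R \<epsilon>) \<bullet> v)" for v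
      using \<epsilon>(1) by (simp add: inner_add_left field_simps)
    then show "a \<bullet> x + \<epsilon> * (h x + u \<bullet> x) \<le> a \<bullet> y + \<epsilon> * (h y + u \<bullet> y) \<longleftrightarrow>
        h x + (u + a /\<^sub>R \<epsilon>) \<bullet> x \<le> h y + (u + a /\<^sub>R \<epsilon>) \<bullet> y" for x y
      using \<epsilon>(1) by simp
  qed
  then have "C = convex hull (minimizers (\<lambda>v. h v + (u + a /\<^sub>R \<epsilon>) \<bullet> v) V)"
    using u \<epsilon>(2) by simp
  then have "C \<in> regular_subdivision permutahedron h"
    using regular_subdivision_iff[OF extreme_points_permutahedron finite_vertices vertices_nonempty]
    unfolding V_def by blast
  then show "generalized_permutahedron C"
    using perm by (simp add: permutahedral_def)
qed

lemma permutahedral_of_local_conditions: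
  fixes h :: "real ^ 'n::{finite,linorder} \<Rightarrow> real"
  assumes "local_conditions h"
  shows "permutahedral (regular_subdivision permutahedron h)"
  unfolding permutahedral_def
proof
  fix C :: "(real ^ 'n::{finite,linorder}) set" assume C: "C \<in> regular_subdivision permutahedron h"
  define V where "V = pt ` (flags :: 'n list set)"
  have finV: "finite V"
    unfolding V_def by simp
  obtain u where u: "C = convex hull (minimizers (\<lambda>v. h v + u \<bullet> v) V)"
    using C regular_subdivision_iff[OF extreme_points_permutahedron finite_vertices vertices_nonempty]
    unfolding V_def by blast
  define M where "M = minimizers (\<lambda>v. h v + u \<bullet> v) V"
  have finM: "finite M"
    unfolding M_def minimizers_def using finV by simp
  show "generalized_permutahedron C"
    unfolding generalized_permutahedron_def
  proof (intro conjI allI impI)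
    show "polytope C"
      unfolding polytope_def u M_def[symmetric] using finM by blast
    fix E assume "E edge_of C"
    then have E: "E face_of convex hull M" "aff_dim E = 1"
      by (auto simp: edge_of_def u M_def)
    moreover from E have "E \<noteq> {}"
      by auto
    ultimately obtain a where a: "E = convex hull (minimizers ((\<bullet>) a) M)"
      using face_of_convex_hull_imp_minimizers[OF finM] by metis
    define N where "N = minimizers ((\<bullet>) a) M"
    \<comment> \<open>A face of a cell is again a cell: the vertices of the edge minimize the height
      plus one linear functional over all of \<open>V\<close>.\<close>
    obtain \<epsilon> where "\<epsilon> > 0" and \<epsilon>: "minimizers (\<lambda>v. h v + u \<bullet> v + \<epsilon> * (a \<bullet> v)) V = N"
      using minimizers_perturb[OF finV, of "\<lambda>v. h v + u \<bullet> v" "(\<bullet>) a"] unfolding N_def M_def by blast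
    define f where "f v = h v + (u + \<epsilon> *\<^sub>R a) \<bullet> v" for v
    have N: "minimizers f V = N"
      unfolding \<epsilon>[symmetric] f_def by (simp add: inner_add_left add.assoc)
    have dimN: "aff_dim N = 1"
      using E(2) unfolding a N_def by (simp add: aff_dim_convex_hull)
    then obtain x where x: "x \<in> N"
      by fastforce
    have "N \<noteq> {x}"
      using dimN by auto
    then obtain y where y: "y \<in> N" "y \<noteq> x"
      using x by blast
    have NV: "N \<subseteq> V"
      unfolding N[symmetric] by (auto simp: minimizers_def)
    obtain xs where xs: "xs \<in> flags" "x = pt xs"
      using x NV unfolding V_def by blast
    obtain ys where ys: "ys \<in> flags" "y = pt ys"
      using y NV unfolding V_def by blast
    \<comment> \<open>A single transpose of \<open>x\<close> on the edge suffices, because the edge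
      is one-dimensional and its direction is then a root.\<close>
    have "\<exists>i j. i < j \<and> j < length xs \<and> pt (swap_nth i j xs) \<in> N"
    proof (rule ccontr)
      assume no: "\<not> ?thesis"
      have strict: "f x < f (pt (swap_nth i j xs))" if "i < j" "j < length xs" for i j
      proof -
        have "pt (swap_nth i j xs) \<in> V" "pt (swap_nth i j xs) \<notin> N"
          using that no swap_nth_permutations[OF xs(1), of i j] unfolding V_def by auto
        then show ?thesis
          using x unfolding N[symmetric] minimizers_def by force
      qed
      \<comment> \<open>The size of the tilt is adjusted to \<open>x\<close> and its transposes
        only. Among them \<open>x\<close> is the strict minimum of \<open>f\<close> and remains
        minimal, whereas at \<open>y\<close>, where \<open>f\<close> has the same value as at
        \<open>x\<close>, the functional \<open>x - y\<close> is smaller.\<close>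
      define X where "X = insert x ((\<lambda>(i, j). pt (swap_nth i j xs)) ` {(i, j). i < j \<and> j < length xs})"
      have "{(i, j). i < j \<and> j < length xs} \<subseteq> {..<length xs} \<times> {..<length xs}"
        by auto
      then have "finite X"
        unfolding X_def by (simp add: finite_subset)
      moreover have "minimizers f X = {x}"
        unfolding minimizers_def X_def using strict by (fastforce simp: less_imp_le)
      moreover have "minimizers ((\<bullet>) (x - y)) {x} = {x}"
        by (auto simp: minimizers_def)
      ultimately obtain \<delta> where \<delta>: "\<delta> > 0" "minimizers (\<lambda>v. f v + \<delta> * ((x - y) \<bullet> v)) X = {x}"
        using minimizers_perturb[of X f "(\<bullet>) (x - y)"] by metis
      define k where "k v = h v + (u + \<epsilon> *\<^sub>R a + \<delta> *\<^sub>R (x - y)) \<bullet> v" for v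
      have k: "k v = f v + \<delta> * ((x - y) \<bullet> v)" for v
        unfolding k_def f_def by (simp add: inner_add_left)
      have "local_conditions k"
        unfolding k_def by (rule local_conditions_add_linear[OF assms])
      then have "k (pt xs) \<le> k (pt ys)"
        unfolding local_conditions_def
      proof (elim conjE, intro local_minimum_is_global[where g = "\<lambda>xs. k (pt xs)", OF _ _ _ _ xs(1) _ ys(1)])
        fix i j assume ij: "i < j" "j < length xs"
        have "x \<in> minimizers k X"
          using \<delta>(2) unfolding k by simp
        moreover have "pt (swap_nth i j xs) \<in> X"
          unfolding X_def using ij by auto
        ultimately show "k (pt xs) \<le> k (pt (swap_nth i j xs))"
          unfolding minimizers_def xs(2) by blast
      qed auto
      moreover have "f y = f x"
        using x y unfolding N[symmetric] minimizers_def by (auto intro: antisym)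
      moreover have "(x - y) \<bullet> y < (x - y) \<bullet> x"
      proof -
        have "0 < (x - y) \<bullet> (x - y)"
          using y(2) by simp
        then show ?thesis
          by (simp add: inner_diff_right)
      qed
      ultimately show False
        using \<delta>(1) unfolding k xs(2)[symmetric] ys(2)[symmetric] by simp
    qed
    then obtain i j where ij: "i < j" "j < length xs" "pt (swap_nth i j xs) \<in> N"
      by blast
    have diff: "pt (swap_nth i j xs) - x = real (j - i) *\<^sub>R axis_diff (xs ! i) (xs ! j)"
      unfolding xs(2) pt_swap_nth[OF ij(1,2)] by simp
    have neq: "xs ! i \<noteq> xs ! j"
      using xs(1) ij by (simp add: permutations_of_set_def nth_eq_iff_index_eq)
    then have "axis_diff (xs ! i) (xs ! j) \<noteq> (0 :: real ^ 'n::{finite,linorder})"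
      by (simp add: axis_eq_axis)
    then have "pt (swap_nth i j xs) \<noteq> x"
      using diff ij(1) by auto
    moreover have "x \<in> E" "pt (swap_nth i j xs) \<in> E"
      unfolding a N_def[symmetric] using x ij(3) by (simp_all add: hull_inc)
    ultimately have "\<exists>c. z - z' = c *\<^sub>R axis_diff (xs ! i) (xs ! j)" if "z \<in> E" "z' \<in> E" for z z'
      using aff_dim_1_collinear[OF E(2), of "pt (swap_nth i j xs)" x z z'] that diff by (metis scaleR_scaleR)
    with neq show "\<exists>i j. i \<noteq> j \<and> (\<forall>x\<in>E. \<forall>y\<in>E. \<exists>c. x - y = c *\<^sub>R axis_diff i j)"
      by blast
  qed
qed

subsection \<open>Cyclic labellings\<close>

lemma segment_edge_of:
  fixes V :: "'a::euclidean_space set"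
  assumes "finite V" "minimizers ((\<bullet>) u) V = {x, y}" "x \<noteq> y"
  shows "closed_segment x y edge_of convex hull V"
  unfolding edge_of_def
proof
  show "closed_segment x y face_of convex hull V"
    using face_of_minimizers[OF assms(1), of u] assms(2) by (simp add: segment_convex_hull)
  show "aff_dim (closed_segment x y) = 1"
    using assms(3) by (simp add: segment_convex_hull aff_dim_convex_hull)
qed

lemma hexagon_points_distinct:
  assumes "p @ i # j # k # q \<in> flags"
  shows "distinct [pt (p @ i # j # k # q), pt (p @ j # i # k # q), pt (p @ j # k # i # q),
    pt (p @ k # j # i # q), pt (p @ k # i # j # q), pt (p @ i # k # j # q)]"
proof -
  have "distinct [i, j, k]"
    using assms by (auto simp: permutations_of_set_def)
  then show ?thesis
    using assms flags_rename[OF assms] by (auto simp: inj_on_eq_iff[OF inj_on_pt])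
qed

text \<open>Two consecutive edges suffice: cyclic renaming of \<open>i\<close>, \<open>j\<close>,
  \<open>k\<close> gives the other four.\<close>

lemma hexagon_edges:
  fixes p q :: "'n::finite list"
  assumes fl: "p @ i # j # k # q \<in> flags"
  defines "F \<equiv> convex hull (pt ` hexagon_flags p i j k q)"
  shows "closed_segment (pt (p @ i # j # k # q)) (pt (p @ j # i # k # q)) edge_of F"
    "closed_segment (pt (p @ j # i # k # q)) (pt (p @ j # k # i # q)) edge_of F"
proof -
  have ijk: "distinct [i, j, k]"
    using fl by (auto simp: permutations_of_set_def)
  define c where "c u = u \<bullet> pt (p @ i # j # k # q)" for u
  have val: "u \<bullet> pt (p @ i # j # k # q) = c u" "u \<bullet> pt (p @ j # i # k # q) = c u + \<alpha>"
    "u \<bullet> pt (p @ j # k # i # q) = c u + 2 * \<alpha> + \<beta>" "u \<bullet> pt (p @ k # j # i # q) = c u + 2 * \<alpha> + 2 * \<beta>"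
    "u \<bullet> pt (p @ k # i # j # q) = c u + \<alpha> + 2 * \<beta>" "u \<bullet> pt (p @ i # k # j # q) = c u + \<beta>"
    if "u = \<alpha> *\<^sub>R axis i 1 - \<beta> *\<^sub>R axis k 1" for u \<alpha> \<beta>
  proof -
    have u: "u \<bullet> axis_diff i j = \<alpha>" "u \<bullet> axis_diff j k = \<beta>"
      using ijk unfolding that by (auto simp: inner_diff_left inner_diff_right inner_axis_axis)
    show "u \<bullet> pt (p @ i # j # k # q) = c u" "u \<bullet> pt (p @ j # i # k # q) = c u + \<alpha>"
      "u \<bullet> pt (p @ j # k # i # q) = c u + 2 * \<alpha> + \<beta>" "u \<bullet> pt (p @ k # j # i # q) = c u + 2 * \<alpha> + 2 * \<beta>"
      "u \<bullet> pt (p @ k # i # j # q) = c u + \<alpha> + 2 * \<beta>" "u \<bullet> pt (p @ i # k # j # q) = c u + \<beta>"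
      unfolding c_def pt_hexagon[where i = i and j = j and k = k] inner_add_right inner_scaleR_right u
      by simp_all
  qed
  note dist = hexagon_points_distinct[OF fl]
  show "closed_segment (pt (p @ i # j # k # q)) (pt (p @ j # i # k # q)) edge_of F"
    unfolding F_def
  proof (rule segment_edge_of)
    \<comment> \<open>This is \<open>val\<close> with \<alpha> = 0 and \<beta> = 1: the functional
      is constant on the edge and larger at the other four vertices. The second edge takes \<alpha>
      = -1 and \<beta> = 1.\<close>
    show "minimizers ((\<bullet>) (0 *\<^sub>R axis i 1 - 1 *\<^sub>R axis k 1)) (pt ` hexagon_flags p i j k q)
        = {pt (p @ i # j # k # q), pt (p @ j # i # k # q)}"
      unfolding minimizers_def by (auto simp: val[OF refl] simp del: scaleR_zero_left scaleR_one)
  qed (use dist in auto)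
  show "closed_segment (pt (p @ j # i # k # q)) (pt (p @ j # k # i # q)) edge_of F"
    unfolding F_def
  proof (rule segment_edge_of)
    show "minimizers ((\<bullet>) (- 1 *\<^sub>R axis i 1 - 1 *\<^sub>R axis k 1)) (pt ` hexagon_flags p i j k q)
        = {pt (p @ j # i # k # q), pt (p @ j # k # i # q)}"
      unfolding minimizers_def
      by (auto simp: val[OF refl] simp del: scaleR_one scaleR_minus1_left scaleR_minus_left)
  qed (use dist in auto)
qed

text \<open>Both diagonals from the first vertex are crossed by the chord from the second vertex to
  the fifth: the short one at its midpoint, a quarter of the way along the chord, and the long one
  at the centre of the hexagon.\<close>

lemma hexagon_not_edges:
  fixes F :: "(real ^ 'n::finite) set"
  assumes fl: "p @ i # j # k # q \<in> flags"
    and V: "{v. v extreme_point_of F} = pt ` hexagon_flags p i j k q"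
  shows "\<not> closed_segment (pt (p @ i # j # k # q)) (pt (p @ j # k # i # q)) edge_of F"
    "\<not> closed_segment (pt (p @ i # j # k # q)) (pt (p @ k # j # i # q)) edge_of F"
proof -
  note dist = hexagon_points_distinct[OF fl]
  have ext: "pt xs extreme_point_of F" if "xs \<in> hexagon_flags p i j k q" for xs
    using V that by blast
  then have mem: "pt xs \<in> F" if "xs \<in> hexagon_flags p i j k q" for xs
    using that unfolding extreme_point_of_def by blast
  show "\<not> closed_segment (pt (p @ i # j # k # q)) (pt (p @ j # k # i # q)) edge_of F"
  proof
    assume "closed_segment (pt (p @ i # j # k # q)) (pt (p @ j # k # i # q)) edge_of F"
    then have face: "closed_segment (pt (p @ i # j # k # q)) (pt (p @ j # k # i # q)) face_of F"
      by (simp add: edge_of_def)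
    have eq: "(1 - 1 / 4) *\<^sub>R pt (p @ j # i # k # q) + (1 / 4) *\<^sub>R pt (p @ k # i # j # q)
        = (1 - 1 / 2) *\<^sub>R pt (p @ i # j # k # q) + (1 / 2) *\<^sub>R pt (p @ j # k # i # q)"
      unfolding pt_hexagon[where i = i and j = j and k = k] by (simp add: vec_eq_iff field_simps)
    show False
    proof (rule not_face_of_crossing[OF face _ _ _ _ _ _ _ _ _ eq])
      show "pt (p @ j # i # k # q) extreme_point_of F"
        by (rule ext) simp
      show "pt (p @ k # i # j # q) \<in> F"
        by (rule mem) simp
    qed (use dist in auto)
  qed
  show "\<not> closed_segment (pt (p @ i # j # k # q)) (pt (p @ k # j # i # q)) edge_of F"
  proof
    assume "closed_segment (pt (p @ i # j # k # q)) (pt (p @ k # j # i # q)) edge_of F"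
    then have face: "closed_segment (pt (p @ i # j # k # q)) (pt (p @ k # j # i # q)) face_of F"
      by (simp add: edge_of_def)
    have eq: "(1 - 1 / 2) *\<^sub>R pt (p @ j # i # k # q) + (1 / 2) *\<^sub>R pt (p @ k # i # j # q)
        = (1 - 1 / 2) *\<^sub>R pt (p @ i # j # k # q) + (1 / 2) *\<^sub>R pt (p @ k # j # i # q)"
      unfolding pt_hexagon[where i = i and j = j and k = k] by (simp add: vec_eq_iff field_simps)
    show False
    proof (rule not_face_of_crossing[OF face _ _ _ _ _ _ _ _ _ eq])
      show "pt (p @ j # i # k # q) extreme_point_of F"
        by (rule ext) simp
      show "pt (p @ k # i # j # q) \<in> F"
        by (rule mem) simp
    qed (use dist in auto)
  qed
qed

lemma square_points_distinct:
  assumes "p @ a # b # q @ c # d # r \<in> flags"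
  shows "distinct [pt (p @ a # b # q @ c # d # r), pt (p @ b # a # q @ c # d # r),
    pt (p @ b # a # q @ d # c # r), pt (p @ a # b # q @ d # c # r)]"
proof -
  have "p @ b # a # q @ c # d # r \<in> flags" "p @ b # a # q @ d # c # r \<in> flags"
    "p @ a # b # q @ d # c # r \<in> flags" "distinct [a, b, c, d]"
    using assms by (auto simp: permutations_of_set_def insert_commute)
  then show ?thesis
    using assms by (auto simp: inj_on_eq_iff[OF inj_on_pt])
qed

lemma square_edges:
  fixes p q r :: "'n::finite list"
  assumes fl: "p @ a # b # q @ c # d # r \<in> flags"
  defines "F \<equiv> convex hull (pt ` square_flags p a b q c d r)"
  shows "closed_segment (pt (p @ a # b # q @ c # d # r)) (pt (p @ b # a # q @ c # d # r)) edge_of F"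
    "closed_segment (pt (p @ b # a # q @ c # d # r)) (pt (p @ b # a # q @ d # c # r)) edge_of F"
    "closed_segment (pt (p @ b # a # q @ d # c # r)) (pt (p @ a # b # q @ d # c # r)) edge_of F"
    "closed_segment (pt (p @ a # b # q @ d # c # r)) (pt (p @ a # b # q @ c # d # r)) edge_of F"
proof -
  have dist4: "distinct [a, b, c, d]"
    using fl by (auto simp: permutations_of_set_def)
  define t where "t u = u \<bullet> pt (p @ a # b # q @ c # d # r)" for u
  have val: "u \<bullet> pt (p @ a # b # q @ c # d # r) = t u" "u \<bullet> pt (p @ b # a # q @ c # d # r) = t u + \<alpha>"
    "u \<bullet> pt (p @ b # a # q @ d # c # r) = t u + \<alpha> + \<beta>" "u \<bullet> pt (p @ a # b # q @ d # c # r) = t u + \<beta>"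
    if "u = \<alpha> *\<^sub>R axis a 1 + \<beta> *\<^sub>R axis c 1" for u \<alpha> \<beta>
  proof -
    have u: "u \<bullet> axis_diff a b = \<alpha>" "u \<bullet> axis_diff c d = \<beta>"
      using dist4 unfolding that by (auto simp: inner_add_left inner_diff_right inner_axis_axis)
    show "u \<bullet> pt (p @ a # b # q @ c # d # r) = t u" "u \<bullet> pt (p @ b # a # q @ c # d # r) = t u + \<alpha>"
      "u \<bullet> pt (p @ b # a # q @ d # c # r) = t u + \<alpha> + \<beta>" "u \<bullet> pt (p @ a # b # q @ d # c # r) = t u + \<beta>"
      unfolding t_def pt_square[where a = a and b = b and c = c and d = d] inner_add_right u
      by simp_all
  qed
  have edge: "closed_segment x y edge_of F"
    if "minimizers ((\<bullet>) (\<alpha> *\<^sub>R axis a 1 + \<beta> *\<^sub>R axis c 1)) (pt ` square_flags p a b q c d r) = {x, y}"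
      "x \<noteq> y" for x y \<alpha> \<beta>
    unfolding F_def using that by (intro segment_edge_of) auto
  note dist = square_points_distinct[OF fl]
  show "closed_segment (pt (p @ a # b # q @ c # d # r)) (pt (p @ b # a # q @ c # d # r)) edge_of F"
    using dist by (intro edge[where \<alpha> = 0 and \<beta> = 1])
      (auto simp: minimizers_def val[OF refl] simp del: scaleR_zero_left scaleR_one)
  show "closed_segment (pt (p @ b # a # q @ c # d # r)) (pt (p @ b # a # q @ d # c # r)) edge_of F"
    using dist by (intro edge[where \<alpha> = "- 1" and \<beta> = 0])
      (auto simp: minimizers_def val[OF refl] simp del: scaleR_zero_left scaleR_minus1_left scaleR_minus_left)
  show "closed_segment (pt (p @ b # a # q @ d # c # r)) (pt (p @ a # b # q @ d # c # r)) edge_of F"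
    using dist by (intro edge[where \<alpha> = 0 and \<beta> = "- 1"])
      (auto simp: minimizers_def val[OF refl] simp del: scaleR_zero_left scaleR_minus1_left scaleR_minus_left)
  show "closed_segment (pt (p @ a # b # q @ d # c # r)) (pt (p @ a # b # q @ c # d # r)) edge_of F"
    using dist by (intro edge[where \<alpha> = 1 and \<beta> = 0])
      (auto simp: minimizers_def val[OF refl] simp del: scaleR_zero_left scaleR_one)
qed

lemma square_not_edge:
  fixes F :: "(real ^ 'n::finite) set"
  assumes fl: "p @ a # b # q @ c # d # r \<in> flags"
    and V: "{v. v extreme_point_of F} = pt ` square_flags p a b q c d r"
  shows "\<not> closed_segment (pt (p @ a # b # q @ c # d # r)) (pt (p @ b # a # q @ d # c # r)) edge_of F"
proof
  note dist = square_points_distinct[OF fl]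
  have ext: "pt xs extreme_point_of F" if "xs \<in> square_flags p a b q c d r" for xs
    using V that by blast
  then have mem: "pt xs \<in> F" if "xs \<in> square_flags p a b q c d r" for xs
    using that unfolding extreme_point_of_def by blast
  assume "closed_segment (pt (p @ a # b # q @ c # d # r)) (pt (p @ b # a # q @ d # c # r)) edge_of F"
  then have face: "closed_segment (pt (p @ a # b # q @ c # d # r)) (pt (p @ b # a # q @ d # c # r)) face_of F"
    by (simp add: edge_of_def)
  have eq: "(1 - 1 / 2) *\<^sub>R pt (p @ b # a # q @ c # d # r) + (1 / 2) *\<^sub>R pt (p @ a # b # q @ d # c # r)
      = (1 - 1 / 2) *\<^sub>R pt (p @ a # b # q @ c # d # r) + (1 / 2) *\<^sub>R pt (p @ b # a # q @ d # c # r)"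
    unfolding pt_square[where a = a and b = b and c = c and d = d] by (simp add: vec_eq_iff field_simps)
  show False
  proof (rule not_face_of_crossing[OF face _ _ _ _ _ _ _ _ _ eq])
    show "pt (p @ b # a # q @ c # d # r) extreme_point_of F"
      by (rule ext) simp
    show "pt (p @ a # b # q @ d # c # r) \<in> F"
      by (rule mem) simp
  qed (use dist in auto)
qed

text \<open>The first step chooses one of the two orientations of the cycle. Every later step keeps
  it, because turning back would repeat a vertex. Six starting points and two orientations give the
  twelve lists.\<close>

lemma six_cycle:
  assumes dist: "distinct [x0, x1, x2, x3, x4, x5]"
    and adj: "\<forall>x y. e x y \<longrightarrow> x = x0 \<and> (y = x1 \<or> y = x5) \<or> x = x1 \<and> (y = x0 \<or> y = x2) \<or>
      x = x2 \<and> (y = x1 \<or> y = x3) \<or> x = x3 \<and> (y = x2 \<or> y = x4) \<or>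
      x = x4 \<and> (y = x3 \<or> y = x5) \<or> x = x5 \<and> (y = x4 \<or> y = x0)"
    and cyc: "e a b" "e b c" "e c d" "e d f" "e f g" "distinct [a, b, c, d, f, g]"
  shows "[a, b, c, d, f, g] \<in> {[x0, x1, x2, x3, x4, x5], [x1, x2, x3, x4, x5, x0],
    [x2, x3, x4, x5, x0, x1], [x3, x4, x5, x0, x1, x2], [x4, x5, x0, x1, x2, x3],
    [x5, x0, x1, x2, x3, x4], [x5, x4, x3, x2, x1, x0], [x4, x3, x2, x1, x0, x5],
    [x3, x2, x1, x0, x5, x4], [x2, x1, x0, x5, x4, x3], [x1, x0, x5, x4, x3, x2],
    [x0, x5, x4, x3, x2, x1]}"
proof -
  define N where "N = {(x0, x1), (x1, x2), (x2, x3), (x3, x4), (x4, x5), (x5, x0)}"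
  have N: "(x0, y) \<in> N \<longleftrightarrow> y = x1" "(x1, y) \<in> N \<longleftrightarrow> y = x2" "(x2, y) \<in> N \<longleftrightarrow> y = x3"
    "(x3, y) \<in> N \<longleftrightarrow> y = x4" "(x4, y) \<in> N \<longleftrightarrow> y = x5" "(x5, y) \<in> N \<longleftrightarrow> y = x0"
    "(y, x1) \<in> N \<longleftrightarrow> y = x0" "(y, x2) \<in> N \<longleftrightarrow> y = x1" "(y, x3) \<in> N \<longleftrightarrow> y = x2"
    "(y, x4) \<in> N \<longleftrightarrow> y = x3" "(y, x5) \<in> N \<longleftrightarrow> y = x4" "(y, x0) \<in> N \<longleftrightarrow> y = x5" for y
    using dist unfolding N_def by auto
  have cases: "x = x0 \<and> y = x1 \<or> x = x1 \<and> y = x2 \<or> x = x2 \<and> y = x3 \<or> x = x3 \<and> y = x4 \<or>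
      x = x4 \<and> y = x5 \<or> x = x5 \<and> y = x0" if "(x, y) \<in> N" for x y
    using that unfolding N_def by blast
  have step: "(x, y) \<in> N \<or> (y, x) \<in> N" if "e x y" for x y
    using adj[rule_format, OF that] unfolding N_def by (elim disjE conjE) simp_all
  have fwd: "z = x" if "(x, y) \<in> N" "(z, y) \<in> N" for x y z
    using cases[OF that(1)] that(2) by (elim disjE conjE) (simp_all add: N)
  have bwd: "z = y" if "(x, y) \<in> N" "(x, z) \<in> N" for x y z
    using cases[OF that(1)] that(2) by (elim disjE conjE) (simp_all add: N)
  have succ: "(y, z) \<in> N" if "(x, y) \<in> N" "e y z" "z \<noteq> x" for x y z
    using step[OF that(2)] fwd[OF that(1)] that(3) by blast
  have prev: "(z, y) \<in> N" if "(y, x) \<in> N" "e y z" "z \<noteq> x" for x y z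
    using step[OF that(2)] bwd[OF that(1)] that(3) by blast
  have neq: "c \<noteq> a" "d \<noteq> b" "f \<noteq> c" "g \<noteq> d"
    using cyc(6) by auto
  from step[OF cyc(1)] show ?thesis
  proof
    assume ab: "(a, b) \<in> N"
    note bc = succ[OF ab cyc(2) neq(1)]
    note cd = succ[OF bc cyc(3) neq(2)]
    note df = succ[OF cd cyc(4) neq(3)]
    note fg = succ[OF df cyc(5) neq(4)]
    from cases[OF ab] show ?thesis
      by (elim disjE conjE; use bc cd df fg in \<open>simp add: N\<close>)
  next
    assume ab: "(b, a) \<in> N"
    note bc = prev[OF ab cyc(2) neq(1)]
    note cd = prev[OF bc cyc(3) neq(2)]
    note df = prev[OF cd cyc(4) neq(3)]
    note fg = prev[OF df cyc(5) neq(4)]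
    from cases[OF ab] show ?thesis
      by (elim disjE conjE; use bc cd df fg in \<open>simp add: N\<close>)
  qed
qed

lemma max_attained_twice_rotate:
  "max_attained_twice x y z \<Longrightarrow> max_attained_twice y z x"
  "max_attained_twice x y z \<Longrightarrow> max_attained_twice x z y"
  unfolding max_attained_twice_def Let_def max_def by (auto split: if_splits)

text \<open>As no diagonal is an edge, a labelling runs around the hexagon of flags. The conditions
  are invariant under the dihedral group: a rotation by one step exchanges the two sides of the
  equation and permutes the terms of the maximum.\<close>

lemma hexagon_labelling:
  fixes F :: "(real ^ 'n::{finite,linorder}) set"
  assumes loc: "local_conditions h" and fl: "p @ i # j # k # q \<in> flags"
    and V: "{v. v extreme_point_of F} = pt ` hexagon_flags p i j k q"
    and verts: "{a, b, c, d, f, g} = {v. v extreme_point_of F}" "distinct [a, b, c, d, f, g]"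
    and edges: "closed_segment a b edge_of F" "closed_segment b c edge_of F" "closed_segment c d edge_of F"
      "closed_segment d f edge_of F" "closed_segment f g edge_of F"
  shows "h a + h c + h f = h b + h d + h g \<and> max_attained_twice (h a + h d) (h b + h f) (h c + h g)"
proof -
  define P where "P xs = pt (p @ xs @ q)" for xs
  define e where "e x y \<longleftrightarrow> closed_segment x y edge_of F \<and> x \<noteq> y \<and>
    x \<in> {v. v extreme_point_of F} \<and> y \<in> {v. v extreme_point_of F}" for x y
  have e_sym: "e x y \<longleftrightarrow> e y x" for x y
    unfolding e_def by (auto simp: closed_segment_commute)
  note ren = hexagon_flags_rename[where p = p and i = i and j = j and k = k and q = q]
  note fls = flags_rename[OF fl]
  \<comment> \<open>The six short and the three long diagonals, each in one direction;
    \<open>e_sym\<close> supplies the other.\<close>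
  have n: "\<not> e (P [i, j, k]) (P [j, k, i])" "\<not> e (P [i, j, k]) (P [k, j, i])"
    "\<not> e (P [j, k, i]) (P [k, i, j])" "\<not> e (P [j, k, i]) (P [i, k, j])"
    "\<not> e (P [k, i, j]) (P [i, j, k])" "\<not> e (P [k, i, j]) (P [j, i, k])"
    "\<not> e (P [j, i, k]) (P [i, k, j])" "\<not> e (P [i, k, j]) (P [k, j, i])"
    "\<not> e (P [k, j, i]) (P [j, i, k])"
    unfolding e_def P_def
    using hexagon_not_edges[OF fl V] hexagon_not_edges[OF fls(1), unfolded ren, OF V]
      hexagon_not_edges[OF fls(2), unfolded ren, OF V] hexagon_not_edges[OF fls(3), unfolded ren, OF V]
      hexagon_not_edges[OF fls(4), unfolded ren, OF V] hexagon_not_edges[OF fls(5), unfolded ren, OF V]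
    by simp_all
  define x0 x1 x2 x3 x4 x5 where x: "x0 = P [i, j, k]" "x1 = P [j, i, k]" "x2 = P [j, k, i]"
    "x3 = P [k, j, i]" "x4 = P [k, i, j]" "x5 = P [i, k, j]"
  note n' = n[folded x]
  have X: "{v. v extreme_point_of F} = {x0, x1, x2, x3, x4, x5}"
    unfolding V x P_def by simp
  have dist: "distinct [x0, x1, x2, x3, x4, x5]"
    using hexagon_points_distinct[OF fl] unfolding x P_def by simp
  have adj: "\<forall>x y. e x y \<longrightarrow> x = x0 \<and> (y = x1 \<or> y = x5) \<or> x = x1 \<and> (y = x0 \<or> y = x2) \<or>
      x = x2 \<and> (y = x1 \<or> y = x3) \<or> x = x3 \<and> (y = x2 \<or> y = x4) \<or>
      x = x4 \<and> (y = x3 \<or> y = x5) \<or> x = x5 \<and> (y = x4 \<or> y = x0)"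
  proof (intro allI impI)
    fix x y assume "e x y"
    then have "x \<in> {x0, x1, x2, x3, x4, x5}" "y \<in> {x0, x1, x2, x3, x4, x5}" "x \<noteq> y"
      using X unfolding e_def by auto
    moreover have "e y x"
      using \<open>e x y\<close> e_sym by blast
    ultimately show "x = x0 \<and> (y = x1 \<or> y = x5) \<or> x = x1 \<and> (y = x0 \<or> y = x2) \<or>
      x = x2 \<and> (y = x1 \<or> y = x3) \<or> x = x3 \<and> (y = x2 \<or> y = x4) \<or>
      x = x4 \<and> (y = x3 \<or> y = x5) \<or> x = x5 \<and> (y = x4 \<or> y = x0)"
      using \<open>e x y\<close> n' by blast
  qed
  have "e a b" "e b c" "e c d" "e d f" "e f g"
    using edges verts unfolding e_def by auto
  note cyc = six_cycle[where e = e, OF dist adj this verts(2)]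
  have he: "h x0 + h x2 + h x4 = h x1 + h x3 + h x5"
    and hm: "max_attained_twice (h x0 + h x3) (h x1 + h x4) (h x2 + h x5)"
    using loc fl unfolding local_conditions_def hexagon_additive_def hexagon_max_def x P_def append.simps
    by blast+
  note hms = hm max_attained_twice_rotate(1)[OF hm] max_attained_twice_rotate(1)[OF max_attained_twice_rotate(1)[OF hm]]
  note hms' = hms hms[THEN max_attained_twice_rotate(2)]
  show ?thesis
  proof
    show "h a + h c + h f = h b + h d + h g"
      using cyc by (elim insertE emptyE; use he in auto)
    show "max_attained_twice (h a + h d) (h b + h f) (h c + h g)"
      using cyc by (elim insertE emptyE; use hms' in \<open>simp add: add.commute\<close>)
  qed
qed

lemma square_labelling:
  fixes F :: "(real ^ 'n::{finite,linorder}) set"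
  assumes loc: "local_conditions h" and fl: "p @ i # j # q @ k # l # r \<in> flags"
    and V: "{v. v extreme_point_of F} = pt ` square_flags p i j q k l r"
    and verts: "{a, b, c, d} = {v. v extreme_point_of F}" "distinct [a, b, c, d]"
    and edges: "closed_segment a b edge_of F" "closed_segment b c edge_of F" "closed_segment c d edge_of F"
      "closed_segment d a edge_of F"
  shows "h a + h c = h b + h d"
proof -
  have fl': "p @ j # i # q @ k # l # r \<in> flags"
    using fl by (auto simp: permutations_of_set_def insert_commute)
  define x0 x1 x2 x3 where x: "x0 = pt (p @ i # j # q @ k # l # r)" "x1 = pt (p @ j # i # q @ k # l # r)"
    "x2 = pt (p @ j # i # q @ l # k # r)" "x3 = pt (p @ i # j # q @ l # k # r)"
  have X: "{v. v extreme_point_of F} = {x0, x1, x2, x3}"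
    unfolding V x by simp
  have n: "\<not> closed_segment x0 x2 edge_of F" "\<not> closed_segment x1 x3 edge_of F"
    "\<not> closed_segment x2 x0 edge_of F" "\<not> closed_segment x3 x1 edge_of F"
    using square_not_edge[OF fl V] square_not_edge[OF fl', unfolded square_flags_rename[of p j i q k l r], OF V]
    unfolding x by (simp_all add: closed_segment_commute)
  have eq: "h x0 + h x2 = h x1 + h x3"
    using loc fl unfolding local_conditions_def square_additive_def x by blast
  have "a \<in> {x0, x1, x2, x3}" "b \<in> {x0, x1, x2, x3}" "c \<in> {x0, x1, x2, x3}" "d \<in> {x0, x1, x2, x3}"
    using verts X by auto
  then show ?thesis
    using edges n eq verts(2) by auto
qed

section \<open>Passing between labellings by permutations and flags\<close>

lemma cyclic_labellingD:
  fixes F :: "(real ^ 'n::{finite,linorder}) set"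
  assumes "cyclic_labelling F xs"
  shows "distinct (map perm_point xs :: (real ^ 'n::{finite,linorder}) list)" "set xs \<subseteq> Sym CARD('n)"
    "perm_point ` set xs = {v. v extreme_point_of F}"
    "Suc i < length xs \<Longrightarrow> closed_segment (perm_point (xs ! i)) (perm_point (xs ! Suc i)) edge_of F"
    "xs \<noteq> [] \<Longrightarrow> closed_segment (perm_point (last xs)) (perm_point (hd xs)) edge_of F"
proof -
  have c: "distinct xs" "set xs \<subseteq> Sym CARD('n)" "perm_point ` set xs = {v. v extreme_point_of F}"
    "\<And>i. i < length xs \<Longrightarrow>
      closed_segment (perm_point (xs ! i)) (perm_point (xs ! (Suc i mod length xs))) edge_of F"
    using assms unfolding cyclic_labelling_def by auto
  show "distinct (map perm_point xs :: (real ^ 'n::{finite,linorder}) list)"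
    using c(1) inj_on_subset[OF inj_on_perm_point c(2)] by (simp add: distinct_map)
  show "set xs \<subseteq> Sym CARD('n)" "perm_point ` set xs = {v. v extreme_point_of F}"
    using c by auto
  show "Suc i < length xs \<Longrightarrow> closed_segment (perm_point (xs ! i)) (perm_point (xs ! Suc i)) edge_of F"
    using c(4)[of i] by simp
  show "xs \<noteq> [] \<Longrightarrow> closed_segment (perm_point (last xs)) (perm_point (hd xs)) edge_of F"
    using c(4)[of "length xs - 1"] by (simp add: last_conv_nth hd_conv_nth)
qed

text \<open>The permutation belonging to a flag, written exactly as it occurs inside
  \<open>vertex_height\<close>.\<close>

definition flag_perm :: "'n::{finite,linorder} list \<Rightarrow> nat \<Rightarrow> nat" where
  "flag_perm xs = inv_into (Sym CARD('n)) (perm_point :: _ \<Rightarrow> real ^ 'n::{finite,linorder}) (pt xs)"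

lemma flag_perm:
  fixes xs :: "'n::{finite,linorder} list"
  assumes "xs \<in> flags"
  shows "flag_perm xs \<in> Sym CARD('n)" "perm_point (flag_perm xs) = pt xs"
proof -
  have "pt xs \<in> perm_point ` Sym CARD('n)"
    using assms pt_image by blast
  then show "flag_perm xs \<in> Sym CARD('n)" "perm_point (flag_perm xs) = pt xs"
    unfolding flag_perm_def by (rule inv_into_into, rule f_inv_into_f)
qed

lemma vertex_height_pt: "vertex_height w (pt xs) = w (flag_perm xs)"
  by (simp add: vertex_height_def flag_perm_def)

lemma cyclic_labelling_flags:
  fixes F :: "(real ^ 'n::{finite,linorder}) set"
  assumes fl: "set fs \<subseteq> flags" and dist: "distinct (map pt fs)"
    and V: "{v. v extreme_point_of F} = pt ` set fs"
    and edges: "\<And>i. i < length fs \<Longrightarrow>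
      closed_segment (pt (fs ! i)) (pt (fs ! (Suc i mod length fs))) edge_of F"
  shows "cyclic_labelling F (map flag_perm fs)"
  unfolding cyclic_labelling_def
proof (intro conjI allI impI)
  have pt: "perm_point (flag_perm xs) = pt xs" if "xs \<in> set fs" for xs
    using that fl flag_perm(2) by blast
  have "map perm_point (map flag_perm fs) = map pt fs"
    using pt by simp
  then show "distinct (map flag_perm fs)"
    using dist by (metis distinct_map)
  show "set (map flag_perm fs) \<subseteq> Sym CARD('n)"
    using fl flag_perm(1) by auto
  show "perm_point ` set (map flag_perm fs) = {v. v extreme_point_of F}"
    unfolding V using pt by (force simp: image_image)
  fix i assume "i < length (map flag_perm fs)"
  then have i: "i < length fs" "Suc i mod length fs < length fs"
    by (simp_all add: mod_less_divisor[OF le_less_trans[OF le0]])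
  then show "closed_segment (perm_point (map flag_perm fs ! i))
      (perm_point (map flag_perm fs ! (Suc i mod length (map flag_perm fs)))) edge_of F"
    using edges[OF i(1)] pt by simp
qed

text \<open>Every hexagon or square of flags is a two-dimensional face with an explicit cyclic
  labelling, so the conditions on labelled faces reach each local relation.\<close>

lemma local_conditions_of_labellings:
  fixes w :: "(nat \<Rightarrow> nat) \<Rightarrow> real"
  assumes hex: "\<And>(F :: (real ^ 'n::{finite,linorder}) set) a b c d e f.
      two_face F permutahedron \<Longrightarrow> cyclic_labelling F [a, b, c, d, e, f] \<Longrightarrow>
        w a + w c + w e = w b + w d + w f \<and>
        max_attained_twice (w a + w d) (w b + w e) (w c + w f)"
    and sq: "\<And>(F :: (real ^ 'n::{finite,linorder}) set) a b c d.
      two_face F permutahedron \<Longrightarrow> cyclic_labelling F [a, b, c, d] \<Longrightarrow> w a + w c = w b + w d"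
  shows "local_conditions (vertex_height w :: real ^ 'n::{finite,linorder} \<Rightarrow> real)"
  unfolding local_conditions_def square_additive_def hexagon_additive_def hexagon_max_def
proof (intro conjI allI impI)
  fix p q r :: "'n list" and a b c d
  assume fl: "p @ a # b # q @ c # d # r \<in> flags"
  let ?F = "convex hull (pt ` square_flags p a b q c d r)"
  let ?fs = "[p @ a # b # q @ c # d # r, p @ b # a # q @ c # d # r,
     p @ b # a # q @ d # c # r, p @ a # b # q @ d # c # r]"
  have "cyclic_labelling ?F (map flag_perm ?fs)"
  proof (rule cyclic_labelling_flags)
    show "set ?fs \<subseteq> flags"
      using fl by (auto simp: permutations_of_set_def insert_commute)
    show "distinct (map pt ?fs)"
      using square_points_distinct[OF fl] by simp
    show "{v. v extreme_point_of ?F} = pt ` set ?fs"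
      using square_face(2)[OF fl] by simp
    fix i assume "i < length ?fs"
    then have "i = 0 \<or> i = 1 \<or> i = 2 \<or> i = 3"
      by auto
    then show "closed_segment (pt (?fs ! i)) (pt (?fs ! (Suc i mod length ?fs))) edge_of ?F"
      using square_edges[OF fl] by (elim disjE) simp_all
  qed
  then show "vertex_height w (pt (p @ a # b # q @ c # d # r)) + vertex_height w (pt (p @ b # a # q @ d # c # r))
    = vertex_height w (pt (p @ b # a # q @ c # d # r)) + vertex_height w (pt (p @ a # b # q @ d # c # r))"
    using sq[OF square_face(1)[OF fl]] by (simp add: vertex_height_pt)
next
  fix p q :: "'n list" and i j k
  assume fl: "p @ i # j # k # q \<in> flags"
  let ?F = "convex hull (pt ` hexagon_flags p i j k q)"
  let ?fs = "[p @ i # j # k # q, p @ j # i # k # q, p @ j # k # i # q,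
     p @ k # j # i # q, p @ k # i # j # q, p @ i # k # j # q]"
  have "cyclic_labelling ?F (map flag_perm ?fs)"
  proof (rule cyclic_labelling_flags)
    show "set ?fs \<subseteq> flags"
      using fl flags_rename[OF fl] by simp
    show "distinct (map pt ?fs)"
      using hexagon_points_distinct[OF fl] by simp
    show "{v. v extreme_point_of ?F} = pt ` set ?fs"
      using hexagon_face(2)[OF fl] by simp
    note ren = hexagon_flags_rename[where p = p and i = i and j = j and k = k and q = q]
    note edges = hexagon_edges[OF fl] hexagon_edges[OF flags_rename(1)[OF fl], unfolded ren]
      hexagon_edges[OF flags_rename(2)[OF fl], unfolded ren]
    fix m assume "m < length ?fs"
    then have "m = 0 \<or> m = 1 \<or> m = 2 \<or> m = 3 \<or> m = 4 \<or> m = 5"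
      by auto
    then show "closed_segment (pt (?fs ! m)) (pt (?fs ! (Suc m mod length ?fs))) edge_of ?F"
      using edges by (elim disjE) simp_all
  qed
  then have "cyclic_labelling ?F [flag_perm (p @ i # j # k # q), flag_perm (p @ j # i # k # q),
      flag_perm (p @ j # k # i # q), flag_perm (p @ k # j # i # q), flag_perm (p @ k # i # j # q),
      flag_perm (p @ i # k # j # q)]"
    by simp
  from hex[OF hexagon_face(1)[OF fl] this]
  show "vertex_height w (pt (p @ i # j # k # q)) + vertex_height w (pt (p @ j # k # i # q))
        + vertex_height w (pt (p @ k # i # j # q))
      = vertex_height w (pt (p @ j # i # k # q)) + vertex_height w (pt (p @ k # j # i # q))
        + vertex_height w (pt (p @ i # k # j # q))"
    "max_attained_twice (vertex_height w (pt (p @ i # j # k # q)) + vertex_height w (pt (p @ k # j # i # q)))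
      (vertex_height w (pt (p @ j # i # k # q)) + vertex_height w (pt (p @ k # i # j # q)))
      (vertex_height w (pt (p @ j # k # i # q)) + vertex_height w (pt (p @ i # k # j # q)))"
    by (simp_all add: vertex_height_pt)
qed

text \<open>The number of vertices tells a labelled hexagon from a labelled square.\<close>

lemma labelling_card:
  fixes F :: "(real ^ 'n::{finite,linorder}) set"
  assumes "cyclic_labelling F xs"
  shows "card {v. v extreme_point_of F} = length xs"
  using cyclic_labellingD(3)[OF assms] distinct_card[OF cyclic_labellingD(1)[OF assms]] by simp

lemma labelled_hexagon:
  fixes F :: "(real ^ 'n::{finite,linorder}) set"
  assumes loc: "local_conditions (vertex_height w :: real ^ 'n::{finite,linorder} \<Rightarrow> real)"
    and F: "two_face F permutahedron" and lab: "cyclic_labelling F [a, b, c, d, e, f]"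
  shows "w a + w c + w e = w b + w d + w f \<and>
    max_attained_twice (w a + w d) (w b + w e) (w c + w f)"
proof -
  note L = cyclic_labellingD[OF lab]
  have h: "vertex_height w (perm_point \<sigma> :: real ^ 'n::{finite,linorder}) = w \<sigma>" if "\<sigma> \<in> {a, b, c, d, e, f}" for \<sigma>
    using that L(2) by (intro vertex_height_perm_point) auto
  from F show ?thesis
  proof (cases rule: two_face_cases)
    case (1 p i j k q)
    have "closed_segment (perm_point a) (perm_point b) edge_of F"
      "closed_segment (perm_point b) (perm_point c) edge_of F"
      "closed_segment (perm_point c) (perm_point d) edge_of F"
      "closed_segment (perm_point d) (perm_point e) edge_of F"
      "closed_segment (perm_point e) (perm_point f) edge_of F"
      using L(4)[of 0] L(4)[of 1] L(4)[of 2] L(4)[of 3] L(4)[of 4] by simp_all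
    from hexagon_labelling[OF loc 1 _ _ this] show ?thesis
      using L(1,3) h by simp
  next
    case (2 p i j q k l r)
    have "card (pt ` square_flags p i j q k l r) = 6"
      using labelling_card[OF lab] unfolding 2(2) by simp
    moreover have "card (pt ` square_flags p i j q k l r) \<le> card (square_flags p i j q k l r)"
      by (rule card_image_le) simp
    moreover have "card (square_flags p i j q k l r) \<le> 4"
      using card_length[of "[p @ i # j # q @ k # l # r, p @ j # i # q @ k # l # r,
        p @ j # i # q @ l # k # r, p @ i # j # q @ l # k # r]"] by simp
    ultimately show ?thesis by linarith
  qed
qed

lemma labelled_square:
  fixes F :: "(real ^ 'n::{finite,linorder}) set"
  assumes loc: "local_conditions (vertex_height w :: real ^ 'n::{finite,linorder} \<Rightarrow> real)"
    and F: "two_face F permutahedron" and lab: "cyclic_labelling F [a, b, c, d]"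
  shows "w a + w c = w b + w d"
proof -
  note L = cyclic_labellingD[OF lab]
  have h: "vertex_height w (perm_point \<sigma> :: real ^ 'n::{finite,linorder}) = w \<sigma>" if "\<sigma> \<in> {a, b, c, d}" for \<sigma>
    using that L(2) by (intro vertex_height_perm_point) auto
  from F show ?thesis
  proof (cases rule: two_face_cases)
    case (1 p i j k q)
    have "card (pt ` hexagon_flags p i j k q) = 4"
      using labelling_card[OF lab] unfolding 1(2) by simp
    moreover have "card (pt ` hexagon_flags p i j k q) = 6"
      using distinct_card[OF hexagon_points_distinct[OF 1(1)]] by simp
    ultimately show ?thesis by linarith
  next
    case (2 p i j q k l r)
    have "closed_segment (perm_point a) (perm_point b) edge_of F"
      "closed_segment (perm_point b) (perm_point c) edge_of F"
      "closed_segment (perm_point c) (perm_point d) edge_of F"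
      "closed_segment (perm_point d) (perm_point a) edge_of F"
      using L(4)[of 0] L(4)[of 1] L(4)[of 2] L(5) by simp_all
    from square_labelling[OF loc 2 _ _ this] show ?thesis
      using L(1,3) h by simp
  qed
qed

theorem theorem14:
  fixes w :: "(nat \<Rightarrow> nat) \<Rightarrow> real"
  shows
    "(induces_permutahedral_subdivision w (permutahedron :: (real ^ 'n::{finite,linorder}) set)
        \<longleftrightarrow> (\<forall>F :: (real ^ 'n::{finite,linorder}) set. two_face F permutahedron
               \<longrightarrow> induces_permutahedral_subdivision w F))
     \<and>
     (induces_permutahedral_subdivision w (permutahedron :: (real ^ 'n::{finite,linorder}) set)
        \<longleftrightarrow>
          (\<forall>(F :: (real ^ 'n::{finite,linorder}) set) a b c d e f.
              two_face F permutahedron \<and> cyclic_labelling F [a, b, c, d, e, f] \<longrightarrow>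
                w a + w c + w e = w b + w d + w f \<and>
                max_attained_twice (w a + w d) (w b + w e) (w c + w f))
          \<and>
          (\<forall>(F :: (real ^ 'n::{finite,linorder}) set) a b c d.
              two_face F permutahedron \<and> cyclic_labelling F [a, b, c, d] \<longrightarrow>
                w a + w c = w b + w d))"
    (is "(?A \<longleftrightarrow> ?B) \<and> (?A \<longleftrightarrow> ?C)")
proof -
  \<comment> \<open>Everything passes through the local conditions: \<open>?A\<close>,
    \<open>?B\<close>, \<open>?L\<close> form a cycle of implications, and \<open>?C\<close> is
    equivalent to \<open>?L\<close>.\<close>
  let ?L = "local_conditions (vertex_height w :: real ^ 'n::{finite,linorder} \<Rightarrow> real)"
  have "?A \<Longrightarrow> ?B"
    unfolding induces_permutahedral_subdivision_def using permutahedral_imp_two_face by blast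
  moreover have "?B \<Longrightarrow> ?L"
    unfolding induces_permutahedral_subdivision_def by (intro local_conditions_of_two_faces) blast
  moreover have "?L \<Longrightarrow> ?C"
    using labelled_hexagon labelled_square by blast
  moreover have "?C \<Longrightarrow> ?L"
    by (intro local_conditions_of_labellings) blast+
  moreover have "?L \<Longrightarrow> ?A"
    unfolding induces_permutahedral_subdivision_def by (rule permutahedral_of_local_conditions)
  ultimately show ?thesis by blast
qed

end
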